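(* Let $\mathbf X$ and $\mathbf Y$ be independent random vectors with values in $\mathbb R^{d_{\mathbf X}}$ and $\mathbb R^{d_{\mathbf Y}}$, with $\mathbf X\in \mathrm{RV}(\alpha_{\mathbf X},\mu^{\mathbf X})$ and $\mathbf Y\in \mathrm{RV}(\alpha_{\mathbf Y},\mu^{\mathbf Y})$. Let $a_{\mathbf X},a_{\mathbf Y}>0$ and let $\psi:\mathbb R^{d_{\mathbf X}}\times\mathbb R^{d_{\mathbf Y}}\to\mathbb R^{d_{\mathbf Z}}$ be continuous with $\psi(s\mathbf x,t\mathbf y)=s^{a_{\mathbf X}}t^{a_{\mathbf Y}}\psi(\mathbf x,\mathbf y)$ for all $s,t\ge 0$, $\mathbf x\in\mathbb R^{d_{\mathbf X}}$, $\mathbf y\in\mathbb R^{d_{\mathbf Y}}$. Assume that the following limits exist and are finite: $$c_{\mathbf X}=\lim_{t\to\infty}\frac{\mathbb P(\|\mathbf X\|^{a_{\mathbf X}}>t)}{\mathbb P(\|\mathbf X\|^{a_{\mathbf X}}\|\mathbf Y\|^{a_{\mathbf Y}}>t)},\qquad c_{\mathbf Y}=\lim_{t\to\infty}\frac{\mathbb P(\|\mathbf Y\|^{a_{\mathbf Y}}>t)}{\mathbb P(\|\mathbf X\|^{a_{\mathbf X}}\|\mathbf Y\|^{a_{\mathbf Y}}>t)}.$$ Put $\mathbf Z=\psi(\mathbf X,\mathbf Y)$. Then, as $t\to\infty$, $$\frac{\mathbb P(t^{-1}\mathbf Z\in\cdot)}{\mathbb P(\|\mathbf X\|^{a_{\mathbf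 X}}\|\mathbf Y\|^{a_{\mathbf Y}}>t)}\stackrel{v}{\to}\eta(\cdot),$$ where $$\begin{aligned}\eta(\cdot)=&\Big(1-c_{\mathbf X}\,\mathbb E\big[\|\mathbf Y\|^{\alpha_{\mathbf X}a_{\mathbf Y}/a_{\mathbf X}}\big]-c_{\mathbf Y}\,\mathbb E\big[\|\mathbf X\|^{\alpha_{\mathbf Y}a_{\mathbf X}/a_{\mathbf Y}}\big]\Big)\,\mathbb E\big[\mu^{\mathbf X}(\{\mathbf x:\psi(\mathbf x,\Theta_{\mathbf Y})\in\cdot\})\big]\\&+c_{\mathbf X}\,\mathbb E\big[\mu^{\mathbf X}(\{\mathbf x:\psi(\mathbf x,\mathbf Y)\in\cdot\})\big]+c_{\mathbf Y}\,\mathbb E\big[\mu^{\mathbf Y}(\{\mathbf y:\psi(\mathbf X,\mathbf y)\in\cdot\})\big].\end{aligned}$$ In particular, if $\eta$ is non-null, then $\mathbf Z\in\mathrm{RV}(\alpha_{\mathbf Z},\mu^{\mathbf Z})$, where $\alpha_{\mathbf Z}=\min\big(\frac{\alpha_{\mathbf X}}{a_{\mathbf X}},\frac{\alpha_{\mathbf Y}}{a_{\mathbf Y}}\big)$ and $\mu^{\mathbf Z}(\cdot)=\eta(\cdot)/\eta(\{\mathbf z:\|\mathbf z\|>1\})$.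
   Context: Each space $\mathbb R^d$ is equipped with an arbitrary fixed norm $\|\cdot\|$; $\mathbb R^d_{\mathbf 0}=\mathbb R^d\setminus\{\mathbf 0\}$. For measures on $\mathbb R^d_{\mathbf 0}$, $\mu_t\stackrel{v}{\to}\mu$ (vague convergence) means $\int f\,d\mu_t\to\int f\,d\mu$ for every non-negative continuous $f$ on $\mathbb R^d_{\mathbf 0}$ with compact support in $\mathbb R^d_{\mathbf 0}$ (so the support is bounded and bounded away from zero). A random vector $\mathbf X$ in $\mathbb R^d$ is regularly varying with index $\alpha>0$ and limit measure $\mu^{\mathbf X}$, written $\mathbf X\in\mathrm{RV}(\alpha,\mu^{\mathbf X})$, if $\mu^{\mathbf X}$ is a non-null Radon measure on $\mathbb R^d_{\mathbf 0}$ such that $\mathbb P(t^{-1}\mathbf X\in\cdot)/\mathbb P(\|\mathbf X\|>t)\stackrel{v}{\to}\mu^{\mathbf X}(\cdot)$ as $t\to\infty$, and $\mu^{\mathbf X}(tA)=t^{-\alpha}\mu^{\mathbf X}(A)$ for all $t>0$ and Borel $A$. Equivalently, given $\|\mathbf X\|>x$, the pair $(\mathbf X/\|\mathbf X\|,\|\mathbf X\|/x)$ converges in distribution as $x\to\infty$ to $(\Theta_{\mathbf X},Z)$ with $\Theta_{\mathbf X}$ and $Z$ independent, $\mathbb P(Z>y)=y^{-\alpha}$ for $y>1$, and $\Theta_{\mathbf X}$ (whose law is the spectral distribution of $\mathbf X$) with values in the unit sphere of $\|\cdot\|$. The same notation $\Theta_{\mathbf Y}$ is used for $\mathbf Y$.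 Sets in the argument of $\eta$ are Borel subsets of $\mathbb R^{d_{\mathbf Z}}_{\mathbf 0}$. The convention $0\cdot\infty=0$ is used in the definition of $\eta$. *)

theory Defs
  imports "HOL-Probability.Probability"
begin

text \<open>The norm on each space is an arbitrary parameter \<open>N\<close>, in general different from the
  Euclidean norm of the type class; topology and Borel sets do not depend on it.\<close>

definition is_norm :: "('a::real_vector \<Rightarrow> real) \<Rightarrow> bool" where
  "is_norm N \<longleftrightarrow>
     (\<forall>x. N x = 0 \<longleftrightarrow> x = 0) \<and>
     (\<forall>c x. N (c *\<^sub>R x) = \<bar>c\<bar> * N x) \<and>
     (\<forall>x y. N (x + y) \<le> N x + N y)"

text \<open>The library constant \<open>indep_var\<close> requires both variables to have the same range type; this is
  what it unfolds to for different range types.\<close>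

definition indep_vectors ::
  "'w measure \<Rightarrow> ('w \<Rightarrow> 'a::euclidean_space) \<Rightarrow> ('w \<Rightarrow> 'b::euclidean_space) \<Rightarrow> bool" where
  "indep_vectors M X Y \<longleftrightarrow>
     X \<in> borel_measurable M \<and> Y \<in> borel_measurable M \<and>
     prob_space.indep_set M
       {X -` A \<inter> space M | A. A \<in> sets borel} {Y -` B \<inter> space M | B. B \<in> sets borel}"

abbreviation punctured_borel :: "'a::euclidean_space measure" where
  "punctured_borel \<equiv> restrict_space borel (- {0})"

text \<open>On the punctured space, which is locally compact with countable base, a Borel measure that is
  finite on compact sets is automatically regular.\<close>

definition radon_measure :: "'a::euclidean_space measure \<Rightarrow> bool" where
  "radon_measure \<mu> \<longleftrightarrow>
     sets \<mu> = sets punctured_borel \<and>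
     (\<forall>K. compact K \<and> K \<subseteq> - {0} \<longrightarrow> emeasure \<mu> K < \<infinity>)"

definition vague_conv :: "(real \<Rightarrow> 'a::euclidean_space measure) \<Rightarrow> 'a measure \<Rightarrow> bool" where
  "vague_conv \<mu>t \<mu> \<longleftrightarrow>
     (\<forall>f :: 'a \<Rightarrow> real.
        continuous_on (- {0}) f \<and> (\<forall>x\<in>- {0}. 0 \<le> f x) \<and>
        (\<exists>K. compact K \<and> K \<subseteq> - {0} \<and> (\<forall>x\<in>- {0} - K. f x = 0)) \<longrightarrow>
        ((\<lambda>t. \<integral>\<^sup>+x. ennreal (f x) \<partial>\<mu>t t) \<longlongrightarrow> (\<integral>\<^sup>+x. ennreal (f x) \<partial>\<mu>)) at_top)"

text \<open>The measure \<open>P(X / t \<in> \<cdot>) / r t\<close> on the punctured space.\<close>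

definition normalized_law ::
  "'w measure \<Rightarrow> ('w \<Rightarrow> 'a::euclidean_space) \<Rightarrow> (real \<Rightarrow> real) \<Rightarrow> real \<Rightarrow> 'a measure" where
  "normalized_law M X r t =
     scale_measure (ennreal (1 / r t))
       (restrict_space (distr M borel (\<lambda>\<omega>. (1 / t) *\<^sub>R X \<omega>)) (- {0}))"

definition regularly_varying ::
  "'w measure \<Rightarrow> ('a::euclidean_space \<Rightarrow> real) \<Rightarrow> ('w \<Rightarrow> 'a) \<Rightarrow> real \<Rightarrow> 'a measure \<Rightarrow> bool" where
  "regularly_varying M N X \<alpha> \<mu> \<longleftrightarrow>
     X \<in> borel_measurable M \<and> 0 < \<alpha> \<and>
     radon_measure \<mu> \<and> emeasure \<mu> (space \<mu>) \<noteq> 0 \<and>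
     vague_conv (normalized_law M X (\<lambda>t. measure M {\<omega> \<in> space M. N (X \<omega>) > t})) \<mu> \<and>
     (\<forall>t>0. \<forall>A\<in>sets \<mu>. emeasure \<mu> ((\<lambda>x. t *\<^sub>R x) ` A) = ennreal (t powr (- \<alpha>)) * emeasure \<mu> A)"

text \<open>\<open>\<Theta>\<close>, defined on an arbitrary probability space \<open>P\<close>, is a spectral vector of \<open>X\<close>: given
  \<open>N X > x\<close>, the pair \<open>(X / N X, N X / x)\<close> converges in distribution to a pair of independent
  components, the first distributed as \<open>\<Theta>\<close> and the second with the Pareto law \<open>\<zeta>\<close>; independence
  is expressed by the product measure.\<close>

definition spectral_vector ::
  "'w measure \<Rightarrow> ('a::euclidean_space \<Rightarrow> real) \<Rightarrow> ('w \<Rightarrow> 'a) \<Rightarrow> real \<Rightarrow>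
   'p measure \<Rightarrow> ('p \<Rightarrow> 'a) \<Rightarrow> bool" where
  "spectral_vector M N X \<alpha> P \<Theta> \<longleftrightarrow>
     prob_space P \<and> \<Theta> \<in> borel_measurable P \<and> (AE \<omega> in P. N (\<Theta> \<omega>) = 1) \<and>
     (\<exists>\<zeta> :: real measure.
        prob_space \<zeta> \<and> sets \<zeta> = sets borel \<and>
        (\<forall>y>1. measure \<zeta> {y<..} = y powr (- \<alpha>)) \<and>
        (\<forall>f :: 'a \<times> real \<Rightarrow> real. continuous_on UNIV f \<and> bounded (range f) \<longrightarrow>
           ((\<lambda>x. \<integral>\<omega>. f ((1 / N (X \<omega>)) *\<^sub>R X \<omega>, N (X \<omega>) / x)
                    \<partial>uniform_measure M {\<omega> \<in> space M. N (X \<omega>) > x})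
              \<longlongrightarrow> (\<integral>p. f p \<partial>(distr P borel \<Theta> \<Otimes>\<^sub>M \<zeta>))) at_top))"

end

theory Submission
  imports Defs
begin

text \<open>Write \<open>R = \<parallel>X\<parallel>\<^sup>a\<close> and \<open>S = \<parallel>Y\<parallel>\<^sup>b\<close> for the two radii, raised to the degrees of homogeneity \<open>a\<close>
  and \<open>b\<close> of \<open>\<psi>\<close>. They are independent with regularly varying tails, and \<open>Z = \<psi>(X, Y)\<close> can be of
  size \<open>t\<close> only if \<open>R S\<close> is of size \<open>t\<close>. There are three ways in which \<open>R S\<close> can be large, separated
  by a level \<open>K\<close>.

  \<^item> \<open>S \<le> K\<close>. Then \<open>X\<close> alone is extreme. For fixed \<open>Y = y\<close> the regular variation of \<open>X\<close> applies,
    and integrating over \<open>y\<close> gives \<open>c\<^sub>X E[\<mu>\<^sup>X{\<psi>(\<cdot>, Y) \<in> \<cdot>}; S \<le> K]\<close>.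
  \<^item> \<open>S > t / K\<close>. Symmetrically, \<open>Y\<close> alone is extreme.
  \<^item> \<open>K < S \<le> t / K\<close>. Then both are extreme. For fixed \<open>y\<close>, with direction \<open>\<theta>\<close> and radius \<open>s\<close>,
    homogeneity turns the probability of interest into one for \<open>\<psi>(X, \<theta>)\<close> at level \<open>t / s \<ge> K\<close>.
    This is \<open>P(R > t / s) \<kappa>(\<theta>)\<close> for some function \<open>\<kappa>\<close>, up to an error that is small compared
    with \<open>P(R > t / s)\<close> uniformly in \<open>\<theta>\<close>. Next fix \<open>X\<close> instead: the expectation of \<open>\<kappa>(\<theta>)\<close> is then taken over sets on which \<open>S\<close>
    exceeds a level at least \<open>K\<close>, where the direction of \<open>Y\<close> already has almost the spectral law.
    So the weight \<open>\<kappa>(\<theta>)\<close> can be replaced by its mean \<open>E \<kappa>(\<Theta>)\<close>, and the contribution is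
    \<open>E \<kappa>(\<Theta>) P(R S > t, K < S \<le> t / K)\<close>. The probability here is what the other two regimes leave
    over, which after division by \<open>P(R S > t)\<close> tends to
    \<open>1 - c\<^sub>X E[S\<^bsup>\<alpha>\<^esup>; S \<le> K] - c\<^sub>Y E[min(R, K)\<^bsup>\<beta>\<^esup>]\<close> with \<open>\<alpha>\<close> and \<open>\<beta>\<close> the tail indices of \<open>R\<close> and
    \<open>S\<close>.

  Letting \<open>K \<rightarrow> \<infinity>\<close> gives the three terms of \<open>\<eta>\<close>. This is \<open>functional_limit\<close> below, proved for
  functionals \<open>F(x, y)\<close> that have the same homogeneity as functions of \<open>\<psi>(x, y)\<close>; the uniformity in
  the middle regime is \<open>parametric_tail_limit\<close>.

  For the regular variation of \<open>Z\<close> it remains to see that \<open>\<eta>\<close> is homogeneous with the smaller of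
  the two indices. Applied to functions of \<open>R S\<close>, the same limit theorem shows that
  \<open>P(R S > l t) / P(R S > t)\<close> tends to a convex combination of \<open>l\<^bsup>-\<alpha>\<^esup>\<close> and \<open>l\<^bsup>-\<beta>\<^esup>\<close> (\<open>h_ratio\<close>). As
  \<open>P(R > t)\<close> and \<open>P(S > t)\<close> are at most of the order of \<open>P(R S > t)\<close>, this combination can be no
  smaller at \<open>l = 2\<close> than either of the two powers. So if the indices differ, all weight is on the smaller one,
  and the terms of \<open>\<eta>\<close> with the other index vanish (\<open>heavier_X\<close>, \<open>heavier_Y\<close>).\<close>

section \<open>Norms\<close>

lemma
  assumes "is_norm N"
  shows is_norm_zero: "N 0 = 0"
    and is_norm_eq_0_iff: "N x = 0 \<longleftrightarrow> x = 0"
    and is_norm_scaleR: "N (c *\<^sub>R x) = \<bar>c\<bar> * N x"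
    and is_norm_triangle: "N (x + y) \<le> N x + N y"
    and is_norm_nonneg: "0 \<le> N x"
proof -
  show "N 0 = 0" "N x = 0 \<longleftrightarrow> x = 0" "N (c *\<^sub>R x) = \<bar>c\<bar> * N x" "N (x + y) \<le> N x + N y"
    using assms unfolding is_norm_def by auto
  have "N (x + (-1) *\<^sub>R x) \<le> N x + N ((-1) *\<^sub>R x)"
    using assms unfolding is_norm_def by blast
  moreover have "N ((-1) *\<^sub>R x) = \<bar>-1\<bar> * N x" "N (x + (-1) *\<^sub>R x) = 0"
    using assms unfolding is_norm_def by (blast, simp)
  ultimately show "0 \<le> N x"
    by simp
qed

lemma is_norm_sum_le:
  assumes "is_norm N" "finite I"
  shows "N (\<Sum>i\<in>I. f i) \<le> (\<Sum>i\<in>I. N (f i))"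
  using assms(2)
proof induction
  case empty
  then show ?case by (simp add: is_norm_zero[OF assms(1)])
next
  case (insert i I)
  then show ?case
    using is_norm_triangle[OF assms(1), of "f i" "sum f I"] by simp
qed

lemma is_norm_le_norm:
  fixes N :: "'a::euclidean_space \<Rightarrow> real"
  assumes N: "is_norm N"
  obtains B where "B > 0" "\<And>x. N x \<le> B * norm x"
proof -
  define B where "B = (\<Sum>b\<in>Basis. N (b::'a)) + 1"
  have Bpos: "B > 0"
    unfolding B_def by (intro add_nonneg_pos sum_nonneg is_norm_nonneg[OF N]) auto
  have "N x \<le> B * norm x" for x
  proof -
    have "N x = N (\<Sum>b\<in>Basis. (x \<bullet> b) *\<^sub>R b)"
      by (simp add: euclidean_representation)
    also have "\<dots> \<le> (\<Sum>b\<in>Basis. N ((x \<bullet> b) *\<^sub>R b))"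
      by (rule is_norm_sum_le[OF N]) simp
    also have "\<dots> = (\<Sum>b\<in>Basis. \<bar>x \<bullet> b\<bar> * N b)"
      by (simp add: is_norm_scaleR[OF N])
    also have "\<dots> \<le> (\<Sum>b\<in>Basis. norm x * N b)"
      by (intro sum_mono mult_right_mono Basis_le_norm is_norm_nonneg[OF N])
    also have "\<dots> \<le> B * norm x"
      by (simp add: B_def algebra_simps sum_distrib_left)
    finally show ?thesis .
  qed
  with Bpos show thesis by (rule that)
qed

lemma is_norm_continuous:
  fixes N :: "'a::euclidean_space \<Rightarrow> real"
  assumes N: "is_norm N"
  shows "continuous_on A N"
proof -
  obtain B where B: "B > 0" "\<And>x. N x \<le> B * norm x"
    using is_norm_le_norm[OF N] by blast
  have *: "N x - N y \<le> B * norm (x - y)" for x y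
    using is_norm_triangle[OF N, of "x - y" y] B(2)[of "x - y"] by simp
  have "\<bar>N x - N y\<bar> \<le> B * dist x y" for x y
    using *[of x y] *[of y x] by (auto simp: dist_norm norm_minus_commute abs_le_iff)
  then have "B-lipschitz_on A N"
    using B(1) by (intro lipschitz_onI) (auto simp: dist_real_def)
  then show ?thesis
    by (rule lipschitz_on_continuous_on)
qed

lemma norm_le_is_norm:
  fixes N :: "'a::euclidean_space \<Rightarrow> real"
  assumes N: "is_norm N"
  obtains c where "c > 0" "\<And>x. norm x \<le> c * N x"
proof -
  let ?S = "sphere (0::'a) 1"
  have ne: "?S \<noteq> {}"
    by simp
  obtain z where z: "z \<in> ?S" "\<And>x. x \<in> ?S \<Longrightarrow> N z \<le> N x"
    using continuous_attains_inf[OF _ ne is_norm_continuous[OF N]] by auto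
  have zpos: "N z > 0"
    using z(1) is_norm_nonneg[OF N, of z] is_norm_eq_0_iff[OF N, of z]
    by (auto simp: less_le)
  have "norm x \<le> (1 / N z) * N x" for x
  proof (cases "x = 0")
    case False
    then have "N z \<le> N ((1 / norm x) *\<^sub>R x)"
      by (intro z(2)) simp
    then show ?thesis
      using zpos False by (simp add: is_norm_scaleR[OF N] field_simps)
  qed (simp add: is_norm_zero[OF N])
  with zpos show thesis
    by (intro that[of "1 / N z"]) auto
qed

lemma is_norm_compact:
  fixes N :: "'a::euclidean_space \<Rightarrow> real"
  assumes N: "is_norm N"
  shows "compact {x. l \<le> N x \<and> N x \<le> u}"
proof -
  obtain c where c: "c > 0" "\<And>x. norm x \<le> c * N x"
    using norm_le_is_norm[OF N] by blast
  have "norm x \<le> c * u" if "N x \<le> u" for x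
    using c(2)[of x] mult_left_mono[OF that, of c] c(1) by linarith
  then have "bounded {x. l \<le> N x \<and> N x \<le> u}"
    by (auto simp: bounded_iff)
  moreover have "closed {x. l \<le> N x \<and> N x \<le> u}"
    by (intro closed_Collect_conj closed_Collect_le continuous_intros is_norm_continuous[OF N])
  ultimately show ?thesis
    by (simp add: compact_eq_bounded_closed)
qed

lemma is_norm_borel_measurable:
  fixes N :: "'a::euclidean_space \<Rightarrow> real"
  assumes "is_norm N"
  shows "N \<in> borel_measurable borel"
  by (rule borel_measurable_continuous_onI[OF is_norm_continuous[OF assms]])

section \<open>Squeezing and cut-off functions\<close>

text \<open>Indicators are not continuous, so their limits are obtained from those of cut-off functions that
  bound them up to an error depending on a parameter \<open>e\<close>, which is then sent to \<open>0\<close>.\<close>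

lemma tendsto_squeeze_param:
  fixes x :: "'i \<Rightarrow> real" and lo hi :: "real \<Rightarrow> real"
  assumes lower: "\<And>e. 0 < e \<Longrightarrow> e < e0 \<Longrightarrow>
      \<exists>l L. (\<forall>\<^sub>F t in F. l t \<le> x t) \<and> (l \<longlongrightarrow> L) F \<and> lo e \<le> L"
    and upper: "\<And>e. 0 < e \<Longrightarrow> e < e0 \<Longrightarrow>
      \<exists>u U. (\<forall>\<^sub>F t in F. x t \<le> u t) \<and> (u \<longlongrightarrow> U) F \<and> U \<le> hi e"
    and "0 < e0"
    and lo: "(lo \<longlongrightarrow> c) (at_right 0)" and hi: "(hi \<longlongrightarrow> c) (at_right 0)"
  shows "(x \<longlongrightarrow> c) F"
proof (rule order_tendstoI)
  have ev: "\<forall>\<^sub>F e in at_right 0. 0 < e \<and> e < e0"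
    using \<open>0 < e0\<close> by (auto simp: eventually_at_right_field)
  fix d
  {
    assume "d < c"
    with lo have "\<forall>\<^sub>F e in at_right 0. d < lo e"
      by (rule order_tendstoD)
    with ev have "\<forall>\<^sub>F e in at_right (0::real). (0 < e \<and> e < e0) \<and> d < lo e"
      by (rule eventually_conj)
    then obtain e where "0 < e" "e < e0" "d < lo e"
      using eventually_happens'[of "at_right (0::real)"] by (auto simp: trivial_limit_at_right_real)
    with lower[of e] obtain l L where *: "\<forall>\<^sub>F t in F. l t \<le> x t" "(l \<longlongrightarrow> L) F" "d < L"
      by force
    then have "\<forall>\<^sub>F t in F. d < l t"
      by (intro order_tendstoD(1))
    with *(1) show "\<forall>\<^sub>F t in F. d < x t"
      by eventually_elim simp
  next
    assume "c < d"
    with hi have "\<forall>\<^sub>F e in at_right 0. hi e < d"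
      by (rule order_tendstoD)
    with ev have "\<forall>\<^sub>F e in at_right (0::real). (0 < e \<and> e < e0) \<and> hi e < d"
      by (rule eventually_conj)
    then obtain e where "0 < e" "e < e0" "hi e < d"
      using eventually_happens'[of "at_right (0::real)"] by (auto simp: trivial_limit_at_right_real)
    with upper[of e] obtain l L where *: "\<forall>\<^sub>F t in F. x t \<le> l t" "(l \<longlongrightarrow> L) F" "L < d"
      by force
    then have "\<forall>\<^sub>F t in F. l t < d"
      by (intro order_tendstoD(2))
    with *(1) show "\<forall>\<^sub>F t in F. x t < d"
      by eventually_elim simp
  }
qed

definition ramp :: "real \<Rightarrow> real \<Rightarrow> real \<Rightarrow> real" where
  "ramp p q x = max 0 (min 1 ((x - p) / (q - p)))"

lemma ramp_bounds: "0 \<le> ramp p q x" "ramp p q x \<le> 1"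
  by (auto simp: ramp_def)

lemma ramp_eq_0: "p < q \<Longrightarrow> x \<le> p \<Longrightarrow> ramp p q x = 0"
  by (auto simp: ramp_def max_def min_def zero_le_divide_iff)

lemma ramp_eq_1: "p < q \<Longrightarrow> q \<le> x \<Longrightarrow> ramp p q x = 1"
  by (auto simp: ramp_def max_def min_def field_simps)

lemma continuous_on_ramp [continuous_intros]:
  assumes "p < q" "continuous_on A f"
  shows "continuous_on A (\<lambda>x. ramp p q (f x))"
  unfolding ramp_def using assms by (intro continuous_intros) auto

section \<open>Regularly varying laws\<close>

text \<open>Everything is said about the law \<open>L\<close> of the vector; the limit measure is extended to the whole space
  by giving no mass to the origin, so that all functions live on one Borel space. The exponent \<open>a\<close> is
  the degree of homogeneity in this vector of the map of interest.\<close>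

locale regular_tail = prob_space L for L :: "'a::euclidean_space measure" +
  fixes N :: "'a \<Rightarrow> real" and \<alpha> a :: real and \<nu> :: "'a measure"
  assumes sets_L [measurable_cong, simp]: "sets L = sets borel"
    and N: "is_norm N" and \<alpha>_pos: "0 < \<alpha>" and a_pos: "0 < a"
    and sets_\<nu> [measurable_cong, simp]: "sets \<nu> = sets borel"
    and \<nu>_0: "emeasure \<nu> {0} = 0"
    and \<nu>_nonnull: "emeasure \<nu> UNIV \<noteq> 0"
    and \<nu>_compact: "compact K \<Longrightarrow> 0 \<notin> K \<Longrightarrow> emeasure \<nu> K < \<infinity>"
    and \<nu>_homogeneous: "0 < t \<Longrightarrow> A \<in> sets borel \<Longrightarrow>
        emeasure \<nu> ((\<lambda>x. t *\<^sub>R x) -` A) = ennreal (t powr \<alpha>) * emeasure \<nu> A"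
    and vague: "continuous_on UNIV f \<Longrightarrow> (\<And>x. 0 \<le> f x) \<Longrightarrow> compact K \<Longrightarrow> 0 \<notin> K \<Longrightarrow>
        (\<And>x. x \<notin> K \<Longrightarrow> f x = 0) \<Longrightarrow>
        ((\<lambda>t. (\<integral>x. f ((1 / t) *\<^sub>R x) \<partial>L) / measure L {x. t < N x}) \<longlongrightarrow> (\<integral>x. f x \<partial>\<nu>)) at_top"
begin

lemma space_L [simp]: "space L = UNIV"
  using sets_eq_imp_space_eq[OF sets_L] by simp

lemma space_\<nu> [simp]: "space \<nu> = UNIV"
  using sets_eq_imp_space_eq[OF sets_\<nu>] by simp

lemma N_measurable [measurable]: "N \<in> borel_measurable borel"
  by (rule is_norm_borel_measurable[OF N])

lemma N_continuous [continuous_intros]: "continuous_on A f \<Longrightarrow> continuous_on A (\<lambda>x. N (f x))"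
  by (rule continuous_on_compose2[OF is_norm_continuous[OF N, of UNIV]]) auto

lemma N_nonneg [simp]: "0 \<le> N x"
  by (rule is_norm_nonneg[OF N])

lemma N_0 [simp]: "N 0 = 0"
  by (rule is_norm_zero[OF N])

lemma N_scaleR [simp]: "N (c *\<^sub>R x) = \<bar>c\<bar> * N x"
  by (rule is_norm_scaleR[OF N])

definition T :: "real \<Rightarrow> real" where
  "T t = measure L {x. t < N x}"

lemma T_nonneg [simp]: "0 \<le> T t"
  by (simp add: T_def)

lemma T_antimono: "s \<le> t \<Longrightarrow> T t \<le> T s"
  unfolding T_def by (rule finite_measure_mono) auto

lemma integral_indicator_tail:
  "(\<integral>x. indicator {x. t < N x} x \<partial>L) = T t"
  by (simp add: T_def)

lemma integrable_L_bounded: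
  assumes [measurable]: "f \<in> borel_measurable borel" and "\<And>x. \<bar>f x\<bar> \<le> B"
  shows "integrable L (f :: 'a \<Rightarrow> real)"
  by (rule integrable_const_bound[where B = B]) (use assms(2) in auto)

text \<open>The product of two ramps is supported on a compact annulus, so multiplying by it turns any
  continuous function into an admissible test function.\<close>

lemma cutoff_continuous:
  assumes "continuous_on UNIV g" "p < p'" "u < u'"
  shows "continuous_on UNIV (\<lambda>x. ramp p p' (N x) * (1 - ramp u u' (N x)) * g x)"
  using assms by (intro continuous_intros) auto

lemma cutoff_limit:
  fixes g :: "'a \<Rightarrow> real"
  assumes g: "continuous_on UNIV g" "\<And>x. 0 \<le> g x" and pu: "0 < p" "p < p'" "u < u'"
  defines "f \<equiv> \<lambda>x. ramp p p' (N x) * (1 - ramp u u' (N x)) * g x"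
  shows "((\<lambda>t. (\<integral>x. f ((1 / t) *\<^sub>R x) \<partial>L) / T t) \<longlongrightarrow> (\<integral>x. f x \<partial>\<nu>)) at_top"
  unfolding T_def
proof (rule vague)
  let ?K = "{x. p \<le> N x \<and> N x \<le> u'}"
  show "continuous_on UNIV f"
    unfolding f_def by (rule cutoff_continuous[OF g(1) pu(2,3)])
  show "0 \<le> f x" for x
    using ramp_bounds[of p p' "N x"] ramp_bounds[of u u' "N x"] g(2)[of x] by (simp add: f_def)
  show "compact ?K" "0 \<notin> ?K"
    using is_norm_compact[OF N, of p u'] pu(1) by auto
  show "f x = 0" if "x \<notin> ?K" for x
    using that pu by (auto simp: f_def ramp_eq_0 ramp_eq_1)
qed

text \<open>The test functions have mass at most \<open>1\<close> for the prelimit measures as soon as they vanish on the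
  unit ball. As the annuli exhaust the complement of the ball, this bounds the limit measure there,
  although that set is not compact.\<close>

lemma emeasure_annulus_le_1:
  assumes "1 < l" "0 < u"
  shows "emeasure \<nu> {x. l \<le> N x \<and> N x \<le> u} \<le> 1"
proof -
  let ?K = "{x. 1 \<le> N x \<and> N x \<le> u + 1}"
  let ?A = "{x. l \<le> N x \<and> N x \<le> u}"
  define f where "f x = ramp 1 l (N x) * (1 - ramp u (u + 1) (N x))" for x
  have K: "compact ?K" "0 \<notin> ?K"
    using is_norm_compact[OF N, of 1 "u + 1"] by auto
  have cont: "continuous_on UNIV f"
    unfolding f_def by (intro continuous_intros) (use assms in auto)
  have f01: "0 \<le> f x" "f x \<le> 1" for x
    using ramp_bounds[of 1 l "N x"] ramp_bounds[of u "u + 1" "N x"]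
    by (auto simp: f_def mult_le_one)
  have f0: "f x = 0" if "x \<notin> ?K" for x
    using that assms by (auto simp: f_def ramp_eq_0 ramp_eq_1)
  have lim: "((\<lambda>t. (\<integral>x. f ((1 / t) *\<^sub>R x) \<partial>L) / T t) \<longlongrightarrow> (\<integral>x. f x \<partial>\<nu>)) at_top"
    using cutoff_limit[of "\<lambda>_. 1" 1 l u "u + 1"] assms by (simp add: f_def)
  have fm [measurable]: "f \<in> borel_measurable borel"
    by (rule borel_measurable_continuous_onI[OF cont])
  have "\<forall>\<^sub>F t in at_top. (\<integral>x. f ((1 / t) *\<^sub>R x) \<partial>L) / T t \<le> 1"
    using eventually_gt_at_top[of 0]
  proof eventually_elim
    case (elim t)
    have "f ((1 / t) *\<^sub>R x) \<le> indicator {x. t < N x} x" for x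
    proof (cases "t < N x")
      case False
      then have "f ((1 / t) *\<^sub>R x) = 0"
        using elim assms by (simp add: f_def ramp_eq_0)
      then show ?thesis by simp
    qed (use f01 in simp)
    then have "(\<integral>x. f ((1 / t) *\<^sub>R x) \<partial>L) \<le> (\<integral>x. indicator {x. t < N x} x \<partial>L)"
      using f01 by (intro integral_mono integrable_L_bounded[where B = 1]) (auto simp: abs_le_iff)
    then show ?case
      unfolding integral_indicator_tail by (auto simp: divide_le_eq_1 less_le)
  qed
  then have le1: "(\<integral>x. f x \<partial>\<nu>) \<le> 1"
    by (rule tendsto_upperbound[OF lim]) simp
  have fin: "emeasure \<nu> ?K < \<infinity>"
    by (rule \<nu>_compact[OF K])
  have "emeasure \<nu> ?A \<le> emeasure \<nu> ?K"
    by (intro emeasure_mono) (use assms in auto)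
  with fin have finA: "emeasure \<nu> ?A < \<infinity>"
    by (simp add: order_le_less_trans)
  have int: "integrable \<nu> f"
  proof (rule Bochner_Integration.integrable_bound)
    show "integrable \<nu> (indicator ?K :: 'a \<Rightarrow> real)"
      using fin by (simp add: integrable_real_indicator)
    show "AE x in \<nu>. norm (f x) \<le> norm (indicator ?K x :: real)"
      using f01 f0 by (auto simp: indicator_def)
  qed simp
  have "measure \<nu> ?A = (\<integral>x. indicator ?A x \<partial>\<nu>)"
    by simp
  also have "\<dots> \<le> (\<integral>x. f x \<partial>\<nu>)"
  proof (rule integral_mono[OF _ int])
    show "integrable \<nu> (indicator ?A :: 'a \<Rightarrow> real)"
      using finA by (simp add: integrable_real_indicator)
    show "indicator ?A x \<le> f x" for x
      using assms f01 by (auto simp: indicator_def f_def ramp_eq_0 ramp_eq_1)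
  qed
  finally have "measure \<nu> ?A \<le> 1"
    using le1 by simp
  with finA show ?thesis
    by (simp add: emeasure_eq_ennreal_measure ennreal_le_1)
qed

lemma \<nu>_tail_le_1: "emeasure \<nu> {x. 1 < N x} \<le> 1"
proof -
  define A where "A n = {x. 1 + 1 / real (Suc n) \<le> N x \<and> N x \<le> real (Suc n)}" for n
  have inc: "incseq A"
  proof (rule incseq_SucI)
    fix n
    have "1 / real (Suc (Suc n)) \<le> 1 / real (Suc n)"
      by (intro divide_left_mono) auto
    then show "A n \<subseteq> A (Suc n)"
      unfolding A_def by auto
  qed
  have Un: "(\<Union>n. A n) = {x. 1 < N x}"
  proof (intro equalityI subsetI)
    fix x assume "x \<in> (\<Union>n. A n)"
    then obtain n where "1 + 1 / real (Suc n) \<le> N x"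
      by (auto simp: A_def)
    moreover have "1 / real (Suc n) > 0"
      by simp
    ultimately have "1 < N x"
      by linarith
    then show "x \<in> {x. 1 < N x}"
      by simp
  next
    fix x assume "x \<in> {x. 1 < N x}"
    then obtain k where k: "1 / real (Suc k) < N x - 1"
      using nat_approx_posE[of "N x - 1"] by auto
    obtain j where j: "N x \<le> real j"
      using real_arch_simple by blast
    have "1 / real (Suc (max k j)) \<le> 1 / real (Suc k)"
      by (intro divide_left_mono) auto
    then have "x \<in> A (max k j)"
      using k j unfolding A_def by auto
    then show "x \<in> (\<Union>n. A n)" by blast
  qed
  have "(SUP n. emeasure \<nu> (A n)) = emeasure \<nu> (\<Union>n. A n)"
    by (rule SUP_emeasure_incseq[OF _ inc]) (auto simp: A_def)
  moreover have "emeasure \<nu> (A n) \<le> 1" for n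
    unfolding A_def by (rule emeasure_annulus_le_1) (auto simp del: of_nat_Suc)
  ultimately show ?thesis
    unfolding Un[symmetric] by (metis SUP_least)
qed

text \<open>The mass of the complement of the unit ball. That it is \<open>1\<close> does not follow directly from vague
  convergence, since mass could escape to infinity.\<close>

definition m :: real where "m = measure \<nu> {x. 1 < N x}"

lemma \<nu>_tail_m:
  assumes "0 < l"
  shows "emeasure \<nu> {x. l < N x} = ennreal (l powr (-\<alpha>) * m)"
proof -
  have "emeasure \<nu> {x. 1 < N x} = ennreal m"
    using \<nu>_tail_le_1 unfolding m_def
    by (intro emeasure_eq_ennreal_measure) (auto simp: top_unique)
  moreover have "(\<lambda>x. (1 / l) *\<^sub>R x) -` {x. 1 < N x} = {x. l < N x}"
    using assms by (auto simp: field_simps)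
  moreover have "(1 / l) powr \<alpha> = l powr (-\<alpha>)"
    using assms by (simp add: powr_divide powr_minus_divide)
  ultimately show ?thesis
    using \<nu>_homogeneous[of "1 / l" "{x. 1 < N x}"] assms by (simp add: ennreal_mult' m_def)
qed

lemma \<nu>_finite_tail: "0 < l \<Longrightarrow> emeasure \<nu> {x. l < N x} < \<infinity>"
  by (simp add: \<nu>_tail_m)

lemma integrable_indicator_tail: "0 < l \<Longrightarrow> integrable \<nu> (indicator {x. l < N x} :: 'a \<Rightarrow> real)"
  using \<nu>_finite_tail by (simp add: integrable_real_indicator)

lemma measure_tail_m: "0 < l \<Longrightarrow> measure \<nu> {x. l < N x} = l powr (-\<alpha>) * m"
  by (rule measure_eq_emeasure_eq_ennreal[OF _ \<nu>_tail_m]) (simp_all add: m_def)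

lemma integrable_\<nu>_bounded:
  assumes [measurable]: "f \<in> borel_measurable borel"
    and "\<And>x. \<bar>f x\<bar> \<le> B" and "0 < \<delta>" and "\<And>x. N x \<le> \<delta> \<Longrightarrow> f x = 0"
  shows "integrable \<nu> (f :: 'a \<Rightarrow> real)"
proof (rule Bochner_Integration.integrable_bound)
  show "integrable \<nu> (\<lambda>x. B * indicator {x. \<delta> < N x} x)"
    using assms(3) integrable_indicator_tail by simp
  show "AE x in \<nu>. norm (f x) \<le> norm (B * indicator {x. \<delta> < N x} x)"
  proof (rule AE_I2)
    fix x
    show "norm (f x) \<le> norm (B * indicator {x. \<delta> < N x} x)"
      using assms(2)[of x] assms(4)[of x] by (cases "\<delta> < N x") auto
  qed
qed simp

lemma m_pos: "0 < m"
proof (rule ccontr)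
  assume "\<not> 0 < m"
  then have "m = 0"
    by (simp add: m_def less_le)
  then have null: "emeasure \<nu> {x. 1 / real (Suc n) < N x} = 0" for n
    by (subst \<nu>_tail_m) auto
  have "UNIV = {0} \<union> (\<Union>n. {x. 1 / real (Suc n) < N x})"
  proof -
    have "\<exists>n. 1 / real (Suc n) < N x" if "x \<noteq> 0" for x
    proof -
      have "0 < N x"
        using that is_norm_eq_0_iff[OF N, of x] by (simp add: less_le)
      then show ?thesis
        by (rule nat_approx_posE) blast
    qed
    then show ?thesis by auto
  qed
  moreover have "emeasure \<nu> (\<Union>n. {x. 1 / real (Suc n) < N x}) = 0"
    by (rule emeasure_UN_eq_0) (use null in auto)
  ultimately have "emeasure \<nu> UNIV \<le> 0"
    using emeasure_subadditive[of "{0}" \<nu> "\<Union>n. {x. 1 / real (Suc n) < N x}"] \<nu>_0 by simp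
  with \<nu>_nonnull show False by simp
qed

lemma T_pos: "0 < T t"
proof (rule ccontr)
  assume "\<not> 0 < T t"
  then have T0: "T s = 0" if "t \<le> s" for s
    using T_antimono[OF that] T_nonneg[of s] by linarith
  define f where "f x = ramp 1 2 (N x) * (1 - ramp 3 4 (N x))" for x
  have cont: "continuous_on UNIV f"
    unfolding f_def by (intro continuous_intros) auto
  have f01: "0 \<le> f x" "f x \<le> 1" for x
    using ramp_bounds[of 1 2 "N x"] ramp_bounds[of 3 4 "N x"]
    by (auto simp: f_def mult_le_one)
  have lim: "((\<lambda>t. (\<integral>x. f ((1 / t) *\<^sub>R x) \<partial>L) / T t) \<longlongrightarrow> (\<integral>x. f x \<partial>\<nu>)) at_top"
    using cutoff_limit[of "\<lambda>_. 1" 1 2 3 4] by (simp add: f_def)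
  have "\<forall>\<^sub>F s in at_top. (\<integral>x. f ((1 / s) *\<^sub>R x) \<partial>L) / T s = 0"
    using eventually_ge_at_top[of t] by eventually_elim (simp add: T0)
  from tendsto_cong[OF this] lim have "(\<integral>x. f x \<partial>\<nu>) = 0"
    using tendsto_unique[OF _ lim, of 0] by simp
  moreover have "(\<integral>x. indicator {x. 2 < N x} x - indicator {x. 3 < N x} x \<partial>\<nu>) \<le> (\<integral>x. f x \<partial>\<nu>)"
  proof (intro integral_mono Bochner_Integration.integrable_diff integrable_indicator_tail
      integrable_\<nu>_bounded[where B = 1 and \<delta> = 1])
    show "f \<in> borel_measurable borel"
      by (rule borel_measurable_continuous_onI[OF cont])
    show "\<bar>f x\<bar> \<le> 1" for x
      using f01[of x] by simp
    show "f x = 0" if "N x \<le> 1" for x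
      using that by (simp add: f_def ramp_eq_0)
    show "indicator {x. 2 < N x} x - indicator {x. 3 < N x} x \<le> f x" for x
      using f01[of x] by (auto simp: indicator_def f_def ramp_eq_1 ramp_eq_0)
  qed auto
  moreover have "(\<integral>x. indicator {x. 2 < N x} x - indicator {x. 3 < N x} x \<partial>\<nu>)
      = 2 powr (-\<alpha>) * m - 3 powr (-\<alpha>) * m"
    using integrable_indicator_tail[of 2] integrable_indicator_tail[of 3] by (simp add: measure_tail_m)
  moreover have "(3::real) powr (-\<alpha>) < 2 powr (-\<alpha>)"
    using \<alpha>_pos by (intro powr_less_mono2_neg) auto
  ultimately show False
    using m_pos by (simp add: mult_less_cancel_right)
qed

end

context regular_tail
begin

lemma T_eq_rescaled:
  assumes "0 < t"
  shows "(\<integral>x. indicator {x. c < N x} ((1 / t) *\<^sub>R x) \<partial>L) = T (c * t)"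
proof -
  have "indicator {x. c < N x} ((1 / t) *\<^sub>R x) = (indicator {x. c * t < N x} x :: real)" for x
    using assms by (auto simp: indicator_def field_simps)
  then show ?thesis
    using integral_indicator_tail[of "c * t"] by simp
qed

lemma T_ratio_interval:
  assumes K: "1 < K"
  shows "((\<lambda>t. (T t - T (K * t)) / T t) \<longlongrightarrow> m * (1 - K powr (-\<alpha>))) at_top"
proof (rule tendsto_squeeze_param)
  let ?lo = "\<lambda>e. m * ((1 + e) powr (-\<alpha>) - (K - e) powr (-\<alpha>))"
  let ?hi = "\<lambda>e. m * ((1 - e) powr (-\<alpha>) - (K + e) powr (-\<alpha>))"
  show "0 < min (1/2) ((K - 1) / 3)"
    using K by simp
  have "(?lo \<longlongrightarrow> m * ((1 + 0) powr (-\<alpha>) - (K - 0) powr (-\<alpha>))) (at_right 0)"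
    using K by (intro tendsto_intros) auto
  then show "(?lo \<longlongrightarrow> m * (1 - K powr (-\<alpha>))) (at_right 0)"
    by simp
  have "(?hi \<longlongrightarrow> m * ((1 - 0) powr (-\<alpha>) - (K + 0) powr (-\<alpha>))) (at_right 0)"
    using K by (intro tendsto_intros) auto
  then show "(?hi \<longlongrightarrow> m * (1 - K powr (-\<alpha>))) (at_right 0)"
    by simp
  have diff: "(\<integral>x. indicator {x. p < N x} x - indicator {x. q < N x} x \<partial>\<nu>)
      = m * (p powr (-\<alpha>) - q powr (-\<alpha>))" if "0 < p" "0 < q" for p q
    using that integrable_indicator_tail[of p] integrable_indicator_tail[of q]
    by (simp add: measure_tail_m algebra_simps)
  have diffL: "(\<integral>x. indicator {x. 1 < N x} ((1 / t) *\<^sub>R x)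
      - indicator {x. K < N x} ((1 / t) *\<^sub>R x) \<partial>L) = T t - T (K * t)" if "0 < t" for t
    using T_eq_rescaled[OF that, of 1] T_eq_rescaled[OF that, of K]
    by (subst Bochner_Integration.integral_diff)
       (auto intro!: integrable_L_bounded[where B = 1])
  fix e :: real assume e: "0 < e" "e < min (1/2) ((K - 1) / 3)"
  have cut: "((\<lambda>t. (\<integral>x. f ((1 / t) *\<^sub>R x) \<partial>L) / T t) \<longlongrightarrow> (\<integral>x. f x \<partial>\<nu>)) at_top"
      "\<And>x. 0 \<le> f x \<and> f x \<le> 1" "f \<in> borel_measurable borel"
      "integrable \<nu> f" "\<And>t. integrable L (\<lambda>x. f ((1 / t) *\<^sub>R x))"
    if "0 < p" "p < p'" "u < u'" and f: "f = (\<lambda>x. ramp p p' (N x) * (1 - ramp u u' (N x)))"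
    for p p' u u' f
  proof -
    show "((\<lambda>t. (\<integral>x. f ((1 / t) *\<^sub>R x) \<partial>L) / T t) \<longlongrightarrow> (\<integral>x. f x \<partial>\<nu>)) at_top"
      using cutoff_limit[of "\<lambda>_. 1" p p' u u'] that by simp
    show f01: "0 \<le> f x \<and> f x \<le> 1" for x
      using ramp_bounds[of p p' "N x"] ramp_bounds[of u u' "N x"] by (auto simp: f mult_le_one)
    have "continuous_on UNIV f"
      using cutoff_continuous[of "\<lambda>_. 1" p p' u u'] that by simp
    then show fm [measurable]: "f \<in> borel_measurable borel"
      by (rule borel_measurable_continuous_onI)
    have "f x = 0" if "N x \<le> p" for x
      using that \<open>p < p'\<close> by (simp add: f ramp_eq_0)
    then show "integrable \<nu> f"
      using f01 \<open>0 < p\<close> fm by (intro integrable_\<nu>_bounded[where B = 1 and \<delta> = p]) auto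
    show "integrable L (\<lambda>x. f ((1 / t) *\<^sub>R x))" for t
      using f01 by (intro integrable_L_bounded[where B = 1]) auto
  qed
  show "\<exists>l L0. (\<forall>\<^sub>F t in at_top. l t \<le> (T t - T (K * t)) / T t) \<and> (l \<longlongrightarrow> L0) at_top \<and> ?lo e \<le> L0"
  proof -
    define f where "f = (\<lambda>x. ramp 1 (1 + e) (N x) * (1 - ramp (K - e) K (N x)))"
    have *: "0 < (1::real)" "1 < 1 + e" "K - e < K"
      using e by auto
    note c = cut[OF * f_def]
    have "f x \<le> indicator {x. 1 < N x} x - indicator {x. K < N x} x" for x
      using c(2)[of x] e K by (auto simp: indicator_def f_def ramp_eq_0 ramp_eq_1)
    then have "(\<integral>x. f ((1 / t) *\<^sub>R x) \<partial>L) \<le> T t - T (K * t)" if "0 < t" for t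
      unfolding diffL[OF that, symmetric] using c(2,3,5)
      by (intro integral_mono Bochner_Integration.integrable_diff integrable_L_bounded[where B = 1]) auto
    note le = this
    have "\<forall>\<^sub>F t in at_top. (\<integral>x. f ((1 / t) *\<^sub>R x) \<partial>L) / T t \<le> (T t - T (K * t)) / T t"
      using eventually_gt_at_top[of 0] by eventually_elim (rule divide_right_mono[OF le T_nonneg])
    moreover have "indicator {x. 1 + e < N x} x - indicator {x. K - e < N x} x \<le> f x" for x
      using c(2)[of x] e K by (auto simp: indicator_def f_def ramp_eq_0 ramp_eq_1)
    then have "?lo e \<le> (\<integral>x. f x \<partial>\<nu>)"
      using e K by (subst diff[symmetric]) (auto intro!: integral_mono c(4)
          Bochner_Integration.integrable_diff integrable_indicator_tail)
    ultimately show ?thesis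
      using c(1) by (intro exI[of _ "\<lambda>t. (\<integral>x. f ((1 / t) *\<^sub>R x) \<partial>L) / T t"] exI[of _ "\<integral>x. f x \<partial>\<nu>"] conjI)
  qed
  show "\<exists>u U0. (\<forall>\<^sub>F t in at_top. (T t - T (K * t)) / T t \<le> u t) \<and> (u \<longlongrightarrow> U0) at_top \<and> U0 \<le> ?hi e"
  proof -
    define f where "f = (\<lambda>x. ramp (1 - e) 1 (N x) * (1 - ramp K (K + e) (N x)))"
    have *: "0 < 1 - e" "1 - e < 1" "K < K + e"
      using e by auto
    note c = cut[OF * f_def]
    have "indicator {x. 1 < N x} x - indicator {x. K < N x} x \<le> f x" for x
      using c(2)[of x] e K by (auto simp: indicator_def f_def ramp_eq_0 ramp_eq_1)
    then have "T t - T (K * t) \<le> (\<integral>x. f ((1 / t) *\<^sub>R x) \<partial>L)" if "0 < t" for t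
      unfolding diffL[OF that, symmetric] using c(2,3,5)
      by (intro integral_mono Bochner_Integration.integrable_diff integrable_L_bounded[where B = 1]) auto
    note le = this
    have "\<forall>\<^sub>F t in at_top. (T t - T (K * t)) / T t \<le> (\<integral>x. f ((1 / t) *\<^sub>R x) \<partial>L) / T t"
      using eventually_gt_at_top[of 0] by eventually_elim (rule divide_right_mono[OF le T_nonneg])
    moreover have "f x \<le> indicator {x. 1 - e < N x} x - indicator {x. K + e < N x} x" for x
      using c(2)[of x] e K by (auto simp: indicator_def f_def ramp_eq_0 ramp_eq_1)
    then have "(\<integral>x. f x \<partial>\<nu>) \<le> ?hi e"
      using e K by (subst diff[symmetric]) (auto intro!: integral_mono c(4)
          Bochner_Integration.integrable_diff integrable_indicator_tail)
    ultimately show ?thesis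
      using c(1) by (intro exI[of _ "\<lambda>t. (\<integral>x. f ((1 / t) *\<^sub>R x) \<partial>L) / T t"] exI[of _ "\<integral>x. f x \<partial>\<nu>"] conjI)
  qed
qed

lemma T_ratio_m:
  assumes "1 < K"
  shows "((\<lambda>t. T (K * t) / T t) \<longlongrightarrow> 1 - m * (1 - K powr (-\<alpha>))) at_top"
proof -
  have "((\<lambda>t. 1 - (T t - T (K * t)) / T t) \<longlongrightarrow> 1 - m * (1 - K powr (-\<alpha>))) at_top"
    by (intro tendsto_intros T_ratio_interval assms)
  moreover have "1 - (T t - T (K * t)) / T t = T (K * t) / T t" for t
    using T_pos[of t] by (simp add: field_simps)
  ultimately show ?thesis by simp
qed

lemma filterlim_times_at_top: "0 < K \<Longrightarrow> filterlim (\<lambda>t. K * t) at_top (at_top :: real filter)"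
  by (rule filterlim_tendsto_pos_mult_at_top[OF tendsto_const]) (auto simp: filterlim_ident)

text \<open>No mass escapes to infinity: the limit \<open>g(K)\<close> of \<open>T (K t) / T t\<close> satisfies \<open>g(4) = g(2)\<^sup>2\<close>, which
  for \<open>g(K) = 1 - m (1 - K\<^bsup>-\<alpha>\<^esup>)\<close> forces \<open>m \<in> {0, 1}\<close>.\<close>

lemma m_eq_1: "m = 1"
proof -
  define u where "u = (2::real) powr (-\<alpha>)"
  have u: "u < 1"
    unfolding u_def using \<alpha>_pos powr_less_mono[of "-\<alpha>" 0 "2::real"] by simp
  have 4: "(4::real) powr (-\<alpha>) = u\<^sup>2"
    using powr_mult[of 2 2 "-\<alpha>"] by (simp add: u_def power2_eq_square)
  have 1: "((\<lambda>t. T (2 * t) / T t) \<longlongrightarrow> 1 - m * (1 - u)) at_top"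
    unfolding u_def by (rule T_ratio_m) simp
  have 2: "((\<lambda>t. T (2 * (2 * t)) / T (2 * t)) \<longlongrightarrow> 1 - m * (1 - u)) at_top"
    by (rule filterlim_compose[OF 1 filterlim_times_at_top]) simp
  have "((\<lambda>t. T (2 * (2 * t)) / T (2 * t) * (T (2 * t) / T t)) \<longlongrightarrow> (1 - m * (1 - u)) * (1 - m * (1 - u))) at_top"
    by (intro tendsto_intros 1 2)
  moreover have "(\<lambda>t. T (2 * (2 * t)) / T (2 * t) * (T (2 * t) / T t)) = (\<lambda>t. T (4 * t) / T t)"
    using T_pos by (intro ext) (simp add: less_imp_neq[THEN not_sym])
  ultimately have "((\<lambda>t. T (4 * t) / T t) \<longlongrightarrow> (1 - m * (1 - u))\<^sup>2) at_top"
    by (simp only: power2_eq_square)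
  moreover have "((\<lambda>t. T (4 * t) / T t) \<longlongrightarrow> 1 - m * (1 - u\<^sup>2)) at_top"
    using T_ratio_m[of 4] by (simp add: 4)
  ultimately have "(1 - m * (1 - u))\<^sup>2 = 1 - m * (1 - u\<^sup>2)"
    by (rule tendsto_unique[OF trivial_limit_at_top_linorder])
  then have "m * (1 - m) * (1 - u)\<^sup>2 = 0"
    by (simp add: power2_eq_square algebra_simps)
  with m_pos u show ?thesis by simp
qed

lemma emeasure_\<nu>_N: "0 < l \<Longrightarrow> emeasure \<nu> {x. l < N x} = ennreal (l powr (-\<alpha>))"
  by (simp add: \<nu>_tail_m m_eq_1)

lemma measure_\<nu>_N: "0 < l \<Longrightarrow> measure \<nu> {x. l < N x} = l powr (-\<alpha>)"
  by (simp add: measure_tail_m m_eq_1)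

lemma T_ratio:
  assumes "0 < K"
  shows "((\<lambda>t. T (K * t) / T t) \<longlongrightarrow> K powr (-\<alpha>)) at_top"
proof -
  consider "K > 1" | "K = 1" | "K < 1" by linarith
  then show ?thesis
  proof cases
    case 1
    then show ?thesis using T_ratio_m[of K] by (simp add: m_eq_1)
  next
    case 2
    then show ?thesis using T_pos by (simp add: less_imp_neq[THEN not_sym])
  next
    case 3
    then have "((\<lambda>t. T ((1 / K) * t) / T t) \<longlongrightarrow> (1 / K) powr (-\<alpha>)) at_top"
      using T_ratio_m[of "1 / K"] assms by (simp add: m_eq_1)
    then have "((\<lambda>t. T ((1 / K) * (K * t)) / T (K * t)) \<longlongrightarrow> (1 / K) powr (-\<alpha>)) at_top"
      by (rule filterlim_compose[OF _ filterlim_times_at_top[OF assms]])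
    then have "((\<lambda>t. inverse (T t / T (K * t))) \<longlongrightarrow> inverse ((1 / K) powr (-\<alpha>))) at_top"
      using assms by (intro tendsto_inverse) auto
    then show ?thesis
      using assms by (simp add: powr_divide powr_minus field_simps)
  qed
qed

text \<open>The function need not vanish near infinity, because \<open>m = 1\<close> controls the tail, and the indicator of
  a complement of a ball may be included, because spheres are null sets for the limit measure.\<close>

lemma tail_limit_N:
  fixes g :: "'a \<Rightarrow> real"
  assumes g: "continuous_on UNIV g" "\<And>x. 0 \<le> g x" "\<And>x. g x \<le> B" and c: "0 < c"
  shows "((\<lambda>t. (\<integral>x. g ((1 / t) *\<^sub>R x) * indicator {x. c < N x} ((1 / t) *\<^sub>R x) \<partial>L) / T t)
     \<longlongrightarrow> (\<integral>x. g x * indicator {x. c < N x} x \<partial>\<nu>)) at_top"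
    (is "(?x \<longlongrightarrow> ?I) _")
proof (rule tendsto_squeeze_param)
  \<comment> \<open>The mass near the sphere of radius \<open>c\<close> and the mass outside radius \<open>1 / e\<close>.\<close>
  let ?err = "\<lambda>e. B * (c powr (-\<alpha>) - (c + e) powr (-\<alpha>) + (1 / e) powr (-\<alpha>))"
  have B: "0 \<le> B"
    using g(2,3)[of undefined] by linarith
  have [measurable]: "g \<in> borel_measurable borel"
    by (rule borel_measurable_continuous_onI[OF g(1)])
  have "((\<lambda>e. e powr \<alpha>) \<longlongrightarrow> 0) (at_right 0)"
    using \<alpha>_pos by (intro tendsto_eq_intros) (auto simp: eventually_at_right_field intro!: exI[of _ 1])
  moreover have "\<forall>\<^sub>F e in at_right 0. e powr \<alpha> = (1 / e) powr (-\<alpha>)"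
    by (auto simp: eventually_at_right_field powr_divide powr_minus_divide intro!: exI[of _ 1])
  ultimately have "((\<lambda>e. (1 / e) powr (-\<alpha>)) \<longlongrightarrow> 0) (at_right 0)"
    by (rule Lim_transform_eventually)
  then have "(?err \<longlongrightarrow> B * (c powr (-\<alpha>) - (c + 0) powr (-\<alpha>) + 0)) (at_right 0)"
    using c by (intro tendsto_intros) auto
  then have err: "(?err \<longlongrightarrow> 0) (at_right 0)"
    by simp
  show "((\<lambda>e. ?I - ?err e) \<longlongrightarrow> ?I) (at_right 0)" "((\<lambda>e. ?I + ?err e) \<longlongrightarrow> ?I) (at_right 0)"
    using tendsto_diff[OF tendsto_const[of ?I] err] tendsto_add[OF tendsto_const[of ?I] err] by auto
  fix e :: real assume e: "0 < e" "e < 1"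
  define f where "f = (\<lambda>x. ramp c (c + e) (N x) * (1 - ramp (1 / e) (2 / e) (N x)) * g x)"
  define r where "r x = (indicator {x. c < N x} x - indicator {x. c + e < N x} x
      + indicator {x. 1 / e < N x} x :: real)" for x
  have e': "1 / e < 2 / e"
    using e by (intro divide_strict_right_mono) auto
  have cutoff01: "0 \<le> ramp c (c + e) (N x) * (1 - ramp (1 / e) (2 / e) (N x)) \<and>
      ramp c (c + e) (N x) * (1 - ramp (1 / e) (2 / e) (N x)) \<le> 1" for x
    using ramp_bounds[of c "c + e" "N x"] ramp_bounds[of "1 / e" "2 / e" "N x"] by (auto simp: mult_le_one)
  have f0: "0 \<le> f x" and fg: "f x \<le> g x" for x
    using cutoff01[of x] g(2)[of x] mult_right_mono[of _ 1 "g x"] by (auto simp: f_def)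
  have fB: "f x \<le> B" for x
    using fg[of x] g(3)[of x] by simp
  have lim: "((\<lambda>t. (\<integral>x. f ((1 / t) *\<^sub>R x) \<partial>L) / T t) \<longlongrightarrow> (\<integral>x. f x \<partial>\<nu>)) at_top"
    unfolding f_def using c e by (intro cutoff_limit g(1,2) e') auto
  have "continuous_on UNIV f"
    unfolding f_def by (intro cutoff_continuous g e') (use e in auto)
  then have [measurable]: "f \<in> borel_measurable borel"
    by (rule borel_measurable_continuous_onI)
  have fz: "f x = 0" if "N x \<le> c" for x
    using that e by (simp add: f_def ramp_eq_0)
  have int_f: "integrable \<nu> f"
    using f0 fB c fz by (intro integrable_\<nu>_bounded[where B = B and \<delta> = c]) auto
  have int_g: "integrable \<nu> (\<lambda>x. g x * indicator {x. c < N x} x)"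
    using g(2,3) B c by (intro integrable_\<nu>_bounded[where B = B and \<delta> = c]) (auto simp: indicator_def)
  have int_r: "integrable \<nu> r"
    unfolding r_def using c e
    by (intro Bochner_Integration.integrable_diff Bochner_Integration.integrable_add
        integrable_indicator_tail) auto
  have [measurable]: "r \<in> borel_measurable borel"
    unfolding r_def by measurable
  have r0: "0 \<le> r x" "r x \<le> 2" for x
    using e by (auto simp: r_def indicator_def)
  have low: "f x \<le> g x * indicator {x. c < N x} x" for x
    using fg[of x] fz[of x] by (auto simp: indicator_def)
  have up: "g x * indicator {x. c < N x} x \<le> f x + B * r x" for x
  proof -
    consider "N x \<le> c" | "c < N x" "N x \<le> c + e" | "c + e < N x" "N x \<le> 1 / e" | "c + e < N x" "1 / e < N x"
      by linarith
    then show ?thesis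
    proof cases
      case 1
      then show ?thesis using f0[of x] B r0[of x] by simp
    next
      case 2
      then have "1 \<le> r x" by (auto simp: r_def indicator_def)
      then show ?thesis using f0[of x] g(3)[of x] 2 B mult_left_mono[of 1 "r x" B] by simp
    next
      case 3
      then have "f x = g x"
        using e e' by (simp add: f_def ramp_eq_0 ramp_eq_1)
      then show ?thesis
        using 3 e mult_nonneg_nonneg[OF B r0(1)[of x]] by (simp add: indicator_def)
    next
      case 4
      then have "c < N x" using e by linarith
      moreover from this 4 have "1 \<le> r x" by (simp add: r_def)
      ultimately show ?thesis
        using f0[of x] g(3)[of x] B mult_left_mono[of 1 "r x" B] by simp
    qed
  qed
  have fi: "\<bar>f x\<bar> \<le> B" for x
    using f0[of x] fB[of x] by simp
  have gi: "\<bar>g x * indicator {x. c < N x} x\<bar> \<le> B" for x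
    using g(2)[of x] g(3)[of x] B by (simp add: indicator_def)
  have ri: "\<bar>r x\<bar> \<le> 2" for x
    using r0[of x] by simp
  have int_r_eq: "B * (\<integral>x. r x \<partial>\<nu>) = ?err e"
    unfolding r_def using c e integrable_indicator_tail[of c] integrable_indicator_tail[of "c + e"]
      integrable_indicator_tail[of "1 / e"] by (simp add: measure_\<nu>_N)
  have int_rL: "(\<integral>x. r ((1 / t) *\<^sub>R x) \<partial>L) = T (c * t) - T ((c + e) * t) + T ((1 / e) * t)" if "0 < t" for t
    unfolding r_def T_eq_rescaled[OF that, symmetric]
    by (subst Bochner_Integration.integral_add Bochner_Integration.integral_diff;
        (intro integrable_L_bounded[where B = 1] Bochner_Integration.integrable_diff)?; (simp add: indicator_def)?)+
  show "\<exists>l L0. (\<forall>\<^sub>F t in at_top. l t \<le> ?x t) \<and> (l \<longlongrightarrow> L0) at_top \<and> ?I - ?err e \<le> L0"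
  proof (intro exI conjI)
    show "((\<lambda>t. (\<integral>x. f ((1 / t) *\<^sub>R x) \<partial>L) / T t) \<longlongrightarrow> (\<integral>x. f x \<partial>\<nu>)) at_top"
      by (rule lim)
    show "\<forall>\<^sub>F t in at_top. (\<integral>x. f ((1 / t) *\<^sub>R x) \<partial>L) / T t \<le> ?x t"
      by (intro always_eventually allI divide_right_mono integral_mono
          integrable_L_bounded[where B = B] T_nonneg low fi gi; measurable)
    have "?I \<le> (\<integral>x. f x + B * r x \<partial>\<nu>)"
      by (intro integral_mono int_g Bochner_Integration.integrable_add int_f integrable_mult_right int_r up)
    also have "\<dots> = (\<integral>x. f x \<partial>\<nu>) + ?err e"
      using int_f int_r by (simp add: int_r_eq[symmetric])
    finally show "?I - ?err e \<le> (\<integral>x. f x \<partial>\<nu>)"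
      by simp
  qed
  show "\<exists>u U0. (\<forall>\<^sub>F t in at_top. ?x t \<le> u t) \<and> (u \<longlongrightarrow> U0) at_top \<and> U0 \<le> ?I + ?err e"
  proof (intro exI conjI)
    let ?u = "\<lambda>t. (\<integral>x. f ((1 / t) *\<^sub>R x) \<partial>L) / T t
        + B * (T (c * t) / T t - T ((c + e) * t) / T t + T ((1 / e) * t) / T t)"
    show "\<forall>\<^sub>F t in at_top. ?x t \<le> ?u t"
      using eventually_gt_at_top[of 0]
    proof eventually_elim
      case (elim t)
      have "(\<integral>x. g ((1 / t) *\<^sub>R x) * indicator {x. c < N x} ((1 / t) *\<^sub>R x) \<partial>L)
          \<le> (\<integral>x. f ((1 / t) *\<^sub>R x) + B * r ((1 / t) *\<^sub>R x) \<partial>L)"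
        by (intro integral_mono Bochner_Integration.integrable_add integrable_mult_right up
            integrable_L_bounded[OF _ fi] integrable_L_bounded[OF _ gi] integrable_L_bounded[OF _ ri]; measurable)
      also have "\<dots> = (\<integral>x. f ((1 / t) *\<^sub>R x) \<partial>L) + B * (\<integral>x. r ((1 / t) *\<^sub>R x) \<partial>L)"
        by (subst Bochner_Integration.integral_add)
           (auto intro!: integrable_L_bounded[OF _ fi] integrable_L_bounded[OF _ ri])
      finally have "?x t \<le> ((\<integral>x. f ((1 / t) *\<^sub>R x) \<partial>L) + B * (\<integral>x. r ((1 / t) *\<^sub>R x) \<partial>L)) / T t"
        by (rule divide_right_mono) simp
      also have "\<dots> = ?u t"
        unfolding int_rL[OF elim] by (simp add: add_divide_distrib diff_divide_distrib ring_distribs)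
      finally show ?case .
    qed
    show "(?u \<longlongrightarrow> (\<integral>x. f x \<partial>\<nu>) + ?err e) at_top"
      using c e by (intro tendsto_intros lim T_ratio) auto
    show "(\<integral>x. f x \<partial>\<nu>) + ?err e \<le> ?I + ?err e"
      by (intro add_right_mono integral_mono int_f int_g low)
  qed
qed simp

end

section \<open>Dilations adapted to the degree of homogeneity\<close>

context regular_tail
begin

definition R :: "'a \<Rightarrow> real" where "R x = N x powr a"

text \<open>With this dilation and the radius \<open>R\<close>, maps of degree \<open>a\<close> become homogeneous of degree one, and
  \<open>\<gamma>\<close> is the tail index of \<open>R\<close>.\<close>

definition dil :: "real \<Rightarrow> 'a \<Rightarrow> 'a" where "dil s x = (s powr (1 / a)) *\<^sub>R x"

definition G :: "real \<Rightarrow> real" where "G t = measure L {x. t < R x}"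

definition \<gamma> :: real where "\<gamma> = \<alpha> / a"

lemma \<gamma>_pos: "0 < \<gamma>"
  using \<alpha>_pos a_pos by (simp add: \<gamma>_def)

lemma R_nonneg [simp]: "0 \<le> R x"
  by (simp add: R_def)

lemma R_0 [simp]: "R 0 = 0"
  using a_pos by (simp add: R_def)

lemma R_pos_iff: "0 < R x \<longleftrightarrow> x \<noteq> 0"
  using is_norm_eq_0_iff[OF N, of x] by (auto simp: R_def less_le)

lemma R_continuous [continuous_intros]: "continuous_on A f \<Longrightarrow> continuous_on A (\<lambda>x. R (f x))"
  unfolding R_def using a_pos by (intro continuous_on_powr' continuous_intros) auto

lemma R_measurable [measurable]: "R \<in> borel_measurable borel"
  unfolding R_def by measurable

lemma dil_continuous [continuous_intros]: "continuous_on A f \<Longrightarrow> continuous_on A (\<lambda>x. dil s (f x))"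
  unfolding dil_def by (intro continuous_intros)

lemma dil_measurable [measurable]: "dil s \<in> borel_measurable borel"
  unfolding dil_def by measurable

lemma dil_dil: "0 \<le> s \<Longrightarrow> 0 \<le> t \<Longrightarrow> dil s (dil t x) = dil (s * t) x"
  by (simp add: dil_def powr_mult)

lemma dil_1 [simp]: "dil 1 x = x"
  by (simp add: dil_def)

lemma dil_zero [simp]: "dil s 0 = 0"
  by (simp add: dil_def)

lemma R_dil: "0 \<le> s \<Longrightarrow> R (dil s x) = s * R x"
  using a_pos by (simp add: R_def dil_def powr_mult powr_powr)

lemma less_R_iff:
  assumes "0 \<le> t"
  shows "t < R x \<longleftrightarrow> t powr (1 / a) < N x"
proof -
  have "t = (t powr (1 / a)) powr a"
    using assms a_pos by (simp add: powr_powr)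
  moreover have "(t powr (1 / a)) powr a < N x powr a \<longleftrightarrow> t powr (1 / a) < N x"
    using powr_less_mono2[OF a_pos, of "t powr (1 / a)" "N x"] powr_mono2[of a "N x" "t powr (1 / a)"] a_pos
    by (cases "t powr (1 / a) < N x") auto
  ultimately show ?thesis
    by (simp add: R_def)
qed

lemma G_eq_T: "0 \<le> t \<Longrightarrow> G t = T (t powr (1 / a))"
  by (simp add: G_def T_def less_R_iff)

lemma G_antimono: "s \<le> t \<Longrightarrow> G t \<le> G s"
  unfolding G_def by (rule finite_measure_mono) auto

lemma G_nonneg [simp]: "0 \<le> G t"
  by (simp add: G_def)

lemma G_pos: "0 < G t"
  using T_pos[of "max 0 t powr (1 / a)"] G_antimono[of t "max 0 t"] G_eq_T[of "max 0 t"] by simp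

lemma filterlim_root: "filterlim (\<lambda>t. t powr (1 / a)) at_top at_top"
  unfolding filterlim_at_top
proof
  fix Z
  show "\<forall>\<^sub>F t in at_top. Z \<le> t powr (1 / a)"
    using eventually_ge_at_top[of "max Z 0 powr a"]
  proof eventually_elim
    case (elim t)
    have "max Z 0 = (max Z 0 powr a) powr (1 / a)"
      using a_pos by (simp add: powr_powr)
    also have "\<dots> \<le> t powr (1 / a)"
      using elim a_pos by (intro powr_mono2) auto
    finally show ?case by simp
  qed
qed

lemma G_ratio:
  assumes "0 < c"
  shows "((\<lambda>t. G (c * t) / G t) \<longlongrightarrow> c powr (-\<gamma>)) at_top"
proof -
  have "((\<lambda>t. T (c powr (1 / a) * t) / T t) \<longlongrightarrow> (c powr (1 / a)) powr (-\<alpha>)) at_top"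
    using assms by (intro T_ratio) simp
  from filterlim_compose[OF this filterlim_root]
  have lim: "((\<lambda>t. T (c powr (1 / a) * t powr (1 / a)) / T (t powr (1 / a))) \<longlongrightarrow> c powr (-\<gamma>)) at_top"
    by (simp add: powr_powr \<gamma>_def)
  have "\<forall>\<^sub>F t in at_top. T (c powr (1 / a) * t powr (1 / a)) / T (t powr (1 / a)) = G (c * t) / G t"
    using eventually_ge_at_top[of 0]
    by eventually_elim (use assms in \<open>simp add: G_eq_T powr_mult\<close>)
  with lim show ?thesis
    by (rule Lim_transform_eventually)
qed

lemma emeasure_\<nu>_R: "0 < s \<Longrightarrow> emeasure \<nu> {x. s < R x} = ennreal (s powr (-\<gamma>))"
  by (simp add: less_R_iff emeasure_\<nu>_N powr_powr \<gamma>_def)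

lemma measure_\<nu>_R: "0 < s \<Longrightarrow> measure \<nu> {x. s < R x} = s powr (-\<gamma>)"
  by (simp add: measure_def emeasure_\<nu>_R)

lemma integrable_\<nu>_indicator: "0 < s \<Longrightarrow> integrable \<nu> (indicator {x. s < R x} :: 'a \<Rightarrow> real)"
  by (simp add: integrable_real_indicator emeasure_\<nu>_R)

lemma integrable_\<nu>:
  assumes [measurable]: "f \<in> borel_measurable borel"
    and "\<And>x. \<bar>f x\<bar> \<le> B" and "0 < \<delta>" and "\<And>x. R x \<le> \<delta> \<Longrightarrow> f x = 0"
  shows "integrable \<nu> (f :: 'a \<Rightarrow> real)"
proof (rule integrable_\<nu>_bounded[OF _ assms(2)])
  show "0 < \<delta> powr (1 / a)"
    using assms(3) by simp
  show "f x = 0" if "N x \<le> \<delta> powr (1 / a)" for x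
    using less_R_iff[of \<delta> x] assms(3,4) that by (auto simp: not_less)
qed simp

lemma sigma_finite_\<nu>: "sigma_finite_measure \<nu>"
proof
  let ?A = "insert {0} (range (\<lambda>n. {x. 1 / real (Suc n) < R x}))"
  have "\<exists>n. 1 / real (Suc n) < R x" if "x \<noteq> 0" for x
  proof -
    have "0 < R x"
      using that by (simp add: R_pos_iff)
    then show ?thesis
      by (rule nat_approx_posE) blast
  qed
  then have "\<Union>?A = space \<nu>"
    by auto
  moreover have "emeasure \<nu> X \<noteq> \<infinity>" if "X \<in> ?A" for X
    using that by (auto simp: \<nu>_0 emeasure_\<nu>_R simp del: of_nat_Suc)
  moreover have "?A \<subseteq> sets \<nu>" "countable ?A"
    by auto
  ultimately show "\<exists>A. countable A \<and> A \<subseteq> sets \<nu> \<and> \<Union> A = space \<nu> \<and> (\<forall>a\<in>A. emeasure \<nu> a \<noteq> \<infinity>)"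
    by blast
qed

lemma \<nu>_dil:
  assumes "0 < s" "A \<in> sets borel"
  shows "emeasure \<nu> (dil s -` A) = ennreal (s powr \<gamma>) * emeasure \<nu> A"
  using \<nu>_homogeneous[of "s powr (1 / a)" A] assms
  by (simp add: dil_def[abs_def] powr_powr \<gamma>_def)

lemma tail_limit:
  fixes g :: "'a \<Rightarrow> real"
  assumes g: "continuous_on UNIV g" "\<And>x. 0 \<le> g x" "\<And>x. g x \<le> B" and c: "0 < c"
  shows "((\<lambda>t. (\<integral>x. g (dil (1 / t) x) * indicator {x. c < R x} (dil (1 / t) x) \<partial>L) / G t)
     \<longlongrightarrow> (\<integral>x. g x * indicator {x. c < R x} x \<partial>\<nu>)) at_top"
proof -
  have "0 < c powr (1 / a)"
    using c by simp
  note filterlim_compose[OF tail_limit_N[OF g this] filterlim_root]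
  moreover have "{x. c powr (1 / a) < N x} = {x. c < R x}"
    using c by (auto simp: less_R_iff)
  ultimately have lim: "((\<lambda>t. (\<integral>x. g ((1 / t powr (1 / a)) *\<^sub>R x) *
          indicator {x. c < R x} ((1 / t powr (1 / a)) *\<^sub>R x) \<partial>L) / T (t powr (1 / a)))
     \<longlongrightarrow> (\<integral>x. g x * indicator {x. c < R x} x \<partial>\<nu>)) at_top"
    by simp
  have "\<forall>\<^sub>F t in at_top. (\<integral>x. g ((1 / t powr (1 / a)) *\<^sub>R x) *
          indicator {x. c < R x} ((1 / t powr (1 / a)) *\<^sub>R x) \<partial>L) / T (t powr (1 / a))
      = (\<integral>x. g (dil (1 / t) x) * indicator {x. c < R x} (dil (1 / t) x) \<partial>L) / G t"
    using eventually_ge_at_top[of 0]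
    by eventually_elim (simp add: G_eq_T dil_def powr_divide)
  with lim show ?thesis
    by (rule Lim_transform_eventually)
qed

lemma tail_limit_vanishing:
  fixes g :: "'a \<Rightarrow> real"
  assumes g: "continuous_on UNIV g" "\<And>x. 0 \<le> g x" "\<And>x. g x \<le> B" and c: "0 < c"
    and g0: "\<And>x. R x \<le> c \<Longrightarrow> g x = 0"
  shows "((\<lambda>t. (\<integral>x. g (dil (1 / t) x) \<partial>L) / G t) \<longlongrightarrow> (\<integral>x. g x \<partial>\<nu>)) at_top"
proof -
  have "g x * indicator {x. c < R x} x = g x" for x
    using g0[of x] by (auto simp: indicator_def)
  note eq = this
  show ?thesis
    using tail_limit[OF g c] unfolding eq .
qed

lemma G_rescaled:
  assumes "0 < t"
  shows "(\<integral>x. indicator {x. c < R x} (dil (1 / t) x) \<partial>L) = G (c * t)"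
proof -
  have "indicator {x. c < R x} (dil (1 / t) x) = (indicator {x. c * t < R x} x :: real)" for x
    using assms by (auto simp: indicator_def field_simps R_dil)
  then show ?thesis
    by (simp add: G_def)
qed

definition direction :: "'a \<Rightarrow> 'a" where "direction y = (1 / N y) *\<^sub>R y"

lemma direction_measurable [measurable]: "direction \<in> borel_measurable borel"
  unfolding direction_def by measurable

lemma N_direction_le: "N (direction y) \<le> 1"
  by (simp add: direction_def)

lemma dil_direction: "dil (R y) (direction y) = y"
proof (cases "y = 0")
  case False
  then have "N y > 0"
    using is_norm_eq_0_iff[OF N, of y] by (simp add: less_le)
  then show ?thesis
    using a_pos by (simp add: dil_def R_def direction_def powr_powr)
qed (simp add: direction_def)



section \<open>Functions depending on a parameter\<close>

text \<open>For a functional \<open>F\<close> as in the overview, this applies to \<open>F(\<cdot>, y)\<close> with \<open>s\<close> the radius of \<open>y\<close>: the weight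
  \<open>\<kappa>(y)\<close> grows at most like that power of the radius whose moment appears in \<open>\<eta>\<close>.\<close>

lemma vanishing_integral:
  fixes g :: "'a \<Rightarrow> real"
  assumes g: "g \<in> borel_measurable borel" "\<And>x. 0 \<le> g x" "\<And>x. g x \<le> B"
    and s: "0 \<le> s" and \<delta>: "0 < \<delta>" and g0: "\<And>x. R x * s \<le> \<delta> \<Longrightarrow> g x = 0"
  shows "integrable \<nu> g" "(\<integral>x. g x \<partial>\<nu>) \<le> B * \<delta> powr (-\<gamma>) * s powr \<gamma>"
proof -
  consider "s = 0" | "0 < s" using s by linarith
  then have "integrable \<nu> g \<and> (\<integral>x. g x \<partial>\<nu>) \<le> B * \<delta> powr (-\<gamma>) * s powr \<gamma>"
  proof cases
    case 1
    then have "g = (\<lambda>_. 0)"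
      using g0 \<delta> by auto
    with 1 show ?thesis by simp
  next
    case 2
    then have pos: "0 < \<delta> / s"
      using \<delta> by simp
    have zero: "g x = 0" if "R x \<le> \<delta> / s" for x
      using that 2 by (intro g0) (simp add: field_simps)
    have int: "integrable \<nu> g"
      using g zero pos by (intro integrable_\<nu>[where B = B and \<delta> = "\<delta> / s"]) auto
    have "g x \<le> B * indicator {x. \<delta> / s < R x} x" for x
      using g(3)[of x] zero[of x] by (cases "\<delta> / s < R x") auto
    then have "(\<integral>x. g x \<partial>\<nu>) \<le> (\<integral>x. B * indicator {x. \<delta> / s < R x} x \<partial>\<nu>)"
      by (intro integral_mono int integrable_mult_right integrable_\<nu>_indicator pos)
    also have "\<dots> = B * \<delta> powr (-\<gamma>) * s powr \<gamma>"
      using pos 2 by (simp add: measure_\<nu>_R powr_divide powr_minus_divide)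
    finally show ?thesis using int by simp
  qed
  then show "integrable \<nu> g" "(\<integral>x. g x \<partial>\<nu>) \<le> B * \<delta> powr (-\<gamma>) * s powr \<gamma>"
    by auto
qed

lemma ramp_integral:
  assumes pq: "0 < p" "p < q" and s: "0 \<le> s"
  shows "q powr (-\<gamma>) * s powr \<gamma> \<le> (\<integral>x. ramp p q (R x * s) \<partial>\<nu>)"
    and "(\<integral>x. ramp p q (R x * s) \<partial>\<nu>) \<le> p powr (-\<gamma>) * s powr \<gamma>"
proof -
  have m: "(\<lambda>x. ramp p q (R x * s)) \<in> borel_measurable borel"
    using pq by (intro borel_measurable_continuous_onI continuous_intros)
  have int: "integrable \<nu> (\<lambda>x. ramp p q (R x * s))"
    and "(\<integral>x. ramp p q (R x * s) \<partial>\<nu>) \<le> 1 * p powr (-\<gamma>) * s powr \<gamma>"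
    by (rule vanishing_integral[OF m ramp_bounds s pq(1)]; simp add: pq ramp_eq_0)+
  then show "(\<integral>x. ramp p q (R x * s) \<partial>\<nu>) \<le> p powr (-\<gamma>) * s powr \<gamma>"
    by simp
  show "q powr (-\<gamma>) * s powr \<gamma> \<le> (\<integral>x. ramp p q (R x * s) \<partial>\<nu>)"
  proof (cases "s = 0")
    case False
    with s pq have pos: "0 < q / s" by simp
    then have "q powr (-\<gamma>) * s powr \<gamma> = (\<integral>x. indicator {x. q / s < R x} x \<partial>\<nu>)"
      using s False pq by (simp add: measure_\<nu>_R powr_divide powr_minus_divide)
    also have "\<dots> \<le> (\<integral>x. ramp p q (R x * s) \<partial>\<nu>)"
    proof (intro integral_mono integrable_\<nu>_indicator pos int)
      show "indicator {x. q / s < R x} x \<le> ramp p q (R x * s)" for x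
        using s False pq ramp_bounds(1)[of p q "R x * s"]
        by (cases "q / s < R x") (auto simp: ramp_eq_1 field_simps)
    qed
    finally show ?thesis .
  qed (use ramp_bounds in \<open>simp add: Bochner_Integration.integral_nonneg\<close>)
qed

text \<open>A modulus of continuity in the parameter that is asymptotically independent of \<open>t\<close>. On a large
  compact annulus it comes from uniform continuity of \<open>F\<close>; the rest of the space has small mass under
  the prelimit measures as well as the limit.\<close>

lemma parametric_modulus:
  fixes F :: "'a \<times> 'b::euclidean_space \<Rightarrow> real"
  assumes F: "continuous_on UNIV F" "\<And>p. 0 \<le> F p" "\<And>p. F p \<le> B"
    and C: "compact C" and \<delta>: "0 < \<delta>"
    and F0: "\<And>x y. y \<in> C \<Longrightarrow> R x \<le> \<delta> \<Longrightarrow> F (x, y) = 0"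
    and e: "0 < e"
  obtains \<rho> where "0 < \<rho>"
    and "\<And>y y'. y \<in> C \<Longrightarrow> y' \<in> C \<Longrightarrow> dist y y' < \<rho> \<Longrightarrow>
      \<bar>(\<integral>x. F (x, y) \<partial>\<nu>) - (\<integral>x. F (x, y') \<partial>\<nu>)\<bar> \<le> e"
    and "\<forall>\<^sub>F t in at_top. \<forall>y\<in>C. \<forall>y'\<in>C. dist y y' < \<rho> \<longrightarrow>
      \<bar>(\<integral>x. F (dil (1 / t) x, y) \<partial>L) / G t - (\<integral>x. F (dil (1 / t) x, y') \<partial>L) / G t\<bar> \<le> e"
proof -
  have [measurable]: "F \<in> borel_measurable borel"
    by (rule borel_measurable_continuous_onI[OF F(1)])
  have Fm [measurable]: "(\<lambda>x. F (x, y)) \<in> borel_measurable borel" for y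
    by (intro borel_measurable_continuous_onI continuous_on_compose2[OF F(1)] continuous_intros) auto
  have B: "0 \<le> B"
    using F(2,3)[of undefined] by linarith
  have "((\<lambda>K. B * K powr (-\<gamma>)) \<longlongrightarrow> B * 0) at_top"
    using \<gamma>_pos by (intro tendsto_intros tendsto_neg_powr filterlim_ident) auto
  then have "\<forall>\<^sub>F K in at_top. B * K powr (-\<gamma>) < e / 2"
    using e by (intro order_tendstoD) auto
  then obtain K where K: "B * K powr (-\<gamma>) < e / 2" "0 < K"
    using eventually_happens'[OF _ eventually_conj[OF _ eventually_gt_at_top[of 0]]] by (metis trivial_limit_at_top_linorder)
  define \<eta> where "\<eta> = e / 2 / \<delta> powr (-\<gamma>)"
  have \<eta>: "0 < \<eta>"
    using e \<delta> by (simp add: \<eta>_def)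
  have lim: "\<eta> * \<delta> powr (-\<gamma>) + B * K powr (-\<gamma>) < e"
    using K \<delta> by (simp add: \<eta>_def)
  have "compact ({x. 0 \<le> N x \<and> N x \<le> K powr (1 / a)} \<times> C)"
    by (intro compact_Times C is_norm_compact N)
  then have "uniformly_continuous_on ({x. 0 \<le> N x \<and> N x \<le> K powr (1 / a)} \<times> C) F"
    by (intro compact_uniformly_continuous continuous_on_subset[OF F(1)]) auto
  then obtain \<rho> where \<rho>: "0 < \<rho>"
    and unif: "\<And>p q. p \<in> {x. 0 \<le> N x \<and> N x \<le> K powr (1 / a)} \<times> C \<Longrightarrow>
        q \<in> {x. 0 \<le> N x \<and> N x \<le> K powr (1 / a)} \<times> C \<Longrightarrow> dist q p < \<rho> \<Longrightarrow> dist (F q) (F p) < \<eta>"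
    by (rule uniformly_continuous_onE[OF _ \<eta>]) blast
  define r where "r x = \<eta> * indicator {x. \<delta> < R x} x + B * indicator {x. K < R x} x" for x
  have [measurable]: "r \<in> borel_measurable borel"
    unfolding r_def by measurable
  have close: "\<bar>F (x, y) - F (x, y')\<bar> \<le> r x" if "y \<in> C" "y' \<in> C" "dist y y' < \<rho>" for x y y'
  proof -
    consider "R x \<le> \<delta>" | "\<delta> < R x" "R x \<le> K" | "K < R x"
      by linarith
    then show ?thesis
    proof cases
      case 1
      then show ?thesis using F0[OF _ 1] that \<eta> B by (simp add: r_def)
    next
      case 2
      then have "N x \<le> K powr (1 / a)"
        using less_R_iff[of K x] K(2) by auto
      then have "dist (F (x, y)) (F (x, y')) < \<eta>"
        using that by (intro unif) (auto simp: dist_Pair_Pair)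
      then show ?thesis using 2 B by (simp add: r_def dist_real_def)
    next
      case 3
      have "\<bar>F (x, y) - F (x, y')\<bar> \<le> B"
        using F(2,3)[of "(x, y)"] F(2,3)[of "(x, y')"] by linarith
      then show ?thesis using 3 \<eta> by (simp add: r_def indicator_def)
    qed
  qed
  have int_F: "integrable \<nu> (\<lambda>x. F (x, y))" if "y \<in> C" for y
    using F F0[OF that] \<delta> by (intro integrable_\<nu>[where B = B and \<delta> = \<delta>]) auto
  have int_FL: "integrable L (\<lambda>x. F (dil s x, y))" for s y
    using F by (intro integrable_L_bounded[where B = B] measurable_compose[OF dil_measurable Fm]) auto
  have int_r: "integrable \<nu> r"
    unfolding r_def using integrable_\<nu>_indicator[OF \<delta>] integrable_\<nu>_indicator[OF K(2)] by simp
  have int_r_eq: "(\<integral>x. r x \<partial>\<nu>) = \<eta> * \<delta> powr (-\<gamma>) + B * K powr (-\<gamma>)"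
    unfolding r_def using integrable_\<nu>_indicator[OF \<delta>] integrable_\<nu>_indicator[OF K(2)] \<delta> K(2)
    by (simp add: measure_\<nu>_R)
  have int_rL: "integrable L (\<lambda>x. r (dil s x))" for s
    using B \<eta> by (intro integrable_L_bounded[where B = "\<eta> + B"]) (auto simp: r_def indicator_def)
  have int_rL_eq: "(\<integral>x. r (dil (1 / t) x) \<partial>L) = \<eta> * G (\<delta> * t) + B * G (K * t)" if "0 < t" for t
  proof -
    have "integrable L (\<lambda>x. indicator {x. c < R x} (dil (1 / t) x) :: real)" for c
      by (rule integrable_L_bounded[where B = 1]) (simp_all add: indicator_def)
    then show ?thesis
      unfolding r_def G_rescaled[OF that, symmetric] by simp
  qed
  show thesis
  proof (rule that[OF \<rho>])
    fix y y' assume y: "y \<in> C" "y' \<in> C" "dist y y' < \<rho>"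
    have "\<bar>(\<integral>x. F (x, y) \<partial>\<nu>) - (\<integral>x. F (x, y') \<partial>\<nu>)\<bar> = \<bar>\<integral>x. F (x, y) - F (x, y') \<partial>\<nu>\<bar>"
      using int_F y by simp
    also have "\<dots> \<le> (\<integral>x. \<bar>F (x, y) - F (x, y')\<bar> \<partial>\<nu>)"
      by (rule integral_abs_bound)
    also have "\<dots> \<le> (\<integral>x. r x \<partial>\<nu>)"
      by (intro integral_mono integrable_abs Bochner_Integration.integrable_diff int_F y int_r close)
    finally show "\<bar>(\<integral>x. F (x, y) \<partial>\<nu>) - (\<integral>x. F (x, y') \<partial>\<nu>)\<bar> \<le> e"
      using lim by (simp add: int_r_eq)
  next
    have "((\<lambda>t. \<eta> * (G (\<delta> * t) / G t) + B * (G (K * t) / G t)) \<longlongrightarrow>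
        \<eta> * \<delta> powr (-\<gamma>) + B * K powr (-\<gamma>)) at_top"
      by (intro tendsto_intros G_ratio \<delta> K(2))
    then have "\<forall>\<^sub>F t in at_top. \<eta> * (G (\<delta> * t) / G t) + B * (G (K * t) / G t) < e"
      using lim by (rule order_tendstoD)
    then show "\<forall>\<^sub>F t in at_top. \<forall>y\<in>C. \<forall>y'\<in>C. dist y y' < \<rho> \<longrightarrow>
      \<bar>(\<integral>x. F (dil (1 / t) x, y) \<partial>L) / G t - (\<integral>x. F (dil (1 / t) x, y') \<partial>L) / G t\<bar> \<le> e"
      using eventually_gt_at_top[of 0]
    proof (eventually_elim, intro ballI impI)
      fix t y y' assume t: "\<eta> * (G (\<delta> * t) / G t) + B * (G (K * t) / G t) < e" "0 < t"
        and y: "y \<in> C" "y' \<in> C" "dist y y' < \<rho>"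
      have "\<bar>(\<integral>x. F (dil (1 / t) x, y) \<partial>L) - (\<integral>x. F (dil (1 / t) x, y') \<partial>L)\<bar>
          = \<bar>\<integral>x. F (dil (1 / t) x, y) - F (dil (1 / t) x, y') \<partial>L\<bar>"
        using int_FL by simp
      also have "\<dots> \<le> (\<integral>x. \<bar>F (dil (1 / t) x, y) - F (dil (1 / t) x, y')\<bar> \<partial>L)"
        by (rule integral_abs_bound)
      also have "\<dots> \<le> (\<integral>x. r (dil (1 / t) x) \<partial>L)"
        by (intro integral_mono integrable_abs Bochner_Integration.integrable_diff int_FL y int_rL close)
      finally have "\<bar>(\<integral>x. F (dil (1 / t) x, y) \<partial>L) - (\<integral>x. F (dil (1 / t) x, y') \<partial>L)\<bar> / G t
          \<le> (\<eta> * G (\<delta> * t) + B * G (K * t)) / G t"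
        unfolding int_rL_eq[OF t(2)] by (rule divide_right_mono) simp
      then show "\<bar>(\<integral>x. F (dil (1 / t) x, y) \<partial>L) / G t - (\<integral>x. F (dil (1 / t) x, y') \<partial>L) / G t\<bar> \<le> e"
        using t(1) G_pos[of t] by (simp add: add_divide_distrib diff_divide_distrib[symmetric])
    qed
  qed
qed

text \<open>Pointwise convergence on a finite net, together with the common modulus of continuity, gives uniform
  convergence on a compact set of parameters.\<close>

lemma parametric_tail_limit:
  fixes F :: "'a \<times> 'b::euclidean_space \<Rightarrow> real"
  assumes F: "continuous_on UNIV F" "\<And>p. 0 \<le> F p" "\<And>p. F p \<le> B"
    and C: "compact C" and \<delta>: "0 < \<delta>"
    and F0: "\<And>x y. y \<in> C \<Longrightarrow> R x \<le> \<delta> \<Longrightarrow> F (x, y) = 0"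
  shows "continuous_on C (\<lambda>y. \<integral>x. F (x, y) \<partial>\<nu>)"
    and "0 < e \<Longrightarrow> \<forall>\<^sub>F t in at_top. \<forall>y\<in>C.
      \<bar>(\<integral>x. F (dil (1 / t) x, y) \<partial>L) / G t - (\<integral>x. F (x, y) \<partial>\<nu>)\<bar> \<le> e"
proof -
  show "continuous_on C (\<lambda>y. \<integral>x. F (x, y) \<partial>\<nu>)"
    unfolding continuous_on_iff
  proof (intro ballI allI impI)
    fix y and e :: real assume y: "y \<in> C" and e: "0 < e"
    obtain \<rho> where \<rho>: "0 < \<rho>"
      "\<And>y y'. y \<in> C \<Longrightarrow> y' \<in> C \<Longrightarrow> dist y y' < \<rho> \<Longrightarrow>
        \<bar>(\<integral>x. F (x, y) \<partial>\<nu>) - (\<integral>x. F (x, y') \<partial>\<nu>)\<bar> \<le> e / 2"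
      by (rule parametric_modulus[OF F C \<delta> F0, of "e / 2"]) (use e in auto)
    have "dist (\<integral>x. F (x, y') \<partial>\<nu>) (\<integral>x. F (x, y) \<partial>\<nu>) < e" if "y' \<in> C" "dist y' y < \<rho>" for y'
      using \<rho>(2)[OF that(1) y that(2)] e by (simp add: dist_real_def)
    with \<rho>(1) show "\<exists>d>0. \<forall>y'\<in>C. dist y' y < d \<longrightarrow>
        dist (\<integral>x. F (x, y') \<partial>\<nu>) (\<integral>x. F (x, y) \<partial>\<nu>) < e"
      by blast
  qed
  assume e: "0 < e"
  obtain \<rho> where \<rho>: "0 < \<rho>"
    and mod\<nu>: "\<And>y y'. y \<in> C \<Longrightarrow> y' \<in> C \<Longrightarrow> dist y y' < \<rho> \<Longrightarrow>
      \<bar>(\<integral>x. F (x, y) \<partial>\<nu>) - (\<integral>x. F (x, y') \<partial>\<nu>)\<bar> \<le> e / 3"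
    and modL: "\<forall>\<^sub>F t in at_top. \<forall>y\<in>C. \<forall>y'\<in>C. dist y y' < \<rho> \<longrightarrow>
      \<bar>(\<integral>x. F (dil (1 / t) x, y) \<partial>L) / G t - (\<integral>x. F (dil (1 / t) x, y') \<partial>L) / G t\<bar> \<le> e / 3"
    by (rule parametric_modulus[OF F C \<delta> F0, of "e / 3"]) (use e in auto)
  obtain D where D: "D \<subseteq> C" "finite D" "C \<subseteq> (\<Union>z\<in>D. ball z \<rho>)"
    by (rule compactE_image[OF C, of C "\<lambda>z. ball z \<rho>"]) (use \<rho> in \<open>auto intro: centre_in_ball[THEN iffD2]\<close>)
  have "((\<lambda>t. (\<integral>x. F (dil (1 / t) x, z) \<partial>L) / G t) \<longlongrightarrow> (\<integral>x. F (x, z) \<partial>\<nu>)) at_top" if "z \<in> D" for z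
    using that D(1) F0
    by (intro tail_limit_vanishing[where B = B and c = \<delta>] F \<delta> continuous_on_compose2[OF F(1)] continuous_intros) auto
  then have "\<forall>\<^sub>F t in at_top. \<bar>(\<integral>x. F (dil (1 / t) x, z) \<partial>L) / G t - (\<integral>x. F (x, z) \<partial>\<nu>)\<bar> < e / 3"
    if "z \<in> D" for z
    using tendstoD[of _ _ at_top "e / 3"] that e by (fastforce simp: dist_real_def)
  then have "\<forall>\<^sub>F t in at_top. \<forall>z\<in>D. \<bar>(\<integral>x. F (dil (1 / t) x, z) \<partial>L) / G t - (\<integral>x. F (x, z) \<partial>\<nu>)\<bar> < e / 3"
    using D(2) by (simp add: eventually_ball_finite)
  with modL show "\<forall>\<^sub>F t in at_top. \<forall>y\<in>C.
      \<bar>(\<integral>x. F (dil (1 / t) x, y) \<partial>L) / G t - (\<integral>x. F (x, y) \<partial>\<nu>)\<bar> \<le> e"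
  proof (eventually_elim, intro ballI)
    fix t y
    assume mod: "\<forall>y\<in>C. \<forall>y'\<in>C. dist y y' < \<rho> \<longrightarrow>
      \<bar>(\<integral>x. F (dil (1 / t) x, y) \<partial>L) / G t - (\<integral>x. F (dil (1 / t) x, y') \<partial>L) / G t\<bar> \<le> e / 3"
      and net: "\<forall>z\<in>D. \<bar>(\<integral>x. F (dil (1 / t) x, z) \<partial>L) / G t - (\<integral>x. F (x, z) \<partial>\<nu>)\<bar> < e / 3"
      and y: "y \<in> C"
    obtain z where z: "z \<in> D" "dist y z < \<rho>"
      using D(3) y by (auto simp: dist_commute)
    then have "z \<in> C" using D(1) by blast
    then show "\<bar>(\<integral>x. F (dil (1 / t) x, y) \<partial>L) / G t - (\<integral>x. F (x, y) \<partial>\<nu>)\<bar> \<le> e"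
      using mod[rule_format, OF y \<open>z \<in> C\<close> z(2)] net[rule_format, OF z(1)] mod\<nu>[OF y \<open>z \<in> C\<close> z(2)]
      by linarith
  qed
qed

end

section \<open>Conditioning on the other vector\<close>

lemma integrable_Fatou:
  fixes f :: "nat \<Rightarrow> 'a \<Rightarrow> real"
  assumes int: "\<And>n. integrable M (f n)" and nonneg: "\<And>n x. 0 \<le> f n x"
    and lim: "\<And>x. (\<lambda>n. f n x) \<longlonglongrightarrow> g x" and bound: "\<And>n. (\<integral>x. f n x \<partial>M) \<le> C"
  shows "integrable M g"
proof -
  have [measurable]: "f n \<in> borel_measurable M" for n
    using int by (rule borel_measurable_integrable)
  have gm: "g \<in> borel_measurable M"
    by (rule borel_measurable_LIMSEQ_real[where u = f]) (use lim in auto)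
  have g0: "0 \<le> g x" for x
    by (rule LIMSEQ_le_const[OF lim]) (use nonneg in auto)
  have "(\<lambda>n. ennreal (f n x)) \<longlonglongrightarrow> ennreal (g x)" for x
    by (intro tendsto_ennrealI lim)
  then have "(\<integral>\<^sup>+x. ennreal (g x) \<partial>M) = (\<integral>\<^sup>+x. liminf (\<lambda>n. ennreal (f n x)) \<partial>M)"
    by (intro nn_integral_cong lim_imp_Liminf[symmetric] trivial_limit_sequentially)
  also have "\<dots> \<le> liminf (\<lambda>n. \<integral>\<^sup>+x. ennreal (f n x) \<partial>M)"
    by (rule nn_integral_liminf) simp
  also have "\<dots> \<le> liminf (\<lambda>n. ennreal C)"
    using bound by (intro Liminf_mono always_eventually allI)
      (simp add: nn_integral_eq_integral[OF int] nonneg ennreal_leI)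
  also have "\<dots> < \<infinity>"
    by (simp add: Liminf_const)
  finally show ?thesis
    using gm g0 by (intro integrableI_nonneg) auto
qed

text \<open>Bounds on truncated moments are all that the tails of products provide; Fatou's lemma turns them into
  integrability.\<close>

lemma integrable_powr_truncations:
  fixes w :: "'a \<Rightarrow> real"
  assumes M: "prob_space M" and [measurable]: "\<And>n. f n \<in> borel_measurable M"
    and f: "\<And>n x. 0 \<le> f n x" "\<And>n x. f n x \<le> real (Suc n)"
    and eq: "\<And>n x. w x \<le> real n \<Longrightarrow> f n x = w x" and c: "0 \<le> c"
    and bound: "\<And>n. (\<integral>x. f n x powr c \<partial>M) \<le> C"
  shows "integrable M (\<lambda>x. w x powr c)"
proof (rule integrable_Fatou)
  interpret prob_space M by fact
  show "integrable M (\<lambda>x. f n x powr c)" for n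
    by (rule integrable_const_bound[where B = "real (Suc n) powr c"])
       (use f c in \<open>auto intro!: powr_mono2 simp del: of_nat_Suc\<close>)
  show "(\<lambda>n. f n x powr c) \<longlonglongrightarrow> w x powr c" for x
  proof (rule tendsto_eventually)
    obtain m where "w x \<le> real m"
      using real_arch_simple by blast
    then have "w x \<le> real n" if "m \<le> n" for n
      using that by simp
    then show "\<forall>\<^sub>F n in sequentially. f n x powr c = w x powr c"
      unfolding eventually_sequentially using eq by metis
  qed
qed (use bound in auto)

context regular_tail
begin

lemma measure_\<nu>_inverse: "0 < r \<Longrightarrow> measure \<nu> {x. 1 / r < R x} = r powr \<gamma>"
  by (simp add: measure_\<nu>_R powr_divide powr_minus_divide)

text \<open>The regime where one vector is extreme and the other one is not: the quotients converge for each
  value \<open>y\<close> of the other vector, and they are bounded because \<open>H\<close> vanishes for \<open>x\<close> in a ball that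
  does not depend on \<open>y\<close>.\<close>

lemma mixed_tail_limit:
  fixes H :: "'a \<times> 'b::euclidean_space \<Rightarrow> real" and L' :: "'b measure"
  assumes L': "prob_space L'" and [measurable_cong]: "sets L' = sets borel"
    and [measurable]: "H \<in> borel_measurable borel"
    and H: "\<And>p. 0 \<le> H p" "\<And>p. H p \<le> B" and \<delta>: "0 < \<delta>"
    and H0: "\<And>x y. R x \<le> \<delta> \<Longrightarrow> H (x, y) = 0"
    and lim: "\<And>y. ((\<lambda>t. (\<integral>x. H (dil (1 / t) x, y) \<partial>L) / G t) \<longlongrightarrow> (\<integral>x. H (x, y) \<partial>\<nu>)) at_top"
  shows "((\<lambda>t. (\<integral>y. (\<integral>x. H (dil (1 / t) x, y) \<partial>L) \<partial>L') / G t)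
    \<longlongrightarrow> (\<integral>y. (\<integral>x. H (x, y) \<partial>\<nu>) \<partial>L')) at_top"
proof -
  interpret L': prob_space L' by fact
  interpret \<nu>: sigma_finite_measure \<nu> by (rule sigma_finite_\<nu>)
  have B: "0 \<le> B"
    using H(1,2)[of undefined] by linarith
  define C where "C = B * (\<delta> powr (-\<gamma>) + 1)"
  have "((\<lambda>t. B * (G (\<delta> * t) / G t)) \<longlongrightarrow> B * \<delta> powr (-\<gamma>)) at_top"
    by (intro tendsto_intros G_ratio \<delta>)
  moreover have "B * \<delta> powr (-\<gamma>) < C + 1"
    using B by (simp add: C_def algebra_simps)
  ultimately have ev: "\<forall>\<^sub>F t in at_top. B * (G (\<delta> * t) / G t) < C + 1"
    by (rule order_tendstoD)
  have "((\<lambda>t. \<integral>y. (\<integral>x. H (dil (1 / t) x, y) \<partial>L) / G t \<partial>L')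
    \<longlongrightarrow> (\<integral>y. (\<integral>x. H (x, y) \<partial>\<nu>) \<partial>L')) at_top"
  proof (rule integral_dominated_convergence_at_top[where w = "\<lambda>_. C + 1"])
    show "\<forall>\<^sub>F t in at_top. AE y in L'. norm ((\<integral>x. H (dil (1 / t) x, y) \<partial>L) / G t) \<le> C + 1"
      using ev eventually_gt_at_top[of 0]
    proof (eventually_elim, intro AE_I2)
      fix t y assume t: "B * (G (\<delta> * t) / G t) < C + 1" "0 < t"
      have 1: "H (dil (1 / t) x, y) \<le> B * indicator {x. \<delta> < R x} (dil (1 / t) x)" for x
        using H(2) H0[of "dil (1 / t) x"] B by (auto simp: indicator_def not_less)
      have "(\<integral>x. H (dil (1 / t) x, y) \<partial>L) \<le> (\<integral>x. B * indicator {x. \<delta> < R x} (dil (1 / t) x) \<partial>L)"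
        using H B by (intro integral_mono 1 integrable_L_bounded[where B = B]) (auto simp: indicator_def)
      also have "\<dots> = B * G (\<delta> * t)"
        using G_rescaled[OF t(2)] by simp
      finally have "(\<integral>x. H (dil (1 / t) x, y) \<partial>L) / G t \<le> B * G (\<delta> * t) / G t"
        by (rule divide_right_mono) simp
      moreover have "0 \<le> (\<integral>x. H (dil (1 / t) x, y) \<partial>L) / G t"
        using H(1) by (intro divide_nonneg_nonneg Bochner_Integration.integral_nonneg) auto
      ultimately show "norm ((\<integral>x. H (dil (1 / t) x, y) \<partial>L) / G t) \<le> C + 1"
        using t(1) by simp
    qed
    show "AE y in L'. ((\<lambda>t. (\<integral>x. H (dil (1 / t) x, y) \<partial>L) / G t) \<longlongrightarrow> (\<integral>x. H (x, y) \<partial>\<nu>)) at_top"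
      using lim by simp
  qed measurable
  then show ?thesis by simp
qed

text \<open>Breiman's lemma in the elementary case of a bounded factor.\<close>

lemma bounded_factor_tail:
  fixes w :: "'b::euclidean_space \<Rightarrow> real" and L' :: "'b measure"
  assumes L': "prob_space L'" and [measurable_cong]: "sets L' = sets borel"
    and [measurable]: "w \<in> borel_measurable borel"
    and w: "\<And>y. 0 \<le> w y" "\<And>y. w y \<le> K" and K: "0 < K"
  shows "((\<lambda>t. (\<integral>y. measure L {x. t < R x * w y} \<partial>L') / G t) \<longlongrightarrow> (\<integral>y. w y powr \<gamma> \<partial>L')) at_top"
proof -
  define H where "H p = (indicator {p. 1 < R (fst p) * w (snd p)} p :: real)" for p
  have Hm [measurable]: "H \<in> borel_measurable borel"
    unfolding H_def borel_prod[symmetric] by measurable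
  have Heq: "H (x, y) = (if w y = 0 then 0 else indicator {x. 1 / w y < R x} x)" for x y
    using w(1)[of y] by (auto simp: H_def indicator_def field_simps less_le)
  have w_pos: "w y \<noteq> 0 \<Longrightarrow> 0 < w y" for y
    using w(1)[of y] by simp
  have "(\<integral>x. H (x, y) \<partial>\<nu>) = w y powr \<gamma>" for y
    using w_pos[of y] by (cases "w y = 0") (simp_all add: Heq measure_\<nu>_inverse)
  moreover have "((\<lambda>t. (\<integral>y. (\<integral>x. H (dil (1 / t) x, y) \<partial>L) \<partial>L') / G t)
      \<longlongrightarrow> (\<integral>y. (\<integral>x. H (x, y) \<partial>\<nu>) \<partial>L')) at_top"
  proof (rule mixed_tail_limit[OF L' assms(2) Hm, where B = 1 and \<delta> = "1 / K"])
    show "H (x, y) = 0" if "R x \<le> 1 / K" for x y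
      using mult_mono[OF that w(2)[of y]] w(1)[of y] K by (simp add: H_def)
    show "((\<lambda>t. (\<integral>x. H (dil (1 / t) x, y) \<partial>L) / G t) \<longlongrightarrow> (\<integral>x. H (x, y) \<partial>\<nu>)) at_top" for y
      using tail_limit[of "\<lambda>_. 1" 1 "1 / w y"] w_pos[of y] by (cases "w y = 0") (simp_all add: Heq)
  qed (use K in \<open>auto simp: H_def indicator_def\<close>)
  moreover have "\<forall>\<^sub>F t in at_top. (\<integral>y. (\<integral>x. H (dil (1 / t) x, y) \<partial>L) \<partial>L') / G t
      = (\<integral>y. measure L {x. t < R x * w y} \<partial>L') / G t"
    using eventually_gt_at_top[of 0]
  proof eventually_elim
    case (elim t)
    have "H (dil (1 / t) x, y) = indicator {x. t < R x * w y} x" for x y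
      using elim by (auto simp: H_def indicator_def R_dil field_simps)
    then show ?case by simp
  qed
  ultimately show ?thesis
    by (simp only: tendsto_cong)
qed

end

section \<open>The tail of the product of the radii\<close>

text \<open>The independent vectors are represented by the product of their laws, and the spectral vector by its
  law \<open>Q\<close>.\<close>

locale product_tail =
  X: regular_tail L\<^sub>X N\<^sub>X \<alpha>\<^sub>X a\<^sub>X \<nu>\<^sub>X + Y: regular_tail L\<^sub>Y N\<^sub>Y \<alpha>\<^sub>Y a\<^sub>Y \<nu>\<^sub>Y
  for L\<^sub>X :: "'a::euclidean_space measure" and N\<^sub>X \<alpha>\<^sub>X a\<^sub>X \<nu>\<^sub>X
    and L\<^sub>Y :: "'b::euclidean_space measure" and N\<^sub>Y \<alpha>\<^sub>Y a\<^sub>Y \<nu>\<^sub>Y +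
  fixes Q :: "'b measure" and c\<^sub>X c\<^sub>Y :: real
  assumes prob_Q: "prob_space Q" and sets_Q [measurable_cong, simp]: "sets Q = sets borel"
    and Q_sphere: "AE y in Q. N\<^sub>Y y = 1"
    and spectral: "continuous_on UNIV k \<Longrightarrow> bounded (range k) \<Longrightarrow>
      ((\<lambda>u. (\<integral>y. k ((1 / N\<^sub>Y y) *\<^sub>R y) * indicator {y. u < Y.R y} y \<partial>L\<^sub>Y) / Y.G u) \<longlongrightarrow> (\<integral>y. k y \<partial>Q)) at_top"
    and lim_X: "((\<lambda>t. X.G t / measure (L\<^sub>X \<Otimes>\<^sub>M L\<^sub>Y) {p. t < X.R (fst p) * Y.R (snd p)}) \<longlongrightarrow> c\<^sub>X) at_top"
    and lim_Y: "((\<lambda>t. Y.G t / measure (L\<^sub>X \<Otimes>\<^sub>M L\<^sub>Y) {p. t < X.R (fst p) * Y.R (snd p)}) \<longlongrightarrow> c\<^sub>Y) at_top"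
begin

sublocale XY: pair_prob_space L\<^sub>X L\<^sub>Y ..

sublocale Q: prob_space Q by (rule prob_Q)

abbreviation L :: "('a \<times> 'b) measure" where "L \<equiv> L\<^sub>X \<Otimes>\<^sub>M L\<^sub>Y"

lemma sets_L [measurable_cong, simp]: "sets L = sets borel"
  unfolding borel_prod[symmetric] by (rule sets_pair_measure_cong) auto

lemma space_L [simp]: "space L = UNIV"
  by (simp add: space_pair_measure)

lemma R_fst_measurable [measurable]: "(\<lambda>p. X.R (fst p)) \<in> borel_measurable (borel :: ('a \<times> 'b) measure)"
  and R_snd_measurable [measurable]: "(\<lambda>p. Y.R (snd p)) \<in> borel_measurable (borel :: ('a \<times> 'b) measure)"
  and R_fst_measurable' [measurable]: "(\<lambda>p. Y.R (fst p)) \<in> borel_measurable (borel :: ('b \<times> 'a) measure)"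
  by (intro borel_measurable_continuous_onI continuous_intros)+

lemma integrable_L_bounded:
  assumes [measurable]: "f \<in> borel_measurable borel" and "\<And>p. \<bar>f p\<bar> \<le> B"
  shows "integrable L (f :: 'a \<times> 'b \<Rightarrow> real)"
  by (rule XY.P.integrable_const_bound[where B = B]) (use assms(2) in auto)

lemma integral_L:
  fixes f :: "'a \<times> 'b \<Rightarrow> real"
  assumes f: "f \<in> borel_measurable borel" "\<And>p. \<bar>f p\<bar> \<le> B"
  shows "(\<integral>p. f p \<partial>L) = (\<integral>x. (\<integral>y. f (x, y) \<partial>L\<^sub>Y) \<partial>L\<^sub>X)"
    and "(\<integral>p. f p \<partial>L) = (\<integral>y. (\<integral>x. f (x, y) \<partial>L\<^sub>X) \<partial>L\<^sub>Y)"
proof -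
  have "integrable L f"
    using f by (rule integrable_L_bounded)
  then have i: "integrable L (\<lambda>(x, y). f (x, y))"
    by simp
  show "(\<integral>p. f p \<partial>L) = (\<integral>x. (\<integral>y. f (x, y) \<partial>L\<^sub>Y) \<partial>L\<^sub>X)"
    using XY.integral_fst[OF i] by simp
  show "(\<integral>p. f p \<partial>L) = (\<integral>y. (\<integral>x. f (x, y) \<partial>L\<^sub>X) \<partial>L\<^sub>Y)"
    using XY.integral_snd[OF i] by simp
qed

lemma measure_L:
  assumes S: "S \<in> sets borel"
  shows "measure L S = (\<integral>x. measure L\<^sub>Y {y. (x, y) \<in> S} \<partial>L\<^sub>X)"
    and "measure L S = (\<integral>y. measure L\<^sub>X {x. (x, y) \<in> S} \<partial>L\<^sub>Y)"
proof -
  have ind: "(indicator S (x, y) :: real) = indicator {y. (x, y) \<in> S} y"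
    "(indicator S (x, y) :: real) = indicator {x. (x, y) \<in> S} x" for x y
    by (auto simp: indicator_def)
  have "measure L S = (\<integral>p. indicator S p \<partial>L)"
    by simp
  also have "\<dots> = (\<integral>x. (\<integral>y. indicator S (x, y) \<partial>L\<^sub>Y) \<partial>L\<^sub>X)"
    using S by (intro integral_L(1)[where B = 1]) auto
  finally show "measure L S = (\<integral>x. measure L\<^sub>Y {y. (x, y) \<in> S} \<partial>L\<^sub>X)"
    unfolding ind(1) by simp
  have "measure L S = (\<integral>p. indicator S p \<partial>L)"
    by simp
  also have "\<dots> = (\<integral>y. (\<integral>x. indicator S (x, y) \<partial>L\<^sub>X) \<partial>L\<^sub>Y)"
    using S by (intro integral_L(2)[where B = 1]) auto
  finally show "measure L S = (\<integral>y. measure L\<^sub>X {x. (x, y) \<in> S} \<partial>L\<^sub>Y)"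
    unfolding ind(2) by simp
qed

lemma measure_section_measurable:
  assumes [measurable]: "S \<in> sets borel"
  shows "(\<lambda>x. measure L\<^sub>Y {y. (x, y) \<in> S}) \<in> borel_measurable borel"
    and "(\<lambda>y. measure L\<^sub>X {x. (x, y) \<in> S}) \<in> borel_measurable borel"
proof -
  have ind: "(indicator S (x, y) :: real) = indicator {y. (x, y) \<in> S} y"
    "(indicator S (x, y) :: real) = indicator {x. (x, y) \<in> S} x" for x y
    by (auto simp: indicator_def)
  have "(\<lambda>x. \<integral>y. indicator S (x, y) \<partial>L\<^sub>Y :: real) \<in> borel_measurable borel"
    by measurable
  then show "(\<lambda>x. measure L\<^sub>Y {y. (x, y) \<in> S}) \<in> borel_measurable borel"
    unfolding ind(1) by simp
  have "(\<lambda>y. \<integral>x. indicator S (x, y) \<partial>L\<^sub>X :: real) \<in> borel_measurable borel"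
    by measurable
  then show "(\<lambda>y. measure L\<^sub>X {x. (x, y) \<in> S}) \<in> borel_measurable borel"
    unfolding ind(2) by simp
qed

definition h :: "real \<Rightarrow> real" where
  "h t = measure L {p. t < X.R (fst p) * Y.R (snd p)}"

lemma tail_sets: "{p. t < X.R (fst p) * Y.R (snd p)} \<in> sets L"
  unfolding sets_L by measurable

lemma h_pos: "0 < h t"
proof -
  have "0 < X.G (max t 1) * Y.G 1"
    by (intro mult_pos_pos X.G_pos Y.G_pos)
  also have "\<dots> = measure L ({x. max t 1 < X.R x} \<times> {y. 1 < Y.R y})"
    unfolding X.G_def Y.G_def
    by (simp add: measure_def Y.emeasure_pair_measure_Times enn2real_mult)
  also have "\<dots> \<le> h t"
    unfolding h_def
  proof (intro XY.P.finite_measure_mono[OF _ tail_sets] subsetI)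
    fix p assume p: "p \<in> {x. max t 1 < X.R x} \<times> {y. 1 < Y.R y}"
    then have "max t 1 * 1 < X.R (fst p) * Y.R (snd p)"
      by (intro mult_strict_mono) auto
    then show "p \<in> {p. t < X.R (fst p) * Y.R (snd p)}"
      by simp
  qed
  finally show ?thesis .
qed

lemma h_nonneg [simp]: "0 \<le> h t"
  using h_pos[of t] by simp

lemma lim_X_h: "((\<lambda>t. X.G t / h t) \<longlongrightarrow> c\<^sub>X) at_top"
  unfolding h_def by (rule lim_X)

lemma lim_Y_h: "((\<lambda>t. Y.G t / h t) \<longlongrightarrow> c\<^sub>Y) at_top"
  unfolding h_def by (rule lim_Y)

lemma c_X_nonneg: "0 \<le> c\<^sub>X"
  by (rule tendsto_lowerbound[OF lim_X_h]) (auto intro!: always_eventually)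

lemma c_Y_nonneg: "0 \<le> c\<^sub>Y"
  by (rule tendsto_lowerbound[OF lim_Y_h]) (auto intro!: always_eventually)

lemma change_normalization_X:
  assumes "((\<lambda>t. f t / X.G t) \<longlongrightarrow> l) at_top"
  shows "((\<lambda>t. f t / h t) \<longlongrightarrow> c\<^sub>X * l) at_top"
proof -
  have "((\<lambda>t. X.G t / h t * (f t / X.G t)) \<longlongrightarrow> c\<^sub>X * l) at_top"
    by (intro tendsto_mult lim_X_h assms)
  moreover have "X.G t / h t * (f t / X.G t) = f t / h t" for t
    using X.G_pos[of t] by simp
  ultimately show ?thesis by simp
qed

lemma change_normalization_Y:
  assumes "((\<lambda>t. f t / Y.G t) \<longlongrightarrow> l) at_top"
  shows "((\<lambda>t. f t / h t) \<longlongrightarrow> c\<^sub>Y * l) at_top"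
proof -
  have "((\<lambda>t. Y.G t / h t * (f t / Y.G t)) \<longlongrightarrow> c\<^sub>Y * l) at_top"
    by (intro tendsto_mult lim_Y_h assms)
  moreover have "Y.G t / h t * (f t / Y.G t) = f t / h t" for t
    using Y.G_pos[of t] by simp
  ultimately show ?thesis by simp
qed

lemma tail_measurable [measurable]:
  "(\<lambda>x. measure L\<^sub>Y {y. t < X.R x * Y.R y}) \<in> borel_measurable borel"
  "(\<lambda>y. measure L\<^sub>X {x. t < X.R x * Y.R y}) \<in> borel_measurable borel"
  using measure_section_measurable[of "{p. t < X.R (fst p) * Y.R (snd p)}"] by simp_all

text \<open>In the regime \<open>S \<le> K\<close> the factor multiplying \<open>R\<close> is \<open>S\<close> set to zero above \<open>K\<close>, whereas the regime \<open>S > t / K\<close>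
  together with \<open>R S > t\<close> amounts to \<open>S min(R, K) > t\<close>. Hence the two different truncations.\<close>

definition truncated_moment_Y :: "real \<Rightarrow> real" where
  "truncated_moment_Y K = (\<integral>y. (Y.R y * indicator {y. Y.R y \<le> K} y) powr X.\<gamma> \<partial>L\<^sub>Y)"

definition truncated_moment_X :: "real \<Rightarrow> real" where
  "truncated_moment_X K = (\<integral>x. min (X.R x) K powr Y.\<gamma> \<partial>L\<^sub>X)"

lemma tail_small_Y:
  assumes K: "0 < K"
  shows "((\<lambda>t. measure L {p. t < X.R (fst p) * Y.R (snd p) \<and> Y.R (snd p) \<le> K} / h t) \<longlongrightarrow> c\<^sub>X * truncated_moment_Y K) at_top"
proof (rule change_normalization_X)
  have lim: "((\<lambda>t. (\<integral>y. measure L\<^sub>X {x. t < X.R x * (Y.R y * indicator {y. Y.R y \<le> K} y)} \<partial>L\<^sub>Y) / X.G t)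
      \<longlongrightarrow> truncated_moment_Y K) at_top"
    unfolding truncated_moment_Y_def using K
    by (intro X.bounded_factor_tail[where K = K]) (auto simp: indicator_def Y.prob_space_axioms)
  have "\<forall>\<^sub>F t in at_top. (\<integral>y. measure L\<^sub>X {x. t < X.R x * (Y.R y * indicator {y. Y.R y \<le> K} y)} \<partial>L\<^sub>Y) / X.G t
      = measure L {p. t < X.R (fst p) * Y.R (snd p) \<and> Y.R (snd p) \<le> K} / X.G t"
    using eventually_gt_at_top[of 0]
  proof eventually_elim
    case (elim t)
    have "{x. t < X.R x * (Y.R y * indicator {y. Y.R y \<le> K} y)}
        = {x. (x, y) \<in> {p. t < X.R (fst p) * Y.R (snd p) \<and> Y.R (snd p) \<le> K}}" for y
      using elim by (auto simp: indicator_def split: if_splits)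
    then show ?case
      by (subst measure_L(2)) auto
  qed
  with lim show "((\<lambda>t. measure L {p. t < X.R (fst p) * Y.R (snd p) \<and> Y.R (snd p) \<le> K} / X.G t) \<longlongrightarrow> truncated_moment_Y K) at_top"
    by (rule Lim_transform_eventually)
qed

lemma tail_large_Y:
  assumes K: "0 < K"
  shows "((\<lambda>t. measure L {p. t < X.R (fst p) * Y.R (snd p) \<and> t / K < Y.R (snd p)} / h t) \<longlongrightarrow> c\<^sub>Y * truncated_moment_X K) at_top"
proof (rule change_normalization_Y)
  have lim: "((\<lambda>t. (\<integral>x. measure L\<^sub>Y {y. t < Y.R y * min (X.R x) K} \<partial>L\<^sub>X) / Y.G t) \<longlongrightarrow> truncated_moment_X K) at_top"
    unfolding truncated_moment_X_def using K
    by (intro Y.bounded_factor_tail[where K = K]) (auto simp: X.prob_space_axioms)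
  have "{y. t < Y.R y * min (X.R x) K}
      = {y. (x, y) \<in> {p. t < X.R (fst p) * Y.R (snd p) \<and> t / K < Y.R (snd p)}}" for t x
    using K mult_left_mono[of K "X.R x" "Y.R _"] mult_left_mono[of "X.R x" K "Y.R _"]
    by (auto simp: field_simps min_def intro: less_le_trans)
  then have "(\<integral>x. measure L\<^sub>Y {y. t < Y.R y * min (X.R x) K} \<partial>L\<^sub>X)
      = measure L {p. t < X.R (fst p) * Y.R (snd p) \<and> t / K < Y.R (snd p)}" for t
    by (subst measure_L(1)) auto
  with lim show "((\<lambda>t. measure L {p. t < X.R (fst p) * Y.R (snd p) \<and> t / K < Y.R (snd p)} / Y.G t) \<longlongrightarrow> truncated_moment_X K) at_top"
    by simp
qed

end

section \<open>The limit theorem for homogeneous functionals\<close>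

text \<open>A continuous function of \<open>\<psi>(x, y)\<close> that vanishes near the origin enters the argument only through
  the properties listed here. Abstracting from \<open>\<psi>\<close> makes it possible to apply the limit theorem also to
  functions of the product of the radii.\<close>

locale product_functional = product_tail +
  fixes F :: "'a \<times> 'b \<Rightarrow> real" and C \<delta> :: real
  assumes F_continuous: "continuous_on UNIV F"
    and F_nonneg: "\<And>p. 0 \<le> F p" and F_le: "\<And>p. F p \<le> C"
    and \<delta>_pos: "0 < \<delta>"
    and F_zero: "\<And>x y. X.R x * Y.R y \<le> \<delta> \<Longrightarrow> F (x, y) = 0"
    and F_dil: "\<And>s x y. 0 \<le> s \<Longrightarrow> F (X.dil s x, y) = F (x, Y.dil s y)"
begin

text \<open>The asymptotic weight of the value \<open>y\<close> of the second vector when the first one is extreme; below,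
  \<open>\<kappa>'\<close> is the weight with the two roles exchanged.\<close>

definition \<kappa> :: "'b \<Rightarrow> real" where "\<kappa> y = (\<integral>x. F (x, y) \<partial>\<nu>\<^sub>X)"

definition \<kappa>' :: "'a \<Rightarrow> real" where "\<kappa>' x = (\<integral>y. F (x, y) \<partial>\<nu>\<^sub>Y)"

definition Ft :: "real \<Rightarrow> 'a \<times> 'b \<Rightarrow> real" where "Ft t p = F (X.dil (1 / t) (fst p), snd p)"

lemma F_measurable [measurable]: "F \<in> borel_measurable borel"
  by (rule borel_measurable_continuous_onI[OF F_continuous])

lemma Ft_measurable [measurable]: "Ft t \<in> borel_measurable borel"
  unfolding Ft_def
  by (intro borel_measurable_continuous_onI continuous_on_compose2[OF F_continuous] continuous_intros) auto

lemma F_swap_measurable [measurable]: "(\<lambda>p. F (snd p, fst p)) \<in> borel_measurable borel"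
  by (intro borel_measurable_continuous_onI continuous_on_compose2[OF F_continuous] continuous_intros) auto

lemma C_nonneg: "0 \<le> C"
  using F_nonneg[of undefined] F_le[of undefined] by linarith

lemma F_abs_le: "\<bar>F p\<bar> \<le> C"
  using F_nonneg[of p] F_le[of p] by simp

lemma Ft_bounds: "0 \<le> Ft t p" "Ft t p \<le> C" "\<bar>Ft t p\<bar> \<le> C"
  using F_nonneg F_le F_abs_le by (auto simp: Ft_def)

lemma \<kappa>_measurable [measurable]: "\<kappa> \<in> borel_measurable borel"
proof -
  interpret \<nu>: sigma_finite_measure \<nu>\<^sub>X by (rule X.sigma_finite_\<nu>)
  show ?thesis unfolding \<kappa>_def by measurable
qed

lemma \<kappa>'_measurable [measurable]: "\<kappa>' \<in> borel_measurable borel"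
proof -
  interpret \<nu>: sigma_finite_measure \<nu>\<^sub>Y by (rule Y.sigma_finite_\<nu>)
  show ?thesis unfolding \<kappa>'_def by measurable
qed

lemma integral_small_Y:
  assumes K: "0 < K"
  shows "((\<lambda>t. (\<integral>p. Ft t p * indicator {p. Y.R (snd p) \<le> K} p \<partial>L) / h t)
    \<longlongrightarrow> c\<^sub>X * (\<integral>y. \<kappa> y * indicator {y. Y.R y \<le> K} y \<partial>L\<^sub>Y)) at_top"
proof (rule change_normalization_X)
  define H where "H p = F p * indicator {p. Y.R (snd p) \<le> K} p" for p
  have [measurable]: "H \<in> borel_measurable borel"
    unfolding H_def by measurable
  have Heq: "H (x, y) = F (x, y) * indicator {y. Y.R y \<le> K} y" for x y
    by (auto simp: H_def indicator_def)
  have H0: "H (x, y) = 0" if "X.R x \<le> \<delta> / K" for x y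
  proof -
    have "X.R x * Y.R y \<le> \<delta>" if "Y.R y \<le> K"
      using mult_mono[OF \<open>X.R x \<le> \<delta> / K\<close> that] K \<delta>_pos by simp
    then show ?thesis
      using F_zero[of x y] by (auto simp: Heq indicator_def)
  qed
  have "((\<lambda>t. (\<integral>y. (\<integral>x. H (X.dil (1 / t) x, y) \<partial>L\<^sub>X) \<partial>L\<^sub>Y) / X.G t)
      \<longlongrightarrow> (\<integral>y. (\<integral>x. H (x, y) \<partial>\<nu>\<^sub>X) \<partial>L\<^sub>Y)) at_top"
  proof (rule X.mixed_tail_limit[where B = C and \<delta> = "\<delta> / K"])
    show "((\<lambda>t. (\<integral>x. H (X.dil (1 / t) x, y) \<partial>L\<^sub>X) / X.G t) \<longlongrightarrow> (\<integral>x. H (x, y) \<partial>\<nu>\<^sub>X)) at_top" for y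
    proof (rule X.tail_limit_vanishing[where c = "\<delta> / K" and B = C])
      show "continuous_on UNIV (\<lambda>x. H (x, y))"
        unfolding Heq by (intro continuous_intros continuous_on_compose2[OF F_continuous]) auto
    qed (use K \<delta>_pos F_nonneg F_le C_nonneg H0 in \<open>auto simp: H_def indicator_def\<close>)
  qed (use K \<delta>_pos F_nonneg F_le C_nonneg H0 in \<open>auto simp: H_def indicator_def Y.prob_space_axioms\<close>)
  moreover have "(\<integral>y. (\<integral>x. H (X.dil (1 / t) x, y) \<partial>L\<^sub>X) \<partial>L\<^sub>Y)
      = (\<integral>p. Ft t p * indicator {p. Y.R (snd p) \<le> K} p \<partial>L)" for t
  proof -
    have "H (X.dil (1 / t) x, y) = Ft t (x, y) * indicator {p. Y.R (snd p) \<le> K} (x, y)" for x y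
      by (auto simp: H_def Ft_def indicator_def)
    then show ?thesis
      using Ft_bounds C_nonneg by (subst integral_L(2)[where B = C]) (auto simp: indicator_def)
  qed
  ultimately show "((\<lambda>t. (\<integral>p. Ft t p * indicator {p. Y.R (snd p) \<le> K} p \<partial>L) / X.G t)
      \<longlongrightarrow> (\<integral>y. \<kappa> y * indicator {y. Y.R y \<le> K} y \<partial>L\<^sub>Y)) at_top"
    by (simp add: Heq \<kappa>_def)
qed

lemma integral_large_Y:
  assumes K: "0 < K"
  shows "((\<lambda>t. (\<integral>p. Ft t p * indicator {p. t / K < Y.R (snd p)} p \<partial>L) / h t)
    \<longlongrightarrow> c\<^sub>Y * (\<integral>x. (\<integral>y. F (x, y) * indicator {y. 1 / K < Y.R y} y \<partial>\<nu>\<^sub>Y) \<partial>L\<^sub>X)) at_top"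
proof (rule change_normalization_Y)
  define H where "H p = F (snd p, fst p) * indicator {p. 1 / K < Y.R (fst p)} p" for p
  have [measurable]: "H \<in> borel_measurable borel"
    unfolding H_def by measurable
  have Heq: "H (y, x) = F (x, y) * indicator {y. 1 / K < Y.R y} y" for x y
    by (auto simp: H_def indicator_def)
  have "((\<lambda>t. (\<integral>x. (\<integral>y. H (Y.dil (1 / t) y, x) \<partial>L\<^sub>Y) \<partial>L\<^sub>X) / Y.G t)
      \<longlongrightarrow> (\<integral>x. (\<integral>y. H (y, x) \<partial>\<nu>\<^sub>Y) \<partial>L\<^sub>X)) at_top"
  proof (rule Y.mixed_tail_limit[where B = C and \<delta> = "1 / K"])
    show "((\<lambda>t. (\<integral>y. H (Y.dil (1 / t) y, x) \<partial>L\<^sub>Y) / Y.G t) \<longlongrightarrow> (\<integral>y. H (y, x) \<partial>\<nu>\<^sub>Y)) at_top" for x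
      unfolding Heq
      by (rule Y.tail_limit[where B = C])
         (use K F_nonneg F_le in \<open>auto intro!: continuous_intros continuous_on_compose2[OF F_continuous]\<close>)
  qed (use K F_nonneg F_le C_nonneg in \<open>auto simp: H_def indicator_def X.prob_space_axioms\<close>)
  moreover have "\<forall>\<^sub>F t in at_top. (\<integral>x. (\<integral>y. H (Y.dil (1 / t) y, x) \<partial>L\<^sub>Y) \<partial>L\<^sub>X)
      = (\<integral>p. Ft t p * indicator {p. t / K < Y.R (snd p)} p \<partial>L)"
    using eventually_gt_at_top[of 0]
  proof eventually_elim
    case (elim t)
    have "H (Y.dil (1 / t) y, x) = Ft t (x, y) * indicator {p. t / K < Y.R (snd p)} (x, y)" for x y
      using elim K by (auto simp: H_def Ft_def indicator_def F_dil Y.R_dil field_simps)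
    then show ?case
      using Ft_bounds C_nonneg by (subst integral_L(1)[where B = C]) (auto simp: indicator_def)
  qed
  ultimately show "((\<lambda>t. (\<integral>p. Ft t p * indicator {p. t / K < Y.R (snd p)} p \<partial>L) / Y.G t)
      \<longlongrightarrow> (\<integral>x. (\<integral>y. F (x, y) * indicator {y. 1 / K < Y.R y} y \<partial>\<nu>\<^sub>Y) \<partial>L\<^sub>X)) at_top"
    unfolding Heq by (rule Lim_transform_eventually[OF _ eventually_mono]) auto
qed

lemma unit_ball_compact: "compact {y. N\<^sub>Y y \<le> 1}"
  using is_norm_compact[OF Y.N, of 0 1] by simp

lemma F_zero_unit_ball:
  assumes "y \<in> {y. N\<^sub>Y y \<le> 1}" "X.R x \<le> \<delta>"
  shows "F (x, y) = 0"
proof (rule F_zero)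
  have "Y.R y \<le> 1"
    using assms(1) Y.a_pos by (auto simp: Y.R_def intro: powr_le1)
  then show "X.R x * Y.R y \<le> \<delta>"
    using mult_mono[OF assms(2) \<open>Y.R y \<le> 1\<close>] \<delta>_pos by simp
qed

lemma \<kappa>_continuous: "continuous_on {y. N\<^sub>Y y \<le> 1} \<kappa>"
  unfolding \<kappa>_def
  by (rule X.parametric_tail_limit(1)[OF F_continuous F_nonneg F_le unit_ball_compact \<delta>_pos F_zero_unit_ball])

lemma \<kappa>_direction_bounded: obtains D where "\<And>y. \<bar>\<kappa> (Y.direction y)\<bar> \<le> D"
proof -
  have "bounded (\<kappa> ` {y. N\<^sub>Y y \<le> 1})"
    by (intro compact_imp_bounded compact_continuous_image \<kappa>_continuous unit_ball_compact)
  then obtain D where "\<And>z. z \<in> \<kappa> ` {y. N\<^sub>Y y \<le> 1} \<Longrightarrow> norm z \<le> D"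
    unfolding bounded_iff by blast
  then show thesis
    using Y.N_direction_le by (intro that[of D]) (auto simp: image_iff)
qed

text \<open>Convergence in law to the spectral vector can be tested only with functions on the whole space, so
  \<open>\<kappa>\<close>, which is continuous and bounded on the unit ball but in general unbounded outside, is composed
  with the radial retraction onto that ball.\<close>

lemma spectral_\<kappa>:
  "((\<lambda>u. (\<integral>y. \<kappa> (Y.direction y) * indicator {y. u < Y.R y} y \<partial>L\<^sub>Y) / Y.G u) \<longlongrightarrow> (\<integral>y. \<kappa> y \<partial>Q)) at_top"
proof -
  define r where "r y = (1 / max 1 (N\<^sub>Y y)) *\<^sub>R y" for y
  have r_ball: "N\<^sub>Y (r y) \<le> 1" for y
    by (auto simp: r_def divide_le_eq_1 max_def)
  have "max 1 (N\<^sub>Y y) \<noteq> 0" for y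
    using max.cobounded1[of 1 "N\<^sub>Y y"] by linarith
  then have r_continuous: "continuous_on UNIV r"
    unfolding r_def by (intro continuous_intros) auto
  have r_id: "r y = y" if "N\<^sub>Y y \<le> 1" for y
    using that by (simp add: r_def max_def)
  have "continuous_on UNIV (\<lambda>y. \<kappa> (r y))"
    by (rule continuous_on_compose2[OF \<kappa>_continuous r_continuous]) (use r_ball in auto)
  moreover have "bounded (range (\<lambda>y. \<kappa> (r y)))"
  proof (rule bounded_subset)
    show "bounded (\<kappa> ` {y. N\<^sub>Y y \<le> 1})"
      by (intro compact_imp_bounded compact_continuous_image \<kappa>_continuous unit_ball_compact)
  qed (use r_ball in auto)
  ultimately have "((\<lambda>u. (\<integral>y. \<kappa> (r (Y.direction y)) * indicator {y. u < Y.R y} y \<partial>L\<^sub>Y) / Y.G u)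
      \<longlongrightarrow> (\<integral>y. \<kappa> (r y) \<partial>Q)) at_top"
    unfolding Y.direction_def by (rule spectral)
  moreover have "r (Y.direction y) = Y.direction y" for y
    by (rule r_id[OF Y.N_direction_le])
  moreover have "(\<integral>y. \<kappa> (r y) \<partial>Q) = (\<integral>y. \<kappa> y \<partial>Q)"
  proof (rule integral_cong_AE)
    show "AE y in Q. \<kappa> (r y) = \<kappa> y"
      using Q_sphere by eventually_elim (simp add: r_id)
    show "(\<lambda>y. \<kappa> (r y)) \<in> borel_measurable Q" "\<kappa> \<in> borel_measurable Q"
      unfolding r_def by measurable
  qed
  ultimately show ?thesis by simp
qed

text \<open>The regime where both vectors are extreme, without and with the condition that the product of the radii
  exceeds \<open>t\<close>.\<close>

definition middle :: "real \<Rightarrow> real \<Rightarrow> ('a \<times> 'b) set" where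
  "middle K t = {p. K < Y.R (snd p) \<and> Y.R (snd p) \<le> t / K}"

definition middle_tail :: "real \<Rightarrow> real \<Rightarrow> ('a \<times> 'b) set" where
  "middle_tail K t = {p. t < X.R (fst p) * Y.R (snd p) \<and> K < Y.R (snd p) \<and> Y.R (snd p) \<le> t / K}"

lemma middle_sets [measurable]: "middle K t \<in> sets borel" "middle_tail K t \<in> sets borel"
  unfolding middle_def middle_tail_def by measurable

text \<open>By homogeneity, fixing \<open>y\<close> at level \<open>t\<close> amounts to fixing its direction at level \<open>t / Y.R y\<close>; the directions
  form a bounded set, where the limit in the first vector is uniform.\<close>

lemma asymptotics_given_Y:
  assumes \<epsilon>: "0 < \<epsilon>"
  obtains t0 where "\<And>t y. 0 < t \<Longrightarrow> 0 < Y.R y \<Longrightarrow> t0 \<le> t / Y.R y \<Longrightarrow>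
    \<bar>(\<integral>x. Ft t (x, y) \<partial>L\<^sub>X) - measure L\<^sub>X {x. t < X.R x * Y.R y} * \<kappa> (Y.direction y)\<bar>
      \<le> \<epsilon> * measure L\<^sub>X {x. t < X.R x * Y.R y}"
proof -
  have "\<forall>\<^sub>F t in at_top. \<forall>y\<in>{y. N\<^sub>Y y \<le> 1}.
      \<bar>(\<integral>x. F (X.dil (1 / t) x, y) \<partial>L\<^sub>X) / X.G t - (\<integral>x. F (x, y) \<partial>\<nu>\<^sub>X)\<bar> \<le> \<epsilon>"
    by (rule X.parametric_tail_limit(2)[OF F_continuous F_nonneg F_le unit_ball_compact \<delta>_pos F_zero_unit_ball \<epsilon>])
  then obtain t0 where t0: "\<And>t y. t0 \<le> t \<Longrightarrow> N\<^sub>Y y \<le> 1 \<Longrightarrow>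
      \<bar>(\<integral>x. F (X.dil (1 / t) x, y) \<partial>L\<^sub>X) / X.G t - \<kappa> y\<bar> \<le> \<epsilon>"
    unfolding eventually_at_top_linorder \<kappa>_def by auto
  show thesis
  proof (rule that[of t0])
    fix t y assume t: "0 < t" and Ry: "0 < Y.R y" and large: "t0 \<le> t / Y.R y"
    let ?I = "\<integral>x. Ft t (x, y) \<partial>L\<^sub>X" and ?g = "X.G (t / Y.R y)" and ?k = "\<kappa> (Y.direction y)"
    have g: "measure L\<^sub>X {x. t < X.R x * Y.R y} = ?g"
      unfolding X.G_def using Ry by (simp add: field_simps)
    have "Ft t (x, y) = F (X.dil (1 / (t / Y.R y)) x, Y.direction y)" for x
    proof -
      have "Ft t (x, y) = F (X.dil (1 / t) x, Y.dil (Y.R y) (Y.direction y))"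
        by (simp add: Ft_def Y.dil_direction)
      also have "\<dots> = F (X.dil (Y.R y) (X.dil (1 / t) x), Y.direction y)"
        by (rule F_dil[symmetric]) simp
      also have "\<dots> = F (X.dil (1 / (t / Y.R y)) x, Y.direction y)"
        using t by (simp add: X.dil_dil)
      finally show ?thesis .
    qed
    then have "\<bar>?I / ?g - ?k\<bar> \<le> \<epsilon>"
      using t0[OF large Y.N_direction_le[of y]] by simp
    then have "\<bar>?I / ?g - ?k\<bar> * ?g \<le> \<epsilon> * ?g"
      by (intro mult_right_mono) auto
    moreover have "?I - ?g * ?k = (?I / ?g - ?k) * ?g"
      using X.G_pos[of "t / Y.R y"] by (simp add: left_diff_distrib)
    ultimately show "\<bar>?I - measure L\<^sub>X {x. t < X.R x * Y.R y} * ?k\<bar> \<le> \<epsilon> * measure L\<^sub>X {x. t < X.R x * Y.R y}"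
      unfolding g by (simp add: abs_mult)
  qed
qed

text \<open>For fixed \<open>x\<close> the middle region is a difference of two sets \<open>{y. u < Y.R y}\<close> with \<open>u \<ge> K\<close> and
  \<open>u \<ge> t / X.R x\<close>. On each of them the direction of \<open>y\<close> has almost the spectral law if \<open>K\<close> is large, which
  explains the factor \<open>2\<close>.\<close>

lemma asymptotics_given_X:
  assumes \<epsilon>: "0 < \<epsilon>"
  obtains u0 where "\<And>K t x. u0 \<le> K \<Longrightarrow> 0 < K \<Longrightarrow> K * K \<le> t \<Longrightarrow>
    \<bar>(\<integral>y. indicator (middle_tail K t) (x, y) * \<kappa> (Y.direction y) \<partial>L\<^sub>Y)
      - (\<integral>y. \<kappa> y \<partial>Q) * measure L\<^sub>Y {y. (x, y) \<in> middle_tail K t}\<bar>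
      \<le> 2 * \<epsilon> * measure L\<^sub>Y {y. t < X.R x * Y.R y}"
proof -
  define kb where "kb = (\<integral>y. \<kappa> y \<partial>Q)"
  define k where "k y = \<kappa> (Y.direction y)" for y
  have [measurable]: "k \<in> borel_measurable borel"
    unfolding k_def by measurable
  obtain D where D: "\<And>y. \<bar>k y\<bar> \<le> D"
    unfolding k_def by (rule \<kappa>_direction_bounded) blast
  have "\<forall>\<^sub>F u in at_top. dist ((\<integral>y. k y * indicator {y. u < Y.R y} y \<partial>L\<^sub>Y) / Y.G u) kb < \<epsilon>"
    unfolding k_def kb_def by (intro tendstoD spectral_\<kappa> \<epsilon>)
  then obtain u0 where u0: "\<And>u. u0 \<le> u \<Longrightarrow>
      \<bar>(\<integral>y. k y * indicator {y. u < Y.R y} y \<partial>L\<^sub>Y) / Y.G u - kb\<bar> < \<epsilon>"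
    unfolding eventually_at_top_linorder by (auto simp: dist_real_def)
  have spec: "\<bar>(\<integral>y. k y * indicator {y. u < Y.R y} y \<partial>L\<^sub>Y) - kb * Y.G u\<bar> \<le> \<epsilon> * Y.G u" if "u0 \<le> u" for u
  proof -
    have "(\<integral>y. k y * indicator {y. u < Y.R y} y \<partial>L\<^sub>Y) - kb * Y.G u
        = ((\<integral>y. k y * indicator {y. u < Y.R y} y \<partial>L\<^sub>Y) / Y.G u - kb) * Y.G u"
      using Y.G_pos[of u] by (simp add: left_diff_distrib)
    also have "\<bar>\<dots>\<bar> \<le> \<epsilon> * Y.G u"
      using u0[OF that] by (simp add: abs_mult mult_right_mono)
    finally show ?thesis .
  qed
  show thesis
  proof (rule that[of u0])
    fix K t x assume K: "u0 \<le> K" "0 < K" and t: "K * K \<le> t"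
    have "0 < K * K"
      using K by simp
    then have t_pos: "0 < t" and Kt: "K \<le> t / K"
      using t K by (linarith, simp add: field_simps)
    let ?J = "\<integral>y. indicator (middle_tail K t) (x, y) * k y \<partial>L\<^sub>Y"
    let ?J1 = "measure L\<^sub>Y {y. (x, y) \<in> middle_tail K t}"
    have "\<bar>?J - kb * ?J1\<bar> \<le> 2 * \<epsilon> * measure L\<^sub>Y {y. t < X.R x * Y.R y}"
    proof (cases "X.R x = 0")
      case True
      with t_pos have "(x, y) \<notin> middle_tail K t" for y
        by (simp add: middle_tail_def)
      then show ?thesis
        using \<epsilon> by simp
    next
      case False
      then have Rx: "0 < X.R x"
        using X.R_nonneg[of x] by (simp add: less_le)
      have tail: "t < X.R x * Y.R y \<longleftrightarrow> t / X.R x < Y.R y" for y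
        using Rx by (simp add: field_simps)
      then have V: "measure L\<^sub>Y {y. t < X.R x * Y.R y} = Y.G (t / X.R x)"
        by (simp add: Y.G_def)
      define u1 u2 where "u1 = max K (t / X.R x)" and "u2 = max (t / K) (t / X.R x)"
      have u: "u0 \<le> u1" "u0 \<le> u2" "t / X.R x \<le> u1" "t / X.R x \<le> u2"
        using K Kt by (auto simp: u1_def u2_def)
      have ind: "indicator (middle_tail K t) (x, y)
          = (indicator {y. u1 < Y.R y} y - indicator {y. u2 < Y.R y} y :: real)" for y
        using Kt tail[of y] by (auto simp: middle_tail_def u1_def u2_def indicator_def)
      have ki: "integrable L\<^sub>Y (\<lambda>y. k y * indicator {y. u < Y.R y} y)" for u
        using D order_trans[OF abs_ge_zero D]
        by (intro Y.integrable_L_bounded[where B = D]) (auto simp: indicator_def)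
      have ii: "integrable L\<^sub>Y (indicator {y. u < Y.R y} :: 'b \<Rightarrow> real)" for u
        by (rule Y.integrable_L_bounded[where B = 1]) auto
      have "?J = (\<integral>y. k y * indicator {y. u1 < Y.R y} y - k y * indicator {y. u2 < Y.R y} y \<partial>L\<^sub>Y)"
        by (simp add: ind algebra_simps)
      then have J: "?J = (\<integral>y. k y * indicator {y. u1 < Y.R y} y \<partial>L\<^sub>Y) - (\<integral>y. k y * indicator {y. u2 < Y.R y} y \<partial>L\<^sub>Y)"
        using ki by simp
      have "?J1 = (\<integral>y. indicator {y. (x, y) \<in> middle_tail K t} y \<partial>L\<^sub>Y)"
        by simp
      also have "\<dots> = (\<integral>y. indicator {y. u1 < Y.R y} y - indicator {y. u2 < Y.R y} y \<partial>L\<^sub>Y)"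
        unfolding ind[symmetric] by (simp add: indicator_def)
      finally have J1: "?J1 = Y.G u1 - Y.G u2"
        using ii by (simp add: Y.G_def)
      have "?J - kb * ?J1 = ((\<integral>y. k y * indicator {y. u1 < Y.R y} y \<partial>L\<^sub>Y) - kb * Y.G u1)
          - ((\<integral>y. k y * indicator {y. u2 < Y.R y} y \<partial>L\<^sub>Y) - kb * Y.G u2)"
        unfolding J J1 by (simp add: algebra_simps)
      then have "\<bar>?J - kb * ?J1\<bar> \<le> \<epsilon> * Y.G u1 + \<epsilon> * Y.G u2"
        using spec[OF u(1)] spec[OF u(2)] by linarith
      also have "\<dots> \<le> \<epsilon> * Y.G (t / X.R x) + \<epsilon> * Y.G (t / X.R x)"
        using \<epsilon> u by (intro add_mono mult_left_mono Y.G_antimono) auto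
      finally show ?thesis by (simp add: V)
    qed
    then show "\<bar>(\<integral>y. indicator (middle_tail K t) (x, y) * \<kappa> (Y.direction y) \<partial>L\<^sub>Y)
        - (\<integral>y. \<kappa> y \<partial>Q) * measure L\<^sub>Y {y. (x, y) \<in> middle_tail K t}\<bar>
      \<le> 2 * \<epsilon> * measure L\<^sub>Y {y. t < X.R x * Y.R y}"
      by (simp add: k_def kb_def)
  qed
qed

lemma integral_diff_le:
  fixes f g :: "'d \<Rightarrow> real"
  assumes "integrable M' f" "integrable M' g" "integrable M' w" "\<And>x. \<bar>f x - g x\<bar> \<le> w x"
  shows "\<bar>(\<integral>x. f x \<partial>M') - (\<integral>x. g x \<partial>M')\<bar> \<le> (\<integral>x. w x \<partial>M')"
proof -
  have "\<bar>(\<integral>x. f x \<partial>M') - (\<integral>x. g x \<partial>M')\<bar> = \<bar>\<integral>x. f x - g x \<partial>M'\<bar>"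
    using assms by simp
  also have "\<dots> \<le> (\<integral>x. \<bar>f x - g x\<bar> \<partial>M')"
    by (rule integral_abs_bound)
  also have "\<dots> \<le> (\<integral>x. w x \<partial>M')"
    using assms by (intro integral_mono) auto
  finally show ?thesis .
qed

text \<open>The expectation over the middle region is first computed by conditioning on \<open>y\<close>, which produces the factor
  \<open>\<kappa> (direction y)\<close>, and then by conditioning on \<open>x\<close>, which averages this factor. The errors of the two
  steps are \<open>\<epsilon>\<close> and \<open>2 \<epsilon>\<close> times \<open>h t\<close>.\<close>

lemma integral_middle:
  assumes \<epsilon>: "0 < \<epsilon>"
  obtains K0 where "1 \<le> K0"
    and "\<And>K t. K0 \<le> K \<Longrightarrow> K * K \<le> t \<Longrightarrow>
      \<bar>(\<integral>p. Ft t p * indicator (middle K t) p \<partial>L) - (\<integral>y. \<kappa> y \<partial>Q) * measure L (middle_tail K t)\<bar>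
      \<le> 3 * \<epsilon> * h t"
proof -
  define kb where "kb = (\<integral>y. \<kappa> y \<partial>Q)"
  define k where "k y = \<kappa> (Y.direction y)" for y
  have [measurable]: "k \<in> borel_measurable borel"
    unfolding k_def by measurable
  have [measurable]: "(\<lambda>p. k (snd p)) \<in> borel_measurable (borel :: ('a \<times> 'b) measure)"
    unfolding borel_prod[symmetric] by measurable
  obtain D where D: "\<And>y. \<bar>k y\<bar> \<le> D"
    unfolding k_def by (rule \<kappa>_direction_bounded) blast
  have D0: "0 \<le> D"
    using D[of undefined] by linarith
  obtain t0 where t0: "\<And>t y. 0 < t \<Longrightarrow> 0 < Y.R y \<Longrightarrow> t0 \<le> t / Y.R y \<Longrightarrow>
    \<bar>(\<integral>x. Ft t (x, y) \<partial>L\<^sub>X) - measure L\<^sub>X {x. t < X.R x * Y.R y} * k y\<bar>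
      \<le> \<epsilon> * measure L\<^sub>X {x. t < X.R x * Y.R y}"
    unfolding k_def by (rule asymptotics_given_Y[OF \<epsilon>]) blast
  obtain u0 where u0: "\<And>K t x. u0 \<le> K \<Longrightarrow> 0 < K \<Longrightarrow> K * K \<le> t \<Longrightarrow>
    \<bar>(\<integral>y. indicator (middle_tail K t) (x, y) * k y \<partial>L\<^sub>Y) - kb * measure L\<^sub>Y {y. (x, y) \<in> middle_tail K t}\<bar>
      \<le> 2 * \<epsilon> * measure L\<^sub>Y {y. t < X.R x * Y.R y}"
    unfolding k_def kb_def by (rule asymptotics_given_X[OF \<epsilon>]) blast
  show thesis
  proof (rule that[of "max 1 (max t0 u0)"])
    fix K t assume K: "max 1 (max t0 u0) \<le> K" and t: "K * K \<le> t"
    have K': "0 < K" "t0 \<le> K" "u0 \<le> K"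
      using K by auto
    have "0 < K * K"
      using K' by simp
    then have t_pos: "0 < t"
      using t by linarith
    let ?S = "{y. K < Y.R y \<and> Y.R y \<le> t / K}" and ?W = "middle_tail K t"
    have W_iff: "indicator ?W (x, y) = (indicator ?S y * indicator {x. t < X.R x * Y.R y} x :: real)"
      and S_iff: "indicator (middle K t) (x, y) = (indicator ?S y :: real)" for x y
      by (auto simp: middle_tail_def middle_def indicator_def)
    define I where "I y = (\<integral>x. Ft t (x, y) \<partial>L\<^sub>X)" for y
    define g where "g y = measure L\<^sub>X {x. t < X.R x * Y.R y}" for y
    have [measurable]: "g \<in> borel_measurable borel" "I \<in> borel_measurable borel"
      unfolding g_def I_def Ft_def by measurable
    have g01: "0 \<le> g y" "g y \<le> 1" for y
      by (simp_all add: g_def)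
    have I_bd: "0 \<le> I y \<and> I y \<le> C" for y
    proof -
      have "integrable L\<^sub>X (\<lambda>x. Ft t (x, y))"
        unfolding Ft_def by (rule X.integrable_L_bounded[where B = C]) (auto simp: F_abs_le)
      then show ?thesis
        unfolding I_def using Ft_bounds
        by (auto intro!: X.integral_le_const Bochner_Integration.integral_nonneg)
    qed
    have first: "\<bar>(\<integral>y. I y * indicator ?S y \<partial>L\<^sub>Y) - (\<integral>y. g y * k y * indicator ?S y \<partial>L\<^sub>Y)\<bar>
        \<le> (\<integral>y. \<epsilon> * (g y * indicator ?S y) \<partial>L\<^sub>Y)"
    proof (rule integral_diff_le)
      show "integrable L\<^sub>Y (\<lambda>y. I y * indicator ?S y)"
        using I_bd C_nonneg by (intro Y.integrable_L_bounded[where B = C]) (auto simp: indicator_def)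
      have "\<bar>g y * k y\<bar> \<le> D" for y
        using mult_mono[OF g01(2) D] g01(1) by (simp add: abs_mult)
      then show "integrable L\<^sub>Y (\<lambda>y. g y * k y * indicator ?S y)"
        using D0 by (intro Y.integrable_L_bounded[where B = D]) (auto simp: indicator_def)
      show "integrable L\<^sub>Y (\<lambda>y. \<epsilon> * (g y * indicator ?S y))"
        using g01 by (intro integrable_mult_right Y.integrable_L_bounded[where B = 1]) (auto simp: indicator_def)
      show "\<bar>I y * indicator ?S y - g y * k y * indicator ?S y\<bar> \<le> \<epsilon> * (g y * indicator ?S y)" for y
      proof (cases "y \<in> ?S")
        case True
        then have "0 < Y.R y" "K \<le> t / Y.R y"
          using K'(1) by (auto simp: field_simps)
        then have "t0 \<le> t / Y.R y"
          using K' by linarith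
        with True \<open>0 < Y.R y\<close> show ?thesis
          using t0[OF t_pos] by (simp add: I_def g_def)
      qed simp
    qed
    have "(\<integral>p. Ft t p * indicator (middle K t) p \<partial>L)
        = (\<integral>y. (\<integral>x. Ft t (x, y) * indicator (middle K t) (x, y) \<partial>L\<^sub>X) \<partial>L\<^sub>Y)"
      using Ft_bounds C_nonneg by (intro integral_L(2)[where B = C]) (auto simp: indicator_def)
    then have eq1: "(\<integral>p. Ft t p * indicator (middle K t) p \<partial>L) = (\<integral>y. I y * indicator ?S y \<partial>L\<^sub>Y)"
      unfolding S_iff by (simp add: I_def)
    have "{x. (x, y) \<in> ?W} = (if y \<in> ?S then {x. t < X.R x * Y.R y} else {})" for y
      by (auto simp: middle_tail_def)
    then have "measure L\<^sub>X {x. (x, y) \<in> ?W} = g y * indicator ?S y" for y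
      by (simp add: g_def)
    then have eq2: "measure L ?W = (\<integral>y. g y * indicator ?S y \<partial>L\<^sub>Y)"
      by (subst measure_L(2)) simp_all
    have kW: "\<bar>indicator ?W p * k (snd p)\<bar> \<le> D" for p
      using D[of "snd p"] D0 by (auto simp: indicator_def)
    have "(\<integral>p. indicator ?W p * k (snd p) \<partial>L) = (\<integral>y. (\<integral>x. indicator ?W (x, y) * k (snd (x, y)) \<partial>L\<^sub>X) \<partial>L\<^sub>Y)"
      by (intro integral_L(2)[where B = D] kW) measurable
    then have eq3: "(\<integral>y. g y * k y * indicator ?S y \<partial>L\<^sub>Y) = (\<integral>p. indicator ?W p * k (snd p) \<partial>L)"
      unfolding W_iff by (simp add: g_def mult_ac)
    define J where "J x = (\<integral>y. indicator ?W (x, y) * k y \<partial>L\<^sub>Y)" for x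
    define J1 where "J1 x = measure L\<^sub>Y {y. (x, y) \<in> ?W}" for x
    define V where "V x = measure L\<^sub>Y {y. t < X.R x * Y.R y}" for x
    have J_bd: "\<bar>J x\<bar> \<le> \<bar>kb\<bar> + 2 * \<epsilon>" for x
    proof -
      have "\<bar>kb * J1 x\<bar> \<le> \<bar>kb\<bar> * 1" "2 * \<epsilon> * V x \<le> 2 * \<epsilon> * 1"
        using \<epsilon> by (auto simp: abs_mult J1_def V_def intro!: mult_left_le)
      with u0[OF K'(3,1) t, of x] show ?thesis
        unfolding J_def[symmetric] J1_def[symmetric] V_def[symmetric] by linarith
    qed
    have [measurable]: "J \<in> borel_measurable borel" "V \<in> borel_measurable borel"
      unfolding J_def V_def by measurable
    have [measurable]: "J1 \<in> borel_measurable borel"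
      unfolding J1_def by (intro measure_section_measurable) measurable
    have second: "\<bar>(\<integral>x. J x \<partial>L\<^sub>X) - (\<integral>x. kb * J1 x \<partial>L\<^sub>X)\<bar> \<le> (\<integral>x. 2 * \<epsilon> * V x \<partial>L\<^sub>X)"
    proof (rule integral_diff_le)
      show "integrable L\<^sub>X J"
        using J_bd by (intro X.integrable_L_bounded[where B = "\<bar>kb\<bar> + 2 * \<epsilon>"]) auto
      show "integrable L\<^sub>X (\<lambda>x. kb * J1 x)" "integrable L\<^sub>X (\<lambda>x. 2 * \<epsilon> * V x)"
        by (intro integrable_mult_right X.integrable_L_bounded[where B = 1]; simp add: J1_def V_def)+
      show "\<bar>J x - kb * J1 x\<bar> \<le> 2 * \<epsilon> * V x" for x
        unfolding J_def J1_def V_def by (rule u0[OF K'(3,1) t])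
    qed
    have eq4: "(\<integral>p. indicator ?W p * k (snd p) \<partial>L) = (\<integral>x. J x \<partial>L\<^sub>X)"
      unfolding J_def by (subst integral_L(1)[where B = D]) (use kW in auto)
    have eq5: "measure L ?W = (\<integral>x. J1 x \<partial>L\<^sub>X)" and eq6: "h t = (\<integral>x. V x \<partial>L\<^sub>X)"
      unfolding J1_def V_def h_def by (subst measure_L(1); simp)+
    have "measure L ?W \<le> h t"
      unfolding h_def by (rule XY.P.finite_measure_mono[OF _ tail_sets]) (auto simp: middle_tail_def)
    then have "\<epsilon> * measure L ?W \<le> \<epsilon> * h t"
      using \<epsilon> by (intro mult_left_mono) auto
    with first second show "\<bar>(\<integral>p. Ft t p * indicator (middle K t) p \<partial>L)
        - (\<integral>y. \<kappa> y \<partial>Q) * measure L (middle_tail K t)\<bar> \<le> 3 * \<epsilon> * h t"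
      unfolding eq1 eq3 eq4 kb_def[symmetric] by (simp add: eq2[symmetric] eq5[symmetric] eq6[symmetric])
  qed simp
qed

end

context product_tail
begin

lemma h_split:
  assumes "0 < K" "K * K \<le> t"
  shows "h t = measure L {p. t < X.R (fst p) * Y.R (snd p) \<and> Y.R (snd p) \<le> K}
    + measure L {p. t < X.R (fst p) * Y.R (snd p) \<and> t / K < Y.R (snd p)}
    + measure L {p. t < X.R (fst p) * Y.R (snd p) \<and> K < Y.R (snd p) \<and> Y.R (snd p) \<le> t / K}"
    (is "_ = measure L ?S1 + measure L ?S2 + measure L ?S3")
proof -
  have Kt: "K \<le> t / K"
    using assms by (simp add: field_simps)
  have sets: "?S1 \<in> sets L" "?S2 \<in> sets L" "?S3 \<in> sets L"
    unfolding sets_L by measurable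
  have "?S1 \<inter> ?S2 = {}" "(?S1 \<union> ?S2) \<inter> ?S3 = {}"
    using Kt by auto
  then have "measure L ((?S1 \<union> ?S2) \<union> ?S3) = measure L ?S1 + measure L ?S2 + measure L ?S3"
    using sets by (simp add: XY.P.finite_measure_Union)
  moreover have "(?S1 \<union> ?S2) \<union> ?S3 = {p. t < X.R (fst p) * Y.R (snd p)}"
    using Kt by auto
  ultimately show ?thesis
    by (simp add: h_def)
qed

text \<open>The regimes \<open>S \<le> K\<close> and \<open>S > t / K\<close> are disjoint once \<open>t \<ge> K\<^sup>2\<close>. This inequality yields the moments in
  the formula for \<open>\<eta>\<close>, and that its first coefficient is nonnegative.\<close>

lemma truncated_moments_le:
  assumes K: "0 < K"
  shows "c\<^sub>X * truncated_moment_Y K + c\<^sub>Y * truncated_moment_X K \<le> 1"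
proof (rule tendsto_upperbound)
  show "((\<lambda>t. measure L {p. t < X.R (fst p) * Y.R (snd p) \<and> Y.R (snd p) \<le> K} / h t
      + measure L {p. t < X.R (fst p) * Y.R (snd p) \<and> t / K < Y.R (snd p)} / h t)
      \<longlongrightarrow> c\<^sub>X * truncated_moment_Y K + c\<^sub>Y * truncated_moment_X K) at_top"
    by (intro tendsto_add tail_small_Y tail_large_Y K)
  show "\<forall>\<^sub>F t in at_top. measure L {p. t < X.R (fst p) * Y.R (snd p) \<and> Y.R (snd p) \<le> K} / h t
      + measure L {p. t < X.R (fst p) * Y.R (snd p) \<and> t / K < Y.R (snd p)} / h t \<le> 1"
    using eventually_ge_at_top[of "K * K"]
  proof eventually_elim
    case (elim t)
    then show ?case
      using h_split[OF K elim] h_pos[of t] by (simp add: add_divide_distrib[symmetric])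
  qed
qed simp

lemma truncated_moment_Y_nonneg: "0 \<le> truncated_moment_Y K"
  unfolding truncated_moment_Y_def by (rule Bochner_Integration.integral_nonneg) simp

lemma truncated_moment_X_nonneg: "0 \<le> truncated_moment_X K"
  unfolding truncated_moment_X_def by (rule Bochner_Integration.integral_nonneg) simp

lemma integrable_moment_Y:
  assumes "0 < c\<^sub>X"
  shows "integrable L\<^sub>Y (\<lambda>y. Y.R y powr X.\<gamma>)"
proof (rule integrable_powr_truncations[OF Y.prob_space_axioms])
  let ?f = "\<lambda>n y. Y.R y * indicator {y. Y.R y \<le> real (Suc n)} y"
  show "(\<integral>y. ?f n y powr X.\<gamma> \<partial>L\<^sub>Y) \<le> 1 / c\<^sub>X" for n
  proof -
    have "c\<^sub>X * truncated_moment_Y (real (Suc n)) \<le> 1"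
      using truncated_moments_le[of "real (Suc n)"] mult_nonneg_nonneg[OF c_Y_nonneg truncated_moment_X_nonneg, of "real (Suc n)"]
      by linarith
    then show ?thesis
      using assms by (simp add: truncated_moment_Y_def field_simps)
  qed
qed (use X.\<gamma>_pos in \<open>auto simp: indicator_def\<close>)

lemma integrable_moment_X:
  assumes "0 < c\<^sub>Y"
  shows "integrable L\<^sub>X (\<lambda>x. X.R x powr Y.\<gamma>)"
proof (rule integrable_powr_truncations[OF X.prob_space_axioms])
  let ?f = "\<lambda>n x. min (X.R x) (real (Suc n))"
  show "(\<integral>x. ?f n x powr Y.\<gamma> \<partial>L\<^sub>X) \<le> 1 / c\<^sub>Y" for n
  proof -
    have "c\<^sub>Y * truncated_moment_X (real (Suc n)) \<le> 1"
      using truncated_moments_le[of "real (Suc n)"] mult_nonneg_nonneg[OF c_X_nonneg truncated_moment_Y_nonneg, of "real (Suc n)"]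
      by linarith
    then show ?thesis
      using assms by (simp add: truncated_moment_X_def field_simps)
  qed
qed (use Y.\<gamma>_pos in \<open>auto simp: min_def\<close>)

text \<open>The asymptotic shares of the three regimes. If \<open>c\<^sub>X = 0\<close>, the moment in \<open>p\<^sub>X\<close> may be infinite; the
  integral is then \<open>0\<close> by default, in agreement with the convention \<open>0 \<cdot> \<infinity> = 0\<close>. The same holds for
  \<open>p\<^sub>Y\<close>.\<close>

definition p\<^sub>X :: real where "p\<^sub>X = c\<^sub>X * (\<integral>y. Y.R y powr X.\<gamma> \<partial>L\<^sub>Y)"

definition p\<^sub>Y :: real where "p\<^sub>Y = c\<^sub>Y * (\<integral>x. X.R x powr Y.\<gamma> \<partial>L\<^sub>X)"

definition c\<^sub>0 :: real where "c\<^sub>0 = 1 - p\<^sub>X - p\<^sub>Y"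

text \<open>For \<open>c = c\<^sub>X\<close> the dominating function has the moment of \<open>Y\<close> as its integral; if that is infinite, then
  \<open>c\<^sub>X = 0\<close> and the limit is trivial.\<close>

lemma weighted_limit:
  assumes c: "0 \<le> c" and bound: "0 < c \<Longrightarrow> integrable M' w" "\<And>K x. \<bar>f K x\<bar> \<le> w x"
    and [measurable]: "\<And>K. f K \<in> borel_measurable M'" "g \<in> borel_measurable M'"
    and lim: "\<And>x. ((\<lambda>K. f K x) \<longlongrightarrow> g x) at_top"
  shows "((\<lambda>K :: real. c * (\<integral>x. f K x \<partial>M')) \<longlongrightarrow> (c::real) * (\<integral>x. g x \<partial>M')) at_top"
proof (cases "c = 0")
  case False
  with c have "integrable M' w"
    by (intro bound(1)) simp
  then have "((\<lambda>K. \<integral>x. f K x \<partial>M') \<longlongrightarrow> (\<integral>x. g x \<partial>M')) at_top"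
    using bound(2) lim by (intro integral_dominated_convergence_at_top[where w = w]) auto
  then show ?thesis by (rule tendsto_mult_left)
qed simp

lemma truncated_moment_Y_limit: "((\<lambda>K. c\<^sub>X * truncated_moment_Y K) \<longlongrightarrow> p\<^sub>X) at_top"
  unfolding truncated_moment_Y_def p\<^sub>X_def
proof (rule weighted_limit[OF c_X_nonneg integrable_moment_Y])
  show "((\<lambda>K. (Y.R y * indicator {y. Y.R y \<le> K} y) powr X.\<gamma>) \<longlongrightarrow> Y.R y powr X.\<gamma>) at_top" for y
    by (intro tendsto_eventually eventually_mono[OF eventually_ge_at_top[of "Y.R y"]]) simp
qed (auto simp: indicator_def)

lemma truncated_moment_X_limit: "((\<lambda>K. c\<^sub>Y * truncated_moment_X K) \<longlongrightarrow> p\<^sub>Y) at_top"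
  unfolding p\<^sub>Y_def
proof (rule Lim_transform_eventually)
  show "((\<lambda>K. c\<^sub>Y * (\<integral>x. min (X.R x) (max 0 K) powr Y.\<gamma> \<partial>L\<^sub>X)) \<longlongrightarrow> c\<^sub>Y * (\<integral>x. X.R x powr Y.\<gamma> \<partial>L\<^sub>X)) at_top"
  proof (rule weighted_limit[OF c_Y_nonneg integrable_moment_X])
    show "((\<lambda>K. min (X.R x) (max 0 K) powr Y.\<gamma>) \<longlongrightarrow> X.R x powr Y.\<gamma>) at_top" for x
      by (intro tendsto_eventually eventually_mono[OF eventually_ge_at_top[of "X.R x"]])
         (simp add: min_def max_def order_trans[OF X.R_nonneg])
  qed (auto intro!: powr_mono2 simp: Y.\<gamma>_pos less_imp_le)
  show "\<forall>\<^sub>F K in at_top. c\<^sub>Y * (\<integral>x. min (X.R x) (max 0 K) powr Y.\<gamma> \<partial>L\<^sub>X) = c\<^sub>Y * truncated_moment_X K"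
    using eventually_ge_at_top[of 0] by eventually_elim (simp add: truncated_moment_X_def max_def)
qed

lemma p_X_nonneg: "0 \<le> p\<^sub>X"
  unfolding p\<^sub>X_def by (intro mult_nonneg_nonneg c_X_nonneg Bochner_Integration.integral_nonneg) simp

lemma p_Y_nonneg: "0 \<le> p\<^sub>Y"
  unfolding p\<^sub>Y_def by (intro mult_nonneg_nonneg c_Y_nonneg Bochner_Integration.integral_nonneg) simp

lemma c_0_nonneg: "0 \<le> c\<^sub>0"
proof -
  have "p\<^sub>X + p\<^sub>Y \<le> 1"
  proof (rule tendsto_upperbound)
    show "((\<lambda>K. c\<^sub>X * truncated_moment_Y K + c\<^sub>Y * truncated_moment_X K) \<longlongrightarrow> p\<^sub>X + p\<^sub>Y) at_top"
      by (intro tendsto_add truncated_moment_Y_limit truncated_moment_X_limit)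
    show "\<forall>\<^sub>F K in at_top. c\<^sub>X * truncated_moment_Y K + c\<^sub>Y * truncated_moment_X K \<le> 1"
      using eventually_gt_at_top[of 0] by eventually_elim (rule truncated_moments_le)
  qed simp
  then show ?thesis by (simp add: c\<^sub>0_def)
qed

end

context product_functional
begin

lemma F_zero_axis: "X.R x = 0 \<or> Y.R y = 0 \<Longrightarrow> F (x, y) = 0"
  using F_zero[of x y] \<delta>_pos by auto

lemma integrable_F_X: "integrable \<nu>\<^sub>X (\<lambda>x. F (x, y))"
  by (rule X.vanishing_integral(1)[OF _ F_nonneg F_le Y.R_nonneg \<delta>_pos F_zero]) measurable

lemma integrable_F_Y: "integrable \<nu>\<^sub>Y (\<lambda>y. F (x, y))"
  by (rule Y.vanishing_integral(1)[OF _ F_nonneg F_le X.R_nonneg \<delta>_pos F_zero]) (simp_all add: mult.commute)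

lemma \<kappa>_nonneg: "0 \<le> \<kappa> y"
  unfolding \<kappa>_def using F_nonneg by (intro Bochner_Integration.integral_nonneg) auto

lemma \<kappa>'_nonneg: "0 \<le> \<kappa>' x"
  unfolding \<kappa>'_def using F_nonneg by (intro Bochner_Integration.integral_nonneg) auto

lemma \<kappa>_le: "\<kappa> y \<le> C * \<delta> powr (- X.\<gamma>) * Y.R y powr X.\<gamma>"
  unfolding \<kappa>_def
  by (rule X.vanishing_integral(2)[OF _ F_nonneg F_le Y.R_nonneg \<delta>_pos F_zero]) measurable

lemma \<kappa>'_le: "\<kappa>' x \<le> C * \<delta> powr (- Y.\<gamma>) * X.R x powr Y.\<gamma>"
  unfolding \<kappa>'_def
  by (rule Y.vanishing_integral(2)[OF _ F_nonneg F_le X.R_nonneg \<delta>_pos F_zero]) (simp_all add: mult.commute)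

lemma small_Y_limit:
  "((\<lambda>K. c\<^sub>X * (\<integral>y. \<kappa> y * indicator {y. Y.R y \<le> K} y \<partial>L\<^sub>Y)) \<longlongrightarrow> c\<^sub>X * (\<integral>y. \<kappa> y \<partial>L\<^sub>Y)) at_top"
proof (rule weighted_limit[OF c_X_nonneg])
  show "integrable L\<^sub>Y (\<lambda>y. C * \<delta> powr (- X.\<gamma>) * Y.R y powr X.\<gamma>)" if "0 < c\<^sub>X"
    by (intro integrable_mult_right integrable_moment_Y that)
  show "\<bar>\<kappa> y * indicator {y. Y.R y \<le> K} y\<bar> \<le> C * \<delta> powr (- X.\<gamma>) * Y.R y powr X.\<gamma>" for K y
    using \<kappa>_nonneg[of y] \<kappa>_le[of y] by (auto simp: indicator_def)
  show "((\<lambda>K. \<kappa> y * indicator {y. Y.R y \<le> K} y) \<longlongrightarrow> \<kappa> y) at_top" for y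
    by (intro tendsto_eventually eventually_mono[OF eventually_ge_at_top[of "Y.R y"]]) simp
qed measurable

lemma large_Y_limit:
  "((\<lambda>K. c\<^sub>Y * (\<integral>x. (\<integral>y. F (x, y) * indicator {y. 1 / K < Y.R y} y \<partial>\<nu>\<^sub>Y) \<partial>L\<^sub>X)) \<longlongrightarrow> c\<^sub>Y * (\<integral>x. \<kappa>' x \<partial>L\<^sub>X)) at_top"
proof (rule weighted_limit[OF c_Y_nonneg])
  interpret \<nu>: sigma_finite_measure \<nu>\<^sub>Y by (rule Y.sigma_finite_\<nu>)
  show "integrable L\<^sub>X (\<lambda>x. C * \<delta> powr (- Y.\<gamma>) * X.R x powr Y.\<gamma>)" if "0 < c\<^sub>Y"
    by (intro integrable_mult_right integrable_moment_X that)
  show "\<bar>\<integral>y. F (x, y) * indicator {y. 1 / K < Y.R y} y \<partial>\<nu>\<^sub>Y\<bar> \<le> C * \<delta> powr (- Y.\<gamma>) * X.R x powr Y.\<gamma>" for K x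
  proof -
    have "0 \<le> (\<integral>y. F (x, y) * indicator {y. 1 / K < Y.R y} y \<partial>\<nu>\<^sub>Y)"
      using F_nonneg by (intro Bochner_Integration.integral_nonneg) auto
    moreover have "(\<integral>y. F (x, y) * indicator {y. 1 / K < Y.R y} y \<partial>\<nu>\<^sub>Y) \<le> \<kappa>' x"
      unfolding \<kappa>'_def using F_nonneg
      by (intro integral_mono integrable_F_Y integrable_real_mult_indicator) (auto simp: indicator_def)
    ultimately show ?thesis using \<kappa>'_le[of x] by simp
  qed
  show "((\<lambda>K. \<integral>y. F (x, y) * indicator {y. 1 / K < Y.R y} y \<partial>\<nu>\<^sub>Y) \<longlongrightarrow> \<kappa>' x) at_top" for x
    unfolding \<kappa>'_def
  proof (rule integral_dominated_convergence_at_top[where w = "\<lambda>y. F (x, y)"])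
    have "\<forall>\<^sub>F K in at_top. F (x, y) * indicator {y. 1 / K < Y.R y} y = F (x, y)" for y
    proof (cases "Y.R y = 0")
      case False
      then have pos: "0 < Y.R y" using Y.R_nonneg[of y] by (simp add: less_le)
      show ?thesis
        using eventually_gt_at_top[of "1 / Y.R y"] eventually_gt_at_top[of 0]
        by eventually_elim (use pos in \<open>simp add: field_simps\<close>)
    qed (simp add: F_zero_axis)
    then show "AE y in \<nu>\<^sub>Y. ((\<lambda>K. F (x, y) * indicator {y. 1 / K < Y.R y} y) \<longlongrightarrow> F (x, y)) at_top"
      by (intro AE_I2 tendsto_eventually)
    show "\<forall>\<^sub>F K in at_top. AE y in \<nu>\<^sub>Y. norm (F (x, y) * indicator {y. 1 / K < Y.R y} y) \<le> F (x, y)"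
      using F_nonneg by (intro always_eventually allI AE_I2) (auto simp: indicator_def)
  qed (auto simp: integrable_F_Y)
  show "(\<lambda>x. \<integral>y. F (x, y) * indicator {y. 1 / K < Y.R y} y \<partial>\<nu>\<^sub>Y) \<in> borel_measurable L\<^sub>X" for K
    by measurable
  show "\<kappa>' \<in> borel_measurable L\<^sub>X"
    using \<kappa>'_measurable by simp
qed

lemma functional_split:
  assumes "0 < K" "K * K \<le> t"
  shows "(\<integral>p. Ft t p \<partial>L) = (\<integral>p. Ft t p * indicator {p. Y.R (snd p) \<le> K} p \<partial>L)
    + (\<integral>p. Ft t p * indicator {p. t / K < Y.R (snd p)} p \<partial>L)
    + (\<integral>p. Ft t p * indicator (middle K t) p \<partial>L)"
proof -
  have Kt: "K \<le> t / K"
    using assms by (simp add: field_simps)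
  have int: "integrable L (\<lambda>p. Ft t p * indicator S p)" if [measurable]: "S \<in> sets borel" for S
    using Ft_bounds C_nonneg by (intro integrable_L_bounded[where B = C]) (auto simp: indicator_def)
  have "(\<integral>p. Ft t p \<partial>L) = (\<integral>p. Ft t p * indicator {p. Y.R (snd p) \<le> K} p
      + Ft t p * indicator {p. t / K < Y.R (snd p)} p
      + Ft t p * indicator (middle K t) p \<partial>L)"
    using Kt by (intro Bochner_Integration.integral_cong) (auto simp: middle_def indicator_def)
  also have "\<dots> = (\<integral>p. Ft t p * indicator {p. Y.R (snd p) \<le> K} p \<partial>L)
    + (\<integral>p. Ft t p * indicator {p. t / K < Y.R (snd p)} p \<partial>L)
    + (\<integral>p. Ft t p * indicator (middle K t) p \<partial>L)"
    using int[of "{p. Y.R (snd p) \<le> K}"] int[of "{p. t / K < Y.R (snd p)}"]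
      int[of "middle K t"] by simp
  finally show ?thesis .
qed

text \<open>For fixed \<open>K\<close> the outer regimes converge and the middle one is known up to a small multiple of \<open>h t\<close>,
  with the probability of the middle region obtained by subtraction; then \<open>K\<close> is chosen large.\<close>

theorem functional_limit:
  "((\<lambda>t. (\<integral>p. Ft t p \<partial>L) / h t) \<longlongrightarrow>
     c\<^sub>0 * (\<integral>y. \<kappa> y \<partial>Q) + c\<^sub>X * (\<integral>y. \<kappa> y \<partial>L\<^sub>Y) + c\<^sub>Y * (\<integral>x. \<kappa>' x \<partial>L\<^sub>X)) at_top"
proof (rule tendstoI)
  fix e :: real assume e: "0 < e"
  define kb where "kb = (\<integral>y. \<kappa> y \<partial>Q)"
  define lim where "lim K = c\<^sub>X * (\<integral>y. \<kappa> y * indicator {y. Y.R y \<le> K} y \<partial>L\<^sub>Y)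
    + c\<^sub>Y * (\<integral>x. (\<integral>y. F (x, y) * indicator {y. 1 / K < Y.R y} y \<partial>\<nu>\<^sub>Y) \<partial>L\<^sub>X)
    + kb * (1 - c\<^sub>X * truncated_moment_Y K - c\<^sub>Y * truncated_moment_X K)" for K
  define l where "l = c\<^sub>X * (\<integral>y. \<kappa> y \<partial>L\<^sub>Y) + c\<^sub>Y * (\<integral>x. \<kappa>' x \<partial>L\<^sub>X) + kb * (1 - p\<^sub>X - p\<^sub>Y)"
  have "(lim \<longlongrightarrow> l) at_top"
    unfolding lim_def l_def by (intro tendsto_intros small_Y_limit large_Y_limit truncated_moment_Y_limit truncated_moment_X_limit)
  then have ev: "\<forall>\<^sub>F K in at_top. dist (lim K) l < e / 3"
    using e by (intro tendstoD) auto
  have "0 < e / 9" using e by simp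
  then obtain K0 where "1 \<le> K0" and K0: "\<And>K t. K0 \<le> K \<Longrightarrow> K * K \<le> t \<Longrightarrow>
      \<bar>(\<integral>p. Ft t p * indicator (middle K t) p \<partial>L)
        - kb * measure L (middle_tail K t)\<bar>
      \<le> 3 * (e / 9) * h t"
    unfolding kb_def by (rule integral_middle) blast
  obtain K where K: "K0 \<le> K" "dist (lim K) l < e / 3"
    using eventually_happens'[OF _ eventually_conj[OF eventually_ge_at_top[of K0] ev]] by auto
  have K_pos: "0 < K"
    using K(1) \<open>1 \<le> K0\<close> by simp
  let ?S = "\<lambda>t. \<integral>p. Ft t p * indicator {p. Y.R (snd p) \<le> K} p \<partial>L"
  let ?B = "\<lambda>t. \<integral>p. Ft t p * indicator {p. t / K < Y.R (snd p)} p \<partial>L"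
  let ?S1 = "\<lambda>t. measure L {p. t < X.R (fst p) * Y.R (snd p) \<and> Y.R (snd p) \<le> K}"
  let ?B1 = "\<lambda>t. measure L {p. t < X.R (fst p) * Y.R (snd p) \<and> t / K < Y.R (snd p)}"
  define main where "main t = ?S t / h t + ?B t / h t + kb * (1 - ?S1 t / h t - ?B1 t / h t)" for t
  have "(main \<longlongrightarrow> lim K) at_top"
    unfolding main_def lim_def
    by (intro tendsto_intros integral_small_Y integral_large_Y tail_small_Y tail_large_Y K_pos)
  then have ev_main: "\<forall>\<^sub>F t in at_top. dist (main t) (lim K) < e / 3"
    using e by (intro tendstoD) auto
  have l_eq: "c\<^sub>0 * (\<integral>y. \<kappa> y \<partial>Q) + c\<^sub>X * (\<integral>y. \<kappa> y \<partial>L\<^sub>Y) + c\<^sub>Y * (\<integral>x. \<kappa>' x \<partial>L\<^sub>X) = l"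
    by (simp add: l_def kb_def c\<^sub>0_def)
  show "\<forall>\<^sub>F t in at_top. dist ((\<integral>p. Ft t p \<partial>L) / h t)
      (c\<^sub>0 * (\<integral>y. \<kappa> y \<partial>Q) + c\<^sub>X * (\<integral>y. \<kappa> y \<partial>L\<^sub>Y) + c\<^sub>Y * (\<integral>x. \<kappa>' x \<partial>L\<^sub>X)) < e"
    using ev_main eventually_ge_at_top[of "K * K"]
  proof eventually_elim
    case (elim t)
    let ?M = "\<integral>p. Ft t p * indicator (middle K t) p \<partial>L"
    let ?M1 = "measure L (middle_tail K t)"
    have h: "0 < h t" by (rule h_pos)
    have "1 - ?S1 t / h t - ?B1 t / h t = (h t - ?S1 t - ?B1 t) / h t"
      using h by (simp add: diff_divide_distrib)
    also have "\<dots> = ?M1 / h t"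
      using h_split[OF K_pos elim(2)] by (simp add: middle_tail_def)
    finally have "main t = (?S t + ?B t + kb * ?M1) / h t"
      by (simp add: main_def add_divide_distrib)
    then have "(\<integral>p. Ft t p \<partial>L) / h t - main t = (?M - kb * ?M1) / h t"
      unfolding functional_split[OF K_pos elim(2)] by (simp add: diff_divide_distrib[symmetric])
    then have "\<bar>(\<integral>p. Ft t p \<partial>L) / h t - main t\<bar> \<le> e / 3"
      using K0[OF K(1) elim(2)] h by (simp add: divide_le_eq)
    then show ?case
      using elim(1) K(2) unfolding l_eq dist_real_def by linarith
  qed
qed

end

section \<open>Which of the two vectors has the heavier tail\<close>

text \<open>If \<open>u > v\<close>, then \<open>f / h\<close> grows geometrically along \<open>2\<^sup>n t\<close> and cannot converge.\<close>

lemma ratio_limit_le: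
  fixes f h :: "real \<Rightarrow> real"
  assumes pos: "\<And>t. 0 < f t" "\<And>t. 0 < h t"
    and f: "((\<lambda>t. f (2 * t) / f t) \<longlongrightarrow> u) at_top" and h: "((\<lambda>t. h (2 * t) / h t) \<longlongrightarrow> v) at_top"
    and v: "0 < v" and c: "((\<lambda>t. f t / h t) \<longlongrightarrow> c) at_top"
  shows "u \<le> v"
proof (rule ccontr)
  assume "\<not> u \<le> v"
  then have "1 < u / v" using v by simp
  then obtain w where w: "1 < w" "w < u / v" using dense by blast
  define q where "q t = f t / h t" for t
  have q_pos: "0 < q t" for t
    using pos by (simp add: q_def)
  have "((\<lambda>t. (f (2 * t) / f t) / (h (2 * t) / h t)) \<longlongrightarrow> u / v) at_top"
    using v by (intro tendsto_divide f h) auto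
  moreover have "(\<lambda>t. (f (2 * t) / f t) / (h (2 * t) / h t)) = (\<lambda>t. q (2 * t) / q t)"
    by (simp add: q_def fun_eq_iff)
  ultimately have "((\<lambda>t. q (2 * t) / q t) \<longlongrightarrow> u / v) at_top"
    by simp
  then have "\<forall>\<^sub>F t in at_top. w < q (2 * t) / q t"
    using w(2) by (rule order_tendstoD)
  then obtain t0 where t0: "\<And>t. t0 \<le> t \<Longrightarrow> w < q (2 * t) / q t"
    unfolding eventually_at_top_linorder by blast
  define t1 where "t1 = max t0 1"
  have step: "w * q t \<le> q (2 * t)" if "t1 \<le> t" for t
    using t0[of t] that q_pos[of t] by (simp add: t1_def field_simps)
  have grow: "w ^ n * q t1 \<le> q (2 ^ n * t1)" for n
  proof (induction n)
    case (Suc n)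
    have "1 * t1 \<le> 2 ^ n * t1"
      by (intro mult_right_mono) (auto simp: t1_def)
    then have "w * q (2 ^ n * t1) \<le> q (2 * (2 ^ n * t1))"
      by (intro step) simp
    moreover have "w * (w ^ n * q t1) \<le> w * q (2 ^ n * t1)"
      using Suc w(1) by (intro mult_left_mono) auto
    ultimately show ?case by (simp add: mult.assoc)
  qed simp
  have pow: "filterlim (\<lambda>n. b ^ n) at_top sequentially" if "1 < b" for b :: real
    using that by (intro filterlim_at_infinity_imp_filterlim_at_top filterlim_realpow_sequentially_gt1) auto
  have "filterlim (\<lambda>n. w ^ n * q t1) at_top sequentially"
    using w(1) q_pos by (intro filterlim_at_top_mult_tendsto_pos[OF tendsto_const] pow) auto
  then have "filterlim (\<lambda>n. q (2 ^ n * t1)) at_top sequentially"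
    by (rule filterlim_at_top_mono) (use grow in auto)
  moreover have "filterlim (\<lambda>n. 2 ^ n * t1) at_top sequentially"
    by (intro filterlim_at_top_mult_tendsto_pos[OF tendsto_const] pow) (auto simp: t1_def)
  then have "(\<lambda>n. q (2 ^ n * t1)) \<longlonglongrightarrow> c"
    using filterlim_compose[OF c] by (simp add: q_def)
  ultimately show False
    using not_tendsto_and_filterlim_at_infinity[OF trivial_limit_sequentially]
      filterlim_at_top_imp_at_infinity by blast
qed

text \<open>A ramp between two levels lies between the indicators of exceeding them. So a limit for ramps that is
  sandwiched by a function \<open>g\<close> of the levels gives a limit for tails wherever \<open>g\<close> is continuous.\<close>

lemma tail_limit_from_ramps:
  fixes W :: "'a \<Rightarrow> real" and r g :: "real \<Rightarrow> real"
  assumes M: "prob_space M" and [measurable]: "W \<in> borel_measurable M"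
    and r: "\<And>t. 0 \<le> r t" and l: "0 < l" and cont: "isCont g l"
    and ramps: "\<And>p q. 0 < p \<Longrightarrow> p < q \<Longrightarrow> \<exists>I. ((\<lambda>t. (\<integral>x. ramp p q (W x / t) \<partial>M) / r t) \<longlongrightarrow> I) at_top
      \<and> g q \<le> I \<and> I \<le> g p"
  shows "((\<lambda>t. measure M {x \<in> space M. l * t < W x} / r t) \<longlongrightarrow> g l) at_top"
proof (rule tendsto_squeeze_param)
  interpret prob_space M by fact
  show "0 < l" by fact
  have "((\<lambda>e. l + e) \<longlongrightarrow> l + 0) (at_right 0)" "((\<lambda>e. l - e) \<longlongrightarrow> l - 0) (at_right 0)"
    by (intro tendsto_intros)+
  then show "((\<lambda>e. g (l + e)) \<longlongrightarrow> g l) (at_right 0)" "((\<lambda>e. g (l - e)) \<longlongrightarrow> g l) (at_right 0)"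
    using isCont_tendsto_compose[OF cont] by auto
  have int: "integrable M (\<lambda>x. ramp p q (W x / t))" if "p < q" for p q t
  proof (rule integrable_const_bound[where B = 1])
    have "ramp p q \<in> borel_measurable borel"
      using that by (intro borel_measurable_continuous_onI continuous_on_ramp continuous_on_id)
    then show "(\<lambda>x. ramp p q (W x / t)) \<in> borel_measurable M"
      by measurable
  qed (use ramp_bounds in auto)
  have int_ind: "integrable M (indicator {x \<in> space M. c < W x} :: 'a \<Rightarrow> real)" for c
    by (rule integrable_const_bound[where B = 1]) (auto simp: indicator_def)
  have ind: "measure M {x \<in> space M. l * t < W x} = (\<integral>x. indicator {x \<in> space M. l * t < W x} x \<partial>M)" for t
    by simp
  fix e assume e: "0 < e" "e < l"
  show "\<exists>u U. (\<forall>\<^sub>F t in at_top. u t \<le> measure M {x \<in> space M. l * t < W x} / r t) \<and> (u \<longlongrightarrow> U) at_top \<and> g (l + e) \<le> U"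
  proof -
    obtain I where I: "((\<lambda>t. (\<integral>x. ramp l (l + e) (W x / t) \<partial>M) / r t) \<longlongrightarrow> I) at_top" "g (l + e) \<le> I"
      using ramps[of l "l + e"] l e by auto
    have "\<forall>\<^sub>F t in at_top. (\<integral>x. ramp l (l + e) (W x / t) \<partial>M) / r t \<le> measure M {x \<in> space M. l * t < W x} / r t"
      using eventually_gt_at_top[of 0] unfolding ind
    proof (eventually_elim, intro divide_right_mono integral_mono int r)
      fix t :: real and x assume "0 < t" "x \<in> space M"
      then show "ramp l (l + e) (W x / t) \<le> indicator {x \<in> space M. l * t < W x} x"
        using e ramp_bounds[of l "l + e" "W x / t"] by (auto simp: indicator_def ramp_eq_0 field_simps)
    qed (use e int_ind in auto)
    with I show ?thesis
      by (intro exI[of _ "\<lambda>t. (\<integral>x. ramp l (l + e) (W x / t) \<partial>M) / r t"] exI[of _ I] conjI)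
  qed
  show "\<exists>u U. (\<forall>\<^sub>F t in at_top. measure M {x \<in> space M. l * t < W x} / r t \<le> u t) \<and> (u \<longlongrightarrow> U) at_top \<and> U \<le> g (l - e)"
  proof -
    obtain I where I: "((\<lambda>t. (\<integral>x. ramp (l - e) l (W x / t) \<partial>M) / r t) \<longlongrightarrow> I) at_top" "I \<le> g (l - e)"
      using ramps[of "l - e" l] l e by auto
    have "\<forall>\<^sub>F t in at_top. measure M {x \<in> space M. l * t < W x} / r t \<le> (\<integral>x. ramp (l - e) l (W x / t) \<partial>M) / r t"
      using eventually_gt_at_top[of 0] unfolding ind
    proof (eventually_elim, intro divide_right_mono integral_mono int r)
      fix t :: real and x assume "0 < t" "x \<in> space M"
      then show "indicator {x \<in> space M. l * t < W x} x \<le> ramp (l - e) l (W x / t)"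
        using e ramp_bounds[of "l - e" l "W x / t"] by (auto simp: indicator_def ramp_eq_1 field_simps)
    qed (use e int_ind in auto)
    with I show ?thesis
      by (intro exI[of _ "\<lambda>t. (\<integral>x. ramp (l - e) l (W x / t) \<partial>M) / r t"] exI[of _ I] conjI)
  qed
qed

context product_tail
begin

text \<open>The shares \<open>c\<^sub>0\<close> and \<open>p\<^sub>X\<close> both come with the index of the first vector; their sum is \<open>1 - p\<^sub>Y\<close>.\<close>

definition ratio_limit :: "real \<Rightarrow> real" where
  "ratio_limit l = (1 - p\<^sub>Y) * l powr (- X.\<gamma>) + p\<^sub>Y * l powr (- Y.\<gamma>)"

lemma p_Y_le_1: "p\<^sub>Y \<le> 1"
  using c_0_nonneg p_X_nonneg by (simp add: c\<^sub>0_def)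

text \<open>The functional limit theorem for a ramp between levels \<open>p\<close> and \<open>q\<close> of the product of the radii, where
  all three terms can be estimated explicitly.\<close>

lemma ramp_limit:
  assumes pq: "0 < p" "p < q"
  shows "\<exists>I. ((\<lambda>t. (\<integral>z. ramp p q (X.R (fst z) * Y.R (snd z) / t) \<partial>L) / h t) \<longlongrightarrow> I) at_top
    \<and> ratio_limit q \<le> I \<and> I \<le> ratio_limit p"
proof -
  let ?F = "\<lambda>z :: 'a \<times> 'b. ramp p q (X.R (fst z) * Y.R (snd z))"
  interpret f: product_functional L\<^sub>X N\<^sub>X \<alpha>\<^sub>X a\<^sub>X \<nu>\<^sub>X L\<^sub>Y N\<^sub>Y \<alpha>\<^sub>Y a\<^sub>Y \<nu>\<^sub>Y Q c\<^sub>X c\<^sub>Y ?F 1 p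
  proof
    show "continuous_on UNIV ?F"
      using pq(2) by (intro continuous_intros)
  qed (use pq ramp_bounds in \<open>auto simp: ramp_eq_0 X.R_dil Y.R_dil mult_ac\<close>)
  have \<kappa>_bounds: "q powr (- X.\<gamma>) * Y.R y powr X.\<gamma> \<le> f.\<kappa> y \<and> f.\<kappa> y \<le> p powr (- X.\<gamma>) * Y.R y powr X.\<gamma>" for y
    using X.ramp_integral[OF pq Y.R_nonneg[of y]] by (simp add: f.\<kappa>_def)
  have \<kappa>'_bounds: "q powr (- Y.\<gamma>) * X.R x powr Y.\<gamma> \<le> f.\<kappa>' x \<and> f.\<kappa>' x \<le> p powr (- Y.\<gamma>) * X.R x powr Y.\<gamma>" for x
    using Y.ramp_integral[OF pq X.R_nonneg[of x]] by (simp add: f.\<kappa>'_def mult.commute)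
  have R1: "AE y in Q. Y.R y = 1"
    using Q_sphere by eventually_elim (simp add: Y.R_def)
  then have AE_\<kappa>: "AE y in Q. q powr (- X.\<gamma>) \<le> f.\<kappa> y \<and> f.\<kappa> y \<le> p powr (- X.\<gamma>)"
  proof eventually_elim
    case (elim y)
    then show ?case using \<kappa>_bounds[of y] by simp
  qed
  have intQ: "integrable Q f.\<kappa>"
    by (rule Q.integrable_const_bound[where B = "p powr (- X.\<gamma>)"])
       (use AE_\<kappa> f.\<kappa>_nonneg in auto)
  have Q_bounds: "q powr (- X.\<gamma>) \<le> (\<integral>y. f.\<kappa> y \<partial>Q)" "(\<integral>y. f.\<kappa> y \<partial>Q) \<le> p powr (- X.\<gamma>)"
    by (rule Q.integral_ge_const[OF intQ], use AE_\<kappa> in auto)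
       (rule Q.integral_le_const[OF intQ], use AE_\<kappa> in auto)
  have X_bounds: "p\<^sub>X * q powr (- X.\<gamma>) \<le> c\<^sub>X * (\<integral>y. f.\<kappa> y \<partial>L\<^sub>Y) \<and> c\<^sub>X * (\<integral>y. f.\<kappa> y \<partial>L\<^sub>Y) \<le> p\<^sub>X * p powr (- X.\<gamma>)"
  proof (cases "c\<^sub>X = 0")
    case True
    then show ?thesis
      unfolding p\<^sub>X_def by simp
  next
    case False
    then have cX: "0 < c\<^sub>X" using c_X_nonneg by simp
    note i = integrable_moment_Y[OF cX]
    have i2: "integrable L\<^sub>Y f.\<kappa>"
      by (rule Bochner_Integration.integrable_bound[OF integrable_mult_right[OF i, of "p powr (- X.\<gamma>)"]])
         (use f.\<kappa>_nonneg \<kappa>_bounds in auto)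
    have "(\<integral>y. q powr (- X.\<gamma>) * Y.R y powr X.\<gamma> \<partial>L\<^sub>Y) \<le> (\<integral>y. f.\<kappa> y \<partial>L\<^sub>Y)"
      "(\<integral>y. f.\<kappa> y \<partial>L\<^sub>Y) \<le> (\<integral>y. p powr (- X.\<gamma>) * Y.R y powr X.\<gamma> \<partial>L\<^sub>Y)"
      by (intro integral_mono i i2 integrable_mult_right conjunct1[OF \<kappa>_bounds] conjunct2[OF \<kappa>_bounds])+
    from this[THEN mult_left_mono, of c\<^sub>X] show ?thesis
      using cX by (simp add: p\<^sub>X_def mult_ac)
  qed
  have Y_bounds: "p\<^sub>Y * q powr (- Y.\<gamma>) \<le> c\<^sub>Y * (\<integral>x. f.\<kappa>' x \<partial>L\<^sub>X) \<and> c\<^sub>Y * (\<integral>x. f.\<kappa>' x \<partial>L\<^sub>X) \<le> p\<^sub>Y * p powr (- Y.\<gamma>)"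
  proof (cases "c\<^sub>Y = 0")
    case True
    then show ?thesis
      unfolding p\<^sub>Y_def by simp
  next
    case False
    then have cY: "0 < c\<^sub>Y" using c_Y_nonneg by simp
    note i = integrable_moment_X[OF cY]
    have i2: "integrable L\<^sub>X f.\<kappa>'"
      by (rule Bochner_Integration.integrable_bound[OF integrable_mult_right[OF i, of "p powr (- Y.\<gamma>)"]])
         (use f.\<kappa>'_nonneg \<kappa>'_bounds in auto)
    have "(\<integral>x. q powr (- Y.\<gamma>) * X.R x powr Y.\<gamma> \<partial>L\<^sub>X) \<le> (\<integral>x. f.\<kappa>' x \<partial>L\<^sub>X)"
      "(\<integral>x. f.\<kappa>' x \<partial>L\<^sub>X) \<le> (\<integral>x. p powr (- Y.\<gamma>) * X.R x powr Y.\<gamma> \<partial>L\<^sub>X)"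
      by (intro integral_mono i i2 integrable_mult_right conjunct1[OF \<kappa>'_bounds] conjunct2[OF \<kappa>'_bounds])+
    from this[THEN mult_left_mono, of c\<^sub>Y] show ?thesis
      using cY by (simp add: p\<^sub>Y_def mult_ac)
  qed
  let ?U = "c\<^sub>0 * (\<integral>y. f.\<kappa> y \<partial>Q) + c\<^sub>X * (\<integral>y. f.\<kappa> y \<partial>L\<^sub>Y) + c\<^sub>Y * (\<integral>x. f.\<kappa>' x \<partial>L\<^sub>X)"
  have r: "ratio_limit l = c\<^sub>0 * l powr (- X.\<gamma>) + p\<^sub>X * l powr (- X.\<gamma>) + p\<^sub>Y * l powr (- Y.\<gamma>)" for l
    by (simp add: ratio_limit_def c\<^sub>0_def algebra_simps)
  have "ratio_limit q \<le> ?U" "?U \<le> ratio_limit p"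
    unfolding r using Q_bounds X_bounds Y_bounds c_0_nonneg by (auto intro!: add_mono mult_left_mono)
  moreover have "((\<lambda>t. (\<integral>z. ramp p q (X.R (fst z) * Y.R (snd z) / t) \<partial>L) / h t) \<longlongrightarrow> ?U) at_top"
    using f.functional_limit
  proof (rule Lim_transform_eventually)
    show "\<forall>\<^sub>F t in at_top. (\<integral>z. f.Ft t z \<partial>L) / h t = (\<integral>z. ramp p q (X.R (fst z) * Y.R (snd z) / t) \<partial>L) / h t"
      using eventually_gt_at_top[of 0] by eventually_elim (simp add: f.Ft_def X.R_dil)
  qed
  ultimately show ?thesis by blast
qed

lemma h_ratio:
  assumes l: "0 < l"
  shows "((\<lambda>t. h (l * t) / h t) \<longlongrightarrow> ratio_limit l) at_top"
proof -
  have "isCont ratio_limit l"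
    unfolding ratio_limit_def using l by (intro continuous_intros) auto
  then have "((\<lambda>t. measure L {z \<in> space L. l * t < X.R (fst z) * Y.R (snd z)} / h t) \<longlongrightarrow> ratio_limit l) at_top"
    by (intro tail_limit_from_ramps l XY.P.prob_space_axioms ramp_limit) simp_all
  then show ?thesis
    by (simp add: h_def)
qed

lemma tail_ratio_le_limit:
  "2 powr (- X.\<gamma>) \<le> ratio_limit 2" "2 powr (- Y.\<gamma>) \<le> ratio_limit 2"
proof -
  have "0 < ratio_limit 2"
  proof (cases "p\<^sub>Y = 0")
    case True
    then show ?thesis by (simp add: ratio_limit_def)
  next
    case False
    then show ?thesis
      using p_Y_le_1 p_Y_nonneg unfolding ratio_limit_def by (intro add_nonneg_pos) auto
  qed
  then show "2 powr (- X.\<gamma>) \<le> ratio_limit 2" "2 powr (- Y.\<gamma>) \<le> ratio_limit 2"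
    using ratio_limit_le[OF X.G_pos h_pos X.G_ratio h_ratio _ lim_X_h]
      ratio_limit_le[OF Y.G_pos h_pos Y.G_ratio h_ratio _ lim_Y_h] by auto
qed

lemma p_Y_pos:
  assumes "0 < c\<^sub>Y"
  shows "0 < p\<^sub>Y"
proof -
  have "X.G 1 = (\<integral>x. indicator {x. 1 < X.R x} x \<partial>L\<^sub>X)"
    by (simp add: X.G_def)
  also have "\<dots> \<le> (\<integral>x. X.R x powr Y.\<gamma> \<partial>L\<^sub>X)"
    using Y.\<gamma>_pos by (intro integral_mono integrable_moment_X assms X.integrable_L_bounded[where B = 1])
      (auto simp: indicator_def ge_one_powr_ge_zero)
  finally show ?thesis
    using assms X.G_pos[of 1] by (simp add: p\<^sub>Y_def)
qed

lemma p_X_pos: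
  assumes "0 < c\<^sub>X"
  shows "0 < p\<^sub>X"
proof -
  have "Y.G 1 = (\<integral>y. indicator {y. 1 < Y.R y} y \<partial>L\<^sub>Y)"
    by (simp add: Y.G_def)
  also have "\<dots> \<le> (\<integral>y. Y.R y powr X.\<gamma> \<partial>L\<^sub>Y)"
    using X.\<gamma>_pos by (intro integral_mono integrable_moment_Y assms Y.integrable_L_bounded[where B = 1])
      (auto simp: indicator_def ge_one_powr_ge_zero)
  finally show ?thesis
    using assms Y.G_pos[of 1] by (simp add: p\<^sub>X_def)
qed

text \<open>A strictly lighter tail of \<open>Y\<close> is compatible with \<open>tail_ratio_le_limit\<close> only if its share is zero.\<close>

lemma heavier_X:
  assumes "X.\<gamma> < Y.\<gamma>"
  shows "c\<^sub>Y = 0"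
proof -
  have "(2::real) powr (- Y.\<gamma>) < 2 powr (- X.\<gamma>)"
    using assms by simp
  moreover have "0 \<le> p\<^sub>Y * (2 powr (- Y.\<gamma>) - 2 powr (- X.\<gamma>))"
    using tail_ratio_le_limit(1) by (simp add: ratio_limit_def algebra_simps)
  ultimately have "p\<^sub>Y \<le> 0"
    by (simp add: zero_le_mult_iff)
  then show ?thesis
    using p_Y_pos c_Y_nonneg by force
qed

lemma heavier_Y:
  assumes "Y.\<gamma> < X.\<gamma>"
  shows "c\<^sub>0 = 0" "c\<^sub>X = 0"
proof -
  have "(2::real) powr (- X.\<gamma>) < 2 powr (- Y.\<gamma>)"
    using assms by simp
  moreover have "0 \<le> (1 - p\<^sub>Y) * (2 powr (- X.\<gamma>) - 2 powr (- Y.\<gamma>))"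
    using tail_ratio_le_limit(2) by (simp add: ratio_limit_def algebra_simps)
  ultimately have "1 - p\<^sub>Y \<le> 0"
    by (simp add: zero_le_mult_iff)
  then have "p\<^sub>X = 0 \<and> c\<^sub>0 = 0"
    using c_0_nonneg p_X_nonneg by (auto simp: c\<^sub>0_def)
  then show "c\<^sub>0 = 0" "c\<^sub>X = 0"
    using p_X_pos c_X_nonneg by force+
qed

end

section \<open>The limit measure\<close>

definition add_measure :: "'a measure \<Rightarrow> 'a measure \<Rightarrow> 'a measure" where
  "add_measure M1 M2 = measure_of (space M1) (sets M1) (\<lambda>A. emeasure M1 A + emeasure M2 A)"

lemma sets_add_measure [simp, measurable_cong]: "sets (add_measure M1 M2) = sets M1"
  by (simp add: add_measure_def)

lemma space_add_measure [simp]: "space (add_measure M1 M2) = space M1"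
  by (simp add: add_measure_def)

lemma emeasure_add_measure:
  assumes "sets M2 = sets M1" "A \<in> sets M1"
  shows "emeasure (add_measure M1 M2) A = emeasure M1 A + emeasure M2 A"
  unfolding add_measure_def
proof (rule emeasure_measure_of_sigma)
  show "sigma_algebra (space M1) (sets M1)" ..
  show "positive (sets M1) (\<lambda>A. emeasure M1 A + emeasure M2 A)"
    by (simp add: positive_def)
  show "countably_additive (sets M1) (\<lambda>A. emeasure M1 A + emeasure M2 A)"
    unfolding countably_additive_def
    using assms(1) by (auto simp: suminf_emeasure suminf_add[symmetric])
qed fact

lemma nn_integral_add_measure:
  assumes sets: "sets M2 = sets M1" and f: "f \<in> borel_measurable M1"
  shows "(\<integral>\<^sup>+x. f x \<partial>add_measure M1 M2) = (\<integral>\<^sup>+x. f x \<partial>M1) + (\<integral>\<^sup>+x. f x \<partial>M2)"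
proof -
  have M2: "u \<in> borel_measurable M2" if "u \<in> borel_measurable M1" for u :: "'a \<Rightarrow> ennreal"
    using that by (simp add: measurable_cong_sets[OF sets refl])
  from f show ?thesis
  proof induction
  case (cong f g)
  have "space M2 = space M1"
    using sets by (rule sets_eq_imp_space_eq)
  with cong(3) have "(\<integral>\<^sup>+x. f x \<partial>add_measure M1 M2) = (\<integral>\<^sup>+x. g x \<partial>add_measure M1 M2)"
    "(\<integral>\<^sup>+x. f x \<partial>M1) = (\<integral>\<^sup>+x. g x \<partial>M1)" "(\<integral>\<^sup>+x. f x \<partial>M2) = (\<integral>\<^sup>+x. g x \<partial>M2)"
    by (auto intro!: nn_integral_cong)
  with cong(4) show ?case by simp
next
  case (set A)
  then show ?case
    using sets by (simp add: emeasure_add_measure)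
next
  case (mult u c)
  have u: "u \<in> borel_measurable M1" by fact
  note [measurable] = u M2[OF u]
  show ?case
    using mult by (simp add: nn_integral_cmult distrib_left)
next
  case (add u v)
  have uv: "u \<in> borel_measurable M1" "v \<in> borel_measurable M1" by fact+
  note [measurable] = uv M2[OF uv(1)] M2[OF uv(2)]
  show ?case
    using add by (simp add: nn_integral_add ac_simps)
next
  case (seq U)
  have U: "U i \<in> borel_measurable M1" for i by fact
  note [measurable] = U M2[OF U]
  have inc: "incseq (\<lambda>i. \<integral>\<^sup>+x. U i x \<partial>M')" for M' :: "'a measure"
    using seq(3) by (auto simp: incseq_def le_fun_def intro!: nn_integral_mono)
  have "(\<integral>\<^sup>+x. (SUP i. U i x) \<partial>add_measure M1 M2) = (SUP i. \<integral>\<^sup>+x. U i x \<partial>add_measure M1 M2)"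
    using seq(3) by (intro nn_integral_monotone_convergence_SUP) auto
  also have "\<dots> = (SUP i. (\<integral>\<^sup>+x. U i x \<partial>M1) + (\<integral>\<^sup>+x. U i x \<partial>M2))"
    using seq.IH by simp
  also have "\<dots> = (SUP i. \<integral>\<^sup>+x. U i x \<partial>M1) + (SUP i. \<integral>\<^sup>+x. U i x \<partial>M2)"
    by (rule ennreal_SUP_add[OF inc inc])
  also have "\<dots> = (\<integral>\<^sup>+x. (SUP i. U i x) \<partial>M1) + (\<integral>\<^sup>+x. (SUP i. U i x) \<partial>M2)"
    using seq(3) by (simp add: nn_integral_monotone_convergence_SUP)
  finally show ?case
    by (simp add: image_comp SUP_apply[abs_def])
  qed
qed

lemma weighted_nn_integral:
  fixes c :: real
  assumes c: "0 \<le> c" and int: "0 < c \<Longrightarrow> integrable M f" and f: "\<And>x. 0 \<le> f x"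
  shows "ennreal c * (\<integral>\<^sup>+x. ennreal (f x) \<partial>M) = ennreal (c * (\<integral>x. f x \<partial>M))"
proof (cases "c = 0")
  case False
  with c f show ?thesis
    by (simp add: nn_integral_eq_integral[OF int] ennreal_mult Bochner_Integration.integral_nonneg)
qed simp

text \<open>The degrees of homogeneity of \<open>\<psi>\<close> are absorbed into the two dilations.\<close>

locale product_map = product_tail +
  fixes N\<^sub>Z :: "'c::euclidean_space \<Rightarrow> real" and \<psi> :: "'a \<times> 'b \<Rightarrow> 'c"
  assumes N_Z: "is_norm N\<^sub>Z" and \<psi>_continuous: "continuous_on UNIV \<psi>"
    and \<psi>_dil: "\<And>s t x y. 0 \<le> s \<Longrightarrow> 0 \<le> t \<Longrightarrow> \<psi> (X.dil s x, Y.dil t y) = (s * t) *\<^sub>R \<psi> (x, y)"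
begin

lemma N_Z_measurable [measurable]: "N\<^sub>Z \<in> borel_measurable borel"
  by (rule is_norm_borel_measurable[OF N_Z])

lemma N_Z_continuous [continuous_intros]: "continuous_on A f \<Longrightarrow> continuous_on A (\<lambda>x. N\<^sub>Z (f x))"
  by (rule continuous_on_compose2[OF is_norm_continuous[OF N_Z, of UNIV]]) auto

lemma \<psi>_measurable [measurable]: "\<psi> \<in> borel_measurable borel"
  by (rule borel_measurable_continuous_onI[OF \<psi>_continuous])

lemma \<psi>_swap_measurable [measurable]: "(\<lambda>p. \<psi> (snd p, fst p)) \<in> borel_measurable borel"
  by (intro borel_measurable_continuous_onI continuous_on_compose2[OF \<psi>_continuous] continuous_intros) auto

lemma \<psi>_pair_measurable:
  assumes "sets M1 = sets borel" "sets M2 = sets borel"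
  shows "\<psi> \<in> borel_measurable (M1 \<Otimes>\<^sub>M M2)" "(\<lambda>p. \<psi> (snd p, fst p)) \<in> borel_measurable (M2 \<Otimes>\<^sub>M M1)"
proof -
  have "sets (M1 \<Otimes>\<^sub>M M2) = sets borel" "sets (M2 \<Otimes>\<^sub>M M1) = sets borel"
    unfolding borel_prod[symmetric] using assms by (auto intro!: sets_pair_measure_cong)
  then show "\<psi> \<in> borel_measurable (M1 \<Otimes>\<^sub>M M2)" "(\<lambda>p. \<psi> (snd p, fst p)) \<in> borel_measurable (M2 \<Otimes>\<^sub>M M1)"
    using \<psi>_measurable \<psi>_swap_measurable by (simp_all cong: measurable_cong_sets)
qed

text \<open>By homogeneity it suffices to bound \<open>\<psi>\<close> on the product of the unit balls, which is compact.\<close>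

lemma \<psi>_bound:
  obtains D where "0 < D" "\<And>x y. N\<^sub>Z (\<psi> (x, y)) \<le> D * (X.R x * Y.R y)"
proof -
  let ?C = "{x. 0 \<le> N\<^sub>X x \<and> N\<^sub>X x \<le> 1} \<times> {y. 0 \<le> N\<^sub>Y y \<and> N\<^sub>Y y \<le> 1}"
  have "compact ((\<lambda>p. N\<^sub>Z (\<psi> p)) ` ?C)"
    by (intro compact_continuous_image compact_Times is_norm_compact X.N Y.N
        continuous_on_compose2[OF is_norm_continuous[OF N_Z, of UNIV]] continuous_on_subset[OF \<psi>_continuous]) auto
  from compact_imp_bounded[OF this, unfolded bounded_iff]
  obtain B where B: "\<forall>z\<in>(\<lambda>p. N\<^sub>Z (\<psi> p)) ` ?C. norm z \<le> B"
    by (rule exE)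
  have "N\<^sub>Z (\<psi> (x, y)) \<le> max B 1 * (X.R x * Y.R y)" for x y
  proof -
    have "\<psi> (x, y) = (X.R x * Y.R y) *\<^sub>R \<psi> (X.direction x, Y.direction y)"
      using \<psi>_dil[of "X.R x" "Y.R y" "X.direction x" "Y.direction y"]
      by (simp add: X.dil_direction Y.dil_direction)
    then have "N\<^sub>Z (\<psi> (x, y)) = (X.R x * Y.R y) * N\<^sub>Z (\<psi> (X.direction x, Y.direction y))"
      by (simp add: is_norm_scaleR[OF N_Z] abs_mult)
    also have "\<dots> \<le> (X.R x * Y.R y) * max B 1"
    proof (intro mult_left_mono)
      have "norm (N\<^sub>Z (\<psi> (X.direction x, Y.direction y))) \<le> B"
        using X.N_direction_le[of x] Y.N_direction_le[of y] by (intro B[rule_format] imageI) auto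
      then show "N\<^sub>Z (\<psi> (X.direction x, Y.direction y)) \<le> max B 1" by simp
    qed simp
    finally show ?thesis by (simp add: mult.commute)
  qed
  then show thesis by (intro that[of "max B 1"]) auto
qed

text \<open>The measures \<open>E[\<nu>\<^sub>X{x. \<psi>(x, W) \<in> \<cdot>}]\<close> and \<open>E[\<nu>\<^sub>Y{y. \<psi>(X, y) \<in> \<cdot>}]\<close>, as images of product measures. They
  may be infinite on compact sets away from the origin if their coefficient in \<open>\<eta>\<close> vanishes.\<close>

definition mix_X :: "'b measure \<Rightarrow> 'c measure" where
  "mix_X W = distr (W \<Otimes>\<^sub>M \<nu>\<^sub>X) borel (\<lambda>p. \<psi> (snd p, fst p))"

definition mix_Y :: "'c measure" where
  "mix_Y = distr (L\<^sub>X \<Otimes>\<^sub>M \<nu>\<^sub>Y) borel \<psi>"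

definition \<eta> :: "'c measure" where
  "\<eta> = add_measure (scale_measure (ennreal c\<^sub>0) (mix_X Q))
    (add_measure (scale_measure (ennreal c\<^sub>X) (mix_X L\<^sub>Y)) (scale_measure (ennreal c\<^sub>Y) mix_Y))"

lemma sets_mix [simp, measurable_cong]: "sets (mix_X W) = sets borel" "sets mix_Y = sets borel"
  by (simp_all add: mix_X_def mix_Y_def)

lemma sets_\<eta> [simp, measurable_cong]: "sets \<eta> = sets borel"
  by (simp add: \<eta>_def)

lemma nn_integral_mix_X:
  assumes [measurable_cong]: "sets W = sets borel" and [measurable]: "f \<in> borel_measurable borel"
  shows "(\<integral>\<^sup>+z. f z \<partial>mix_X W) = (\<integral>\<^sup>+y. (\<integral>\<^sup>+x. f (\<psi> (x, y)) \<partial>\<nu>\<^sub>X) \<partial>W)"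
proof -
  interpret \<nu>: sigma_finite_measure \<nu>\<^sub>X by (rule X.sigma_finite_\<nu>)
  have "(\<integral>\<^sup>+z. f z \<partial>mix_X W) = (\<integral>\<^sup>+p. f (\<psi> (snd p, fst p)) \<partial>(W \<Otimes>\<^sub>M \<nu>\<^sub>X))"
    unfolding mix_X_def by (rule nn_integral_distr[OF \<psi>_pair_measurable(2)]) (use assms in auto)
  also have "\<dots> = (\<integral>\<^sup>+y. (\<integral>\<^sup>+x. f (\<psi> (x, y)) \<partial>\<nu>\<^sub>X) \<partial>W)"
    using assms
    by (subst \<nu>.nn_integral_fst[symmetric]) (auto intro!: measurable_compose[OF \<psi>_pair_measurable(2)])
  finally show ?thesis .
qed

lemma nn_integral_mix_Y:
  assumes [measurable]: "f \<in> borel_measurable borel"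
  shows "(\<integral>\<^sup>+z. f z \<partial>mix_Y) = (\<integral>\<^sup>+x. (\<integral>\<^sup>+y. f (\<psi> (x, y)) \<partial>\<nu>\<^sub>Y) \<partial>L\<^sub>X)"
proof -
  interpret \<nu>: sigma_finite_measure \<nu>\<^sub>Y by (rule Y.sigma_finite_\<nu>)
  have "(\<integral>\<^sup>+z. f z \<partial>mix_Y) = (\<integral>\<^sup>+p. f (\<psi> p) \<partial>(L\<^sub>X \<Otimes>\<^sub>M \<nu>\<^sub>Y))"
    unfolding mix_Y_def by (rule nn_integral_distr[OF \<psi>_pair_measurable(1)]) (use assms in auto)
  also have "\<dots> = (\<integral>\<^sup>+x. (\<integral>\<^sup>+y. f (\<psi> (x, y)) \<partial>\<nu>\<^sub>Y) \<partial>L\<^sub>X)"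
    using assms
    by (subst \<nu>.nn_integral_fst[symmetric]) (auto intro!: measurable_compose[OF \<psi>_pair_measurable(1)])
  finally show ?thesis .
qed

lemma nn_integral_\<eta>:
  assumes [measurable]: "f \<in> borel_measurable borel"
  shows "(\<integral>\<^sup>+z. f z \<partial>\<eta>) =
      ennreal c\<^sub>0 * (\<integral>\<^sup>+y. (\<integral>\<^sup>+x. f (\<psi> (x, y)) \<partial>\<nu>\<^sub>X) \<partial>Q)
    + ennreal c\<^sub>X * (\<integral>\<^sup>+y. (\<integral>\<^sup>+x. f (\<psi> (x, y)) \<partial>\<nu>\<^sub>X) \<partial>L\<^sub>Y)
    + ennreal c\<^sub>Y * (\<integral>\<^sup>+x. (\<integral>\<^sup>+y. f (\<psi> (x, y)) \<partial>\<nu>\<^sub>Y) \<partial>L\<^sub>X)"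
  unfolding \<eta>_def
  by (simp add: nn_integral_add_measure nn_integral_scale_measure nn_integral_mix_X nn_integral_mix_Y add.assoc)

lemma section_sets:
  assumes "A \<in> sets borel"
  shows "{x. \<psi> (x, y) \<in> A} \<in> sets borel" "{y. \<psi> (x, y) \<in> A} \<in> sets borel"
  using assms by measurable

lemma nn_integral_section:
  assumes "A \<in> sets borel"
  shows "(\<integral>\<^sup>+x. indicator A (\<psi> (x, y)) \<partial>\<nu>\<^sub>X) = emeasure \<nu>\<^sub>X {x. \<psi> (x, y) \<in> A}"
    and "(\<integral>\<^sup>+y. indicator A (\<psi> (x, y)) \<partial>\<nu>\<^sub>Y) = emeasure \<nu>\<^sub>Y {y. \<psi> (x, y) \<in> A}"
proof -
  have "(\<lambda>x. indicator A (\<psi> (x, y)) :: ennreal) = indicator {x. \<psi> (x, y) \<in> A}"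
    by (auto simp: indicator_def fun_eq_iff)
  then show "(\<integral>\<^sup>+x. indicator A (\<psi> (x, y)) \<partial>\<nu>\<^sub>X) = emeasure \<nu>\<^sub>X {x. \<psi> (x, y) \<in> A}"
    using section_sets[OF assms] by simp
  have "(\<lambda>y. indicator A (\<psi> (x, y)) :: ennreal) = indicator {y. \<psi> (x, y) \<in> A}"
    by (auto simp: indicator_def fun_eq_iff)
  then show "(\<integral>\<^sup>+y. indicator A (\<psi> (x, y)) \<partial>\<nu>\<^sub>Y) = emeasure \<nu>\<^sub>Y {y. \<psi> (x, y) \<in> A}"
    using section_sets[OF assms] by simp
qed

lemma section_measurable:
  assumes [measurable]: "A \<in> sets borel"
  shows "(\<lambda>y. emeasure \<nu>\<^sub>X {x. \<psi> (x, y) \<in> A}) \<in> borel_measurable borel"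
    and "(\<lambda>x. emeasure \<nu>\<^sub>Y {y. \<psi> (x, y) \<in> A}) \<in> borel_measurable borel"
proof -
  interpret \<nu>X: sigma_finite_measure \<nu>\<^sub>X by (rule X.sigma_finite_\<nu>)
  interpret \<nu>Y: sigma_finite_measure \<nu>\<^sub>Y by (rule Y.sigma_finite_\<nu>)
  show "(\<lambda>y. emeasure \<nu>\<^sub>X {x. \<psi> (x, y) \<in> A}) \<in> borel_measurable borel"
    unfolding nn_integral_section[OF assms, symmetric] by measurable
  show "(\<lambda>x. emeasure \<nu>\<^sub>Y {y. \<psi> (x, y) \<in> A}) \<in> borel_measurable borel"
    unfolding nn_integral_section[OF assms, symmetric] by measurable
qed

lemma emeasure_\<eta>:
  assumes A: "A \<in> sets borel"
  shows "emeasure \<eta> A =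
      ennreal c\<^sub>0 * (\<integral>\<^sup>+y. emeasure \<nu>\<^sub>X {x. \<psi> (x, y) \<in> A} \<partial>Q)
    + ennreal c\<^sub>X * (\<integral>\<^sup>+y. emeasure \<nu>\<^sub>X {x. \<psi> (x, y) \<in> A} \<partial>L\<^sub>Y)
    + ennreal c\<^sub>Y * (\<integral>\<^sup>+x. emeasure \<nu>\<^sub>Y {y. \<psi> (x, y) \<in> A} \<partial>L\<^sub>X)"
  using nn_integral_\<eta>[of "indicator A"] A by (simp add: nn_integral_section)

lemma map_limit:
  fixes f :: "'c \<Rightarrow> real"
  assumes f: "continuous_on UNIV f" "\<And>z. 0 \<le> f z" "\<And>z. f z \<le> B"
    and d: "0 < d" "\<And>z. N\<^sub>Z z \<le> d \<Longrightarrow> f z = 0"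
  obtains l where "0 \<le> l" "((\<lambda>t. (\<integral>p. f ((1 / t) *\<^sub>R \<psi> p) \<partial>L) / h t) \<longlongrightarrow> l) at_top"
    "(\<integral>\<^sup>+z. ennreal (f z) \<partial>\<eta>) = ennreal l"
proof -
  obtain D where D: "0 < D" "\<And>x y. N\<^sub>Z (\<psi> (x, y)) \<le> D * (X.R x * Y.R y)"
    by (rule \<psi>_bound) blast
  interpret f: product_functional L\<^sub>X N\<^sub>X \<alpha>\<^sub>X a\<^sub>X \<nu>\<^sub>X L\<^sub>Y N\<^sub>Y \<alpha>\<^sub>Y a\<^sub>Y \<nu>\<^sub>Y Q c\<^sub>X c\<^sub>Y "\<lambda>p. f (\<psi> p)" B "d / D"
  proof
    show "continuous_on UNIV (\<lambda>p. f (\<psi> p))"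
      by (rule continuous_on_compose2[OF f(1) \<psi>_continuous]) auto
    show "f (\<psi> (x, y)) = 0" if "X.R x * Y.R y \<le> d / D" for x y
    proof (rule d(2))
      have "N\<^sub>Z (\<psi> (x, y)) \<le> D * (X.R x * Y.R y)" by (rule D(2))
      also have "\<dots> \<le> d" using that D(1) by (simp add: field_simps)
      finally show "N\<^sub>Z (\<psi> (x, y)) \<le> d" .
    qed
    show "f (\<psi> (X.dil s x, y)) = f (\<psi> (x, Y.dil s y))" if "0 \<le> s" for s x y
      using \<psi>_dil[of s 1 x y] \<psi>_dil[of 1 s x y] that by simp
  qed (use f d D in auto)
  define l where "l = c\<^sub>0 * (\<integral>y. f.\<kappa> y \<partial>Q) + c\<^sub>X * (\<integral>y. f.\<kappa> y \<partial>L\<^sub>Y) + c\<^sub>Y * (\<integral>x. f.\<kappa>' x \<partial>L\<^sub>X)"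
  have nn: "0 \<le> (\<integral>y. f.\<kappa> y \<partial>Q)" "0 \<le> (\<integral>y. f.\<kappa> y \<partial>L\<^sub>Y)" "0 \<le> (\<integral>x. f.\<kappa>' x \<partial>L\<^sub>X)"
    using f.\<kappa>_nonneg f.\<kappa>'_nonneg by (auto intro!: Bochner_Integration.integral_nonneg)
  have [measurable]: "f \<in> borel_measurable borel"
    by (rule borel_measurable_continuous_onI[OF f(1)])
  have "\<forall>\<^sub>F t in at_top. (\<integral>p. f.Ft t p \<partial>L) / h t = (\<integral>p. f ((1 / t) *\<^sub>R \<psi> p) \<partial>L) / h t"
    using eventually_gt_at_top[of 0]
  proof eventually_elim
    case (elim t)
    have "f.Ft t p = f ((1 / t) *\<^sub>R \<psi> p)" for p
      using \<psi>_dil[of "1 / t" 1 "fst p" "snd p"] elim by (simp add: f.Ft_def)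
    then show ?case by simp
  qed
  with f.functional_limit have lim: "((\<lambda>t. (\<integral>p. f ((1 / t) *\<^sub>R \<psi> p) \<partial>L) / h t) \<longlongrightarrow> l) at_top"
    unfolding l_def by (rule Lim_transform_eventually)
  have inner: "(\<integral>\<^sup>+x. ennreal (f (\<psi> (x, y))) \<partial>\<nu>\<^sub>X) = ennreal (f.\<kappa> y)"
    "(\<integral>\<^sup>+y. ennreal (f (\<psi> (x, y))) \<partial>\<nu>\<^sub>Y) = ennreal (f.\<kappa>' x)" for x y
    unfolding f.\<kappa>_def f.\<kappa>'_def using f.integrable_F_X f.integrable_F_Y f(2)
    by (auto intro!: nn_integral_eq_integral)
  have "AE y in Q. f.\<kappa> y \<le> B * (d / D) powr (- X.\<gamma>)"
    using Q_sphere
  proof eventually_elim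
    case (elim y)
    then show ?case using f.\<kappa>_le[of y] by (simp add: Y.R_def)
  qed
  then have "integrable Q f.\<kappa>"
    using f.\<kappa>_nonneg by (intro Q.integrable_const_bound[where B = "B * (d / D) powr (- X.\<gamma>)"]) auto
  then have 0: "ennreal c\<^sub>0 * (\<integral>\<^sup>+y. ennreal (f.\<kappa> y) \<partial>Q) = ennreal (c\<^sub>0 * (\<integral>y. f.\<kappa> y \<partial>Q))"
    by (intro weighted_nn_integral c_0_nonneg f.\<kappa>_nonneg)
  have 1: "ennreal c\<^sub>X * (\<integral>\<^sup>+y. ennreal (f.\<kappa> y) \<partial>L\<^sub>Y) = ennreal (c\<^sub>X * (\<integral>y. f.\<kappa> y \<partial>L\<^sub>Y))"
    by (intro weighted_nn_integral c_X_nonneg f.\<kappa>_nonneg Bochner_Integration.integrable_bound[OF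
          integrable_mult_right[OF integrable_moment_Y, of "B * (d / D) powr (- X.\<gamma>)"]])
       (use f.\<kappa>_nonneg f.\<kappa>_le f.C_nonneg in auto)
  have 2: "ennreal c\<^sub>Y * (\<integral>\<^sup>+x. ennreal (f.\<kappa>' x) \<partial>L\<^sub>X) = ennreal (c\<^sub>Y * (\<integral>x. f.\<kappa>' x \<partial>L\<^sub>X))"
    by (intro weighted_nn_integral c_Y_nonneg f.\<kappa>'_nonneg Bochner_Integration.integrable_bound[OF
          integrable_mult_right[OF integrable_moment_X, of "B * (d / D) powr (- Y.\<gamma>)"]])
       (use f.\<kappa>'_nonneg f.\<kappa>'_le f.C_nonneg in auto)
  have "(\<integral>\<^sup>+z. ennreal (f z) \<partial>\<eta>) = ennreal l"
    using nn c_0_nonneg c_X_nonneg c_Y_nonneg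
    by (simp add: nn_integral_\<eta> inner 0 1 2 l_def ennreal_plus[symmetric] del: ennreal_plus)
  moreover have "0 \<le> l"
    using nn c_0_nonneg c_X_nonneg c_Y_nonneg by (simp add: l_def)
  ultimately show thesis
    using lim by (intro that)
qed

lemma \<eta>_tail_finite:
  assumes "0 < d"
  shows "emeasure \<eta> {z. d < N\<^sub>Z z} < \<infinity>"
proof -
  obtain l where l: "(\<integral>\<^sup>+z. ennreal (ramp (d / 2) d (N\<^sub>Z z)) \<partial>\<eta>) = ennreal l"
    by (rule map_limit[of "\<lambda>z. ramp (d / 2) d (N\<^sub>Z z)" 1 "d / 2"])
       (use assms in \<open>auto intro!: continuous_on_ramp N_Z_continuous continuous_on_id simp: ramp_bounds ramp_eq_0\<close>)
  have "emeasure \<eta> {z. d < N\<^sub>Z z} = (\<integral>\<^sup>+z. indicator {z. d < N\<^sub>Z z} z \<partial>\<eta>)"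
    by simp
  also have "\<dots> \<le> (\<integral>\<^sup>+z. ennreal (ramp (d / 2) d (N\<^sub>Z z)) \<partial>\<eta>)"
    using assms by (intro nn_integral_mono) (auto simp: indicator_def ramp_eq_1)
  finally show ?thesis
    unfolding l by (simp add: order_le_less_trans)
qed

definition \<gamma> :: real where "\<gamma> = min X.\<gamma> Y.\<gamma>"

text \<open>The first two terms scale with the index of \<open>X\<close> and the third one with that of \<open>Y\<close>; if the indices
  differ, the terms with the larger index have coefficient zero.\<close>

lemma \<eta>_homogeneous:
  assumes t: "0 < t" and A: "A \<in> sets borel"
  shows "emeasure \<eta> ((\<lambda>z. t *\<^sub>R z) -` A) = ennreal (t powr \<gamma>) * emeasure \<eta> A"
proof -
  have tA: "(\<lambda>z. t *\<^sub>R z) -` A \<in> sets borel"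
    by (rule measurable_sets_borel[OF _ A]) measurable
  have "{x. \<psi> (x, y) \<in> (\<lambda>z. t *\<^sub>R z) -` A} = X.dil t -` {x. \<psi> (x, y) \<in> A}" for y
    using \<psi>_dil[of t 1 _ y] t by auto
  then have X: "emeasure \<nu>\<^sub>X {x. \<psi> (x, y) \<in> (\<lambda>z. t *\<^sub>R z) -` A}
      = ennreal (t powr X.\<gamma>) * emeasure \<nu>\<^sub>X {x. \<psi> (x, y) \<in> A}" for y
    by (simp only: X.\<nu>_dil[OF t section_sets(1)[OF A]])
  have "{y. \<psi> (x, y) \<in> (\<lambda>z. t *\<^sub>R z) -` A} = Y.dil t -` {y. \<psi> (x, y) \<in> A}" for x
    using \<psi>_dil[of 1 t x] t by auto
  then have Y: "emeasure \<nu>\<^sub>Y {y. \<psi> (x, y) \<in> (\<lambda>z. t *\<^sub>R z) -` A}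
      = ennreal (t powr Y.\<gamma>) * emeasure \<nu>\<^sub>Y {y. \<psi> (x, y) \<in> A}" for x
    by (simp only: Y.\<nu>_dil[OF t section_sets(2)[OF A]])
  have "ennreal c\<^sub>0 * (ennreal (t powr X.\<gamma>) * u) = ennreal (t powr \<gamma>) * (ennreal c\<^sub>0 * u)"
    "ennreal c\<^sub>X * (ennreal (t powr X.\<gamma>) * u) = ennreal (t powr \<gamma>) * (ennreal c\<^sub>X * u)"
    "ennreal c\<^sub>Y * (ennreal (t powr Y.\<gamma>) * u) = ennreal (t powr \<gamma>) * (ennreal c\<^sub>Y * u)" for u
    using heavier_X heavier_Y by (cases X.\<gamma> Y.\<gamma> rule: linorder_cases; simp add: \<gamma>_def mult_ac)+
  then show ?thesis
    unfolding emeasure_\<eta>[OF tA] emeasure_\<eta>[OF A] X Y using section_measurable[OF A]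
    by (simp add: nn_integral_cmult distrib_left)
qed

definition m :: real where "m = measure \<eta> {z. 1 < N\<^sub>Z z}"

lemma emeasure_\<eta>_1: "emeasure \<eta> {z. 1 < N\<^sub>Z z} = ennreal m"
  using \<eta>_tail_finite[of 1] by (simp add: m_def emeasure_eq_ennreal_measure)

lemma emeasure_\<eta>_tail:
  assumes "0 < l"
  shows "emeasure \<eta> {z. l < N\<^sub>Z z} = ennreal (l powr (-\<gamma>) * m)"
proof -
  have "(\<lambda>z. (1 / l) *\<^sub>R z) -` {z. 1 < N\<^sub>Z z} = {z. l < N\<^sub>Z z}"
    using assms by (auto simp: is_norm_scaleR[OF N_Z] field_simps)
  moreover have "(1 / l) powr \<gamma> = l powr (-\<gamma>)"
    using assms by (simp add: powr_divide powr_minus_divide)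
  ultimately show ?thesis
    using \<eta>_homogeneous[of "1 / l" "{z. 1 < N\<^sub>Z z}"] assms
    by (simp add: emeasure_\<eta>_1 ennreal_mult')
qed

lemma m_pos:
  assumes "emeasure \<eta> (- {0}) \<noteq> 0"
  shows "0 < m"
proof (rule ccontr)
  assume "\<not> 0 < m"
  then have "m = 0"
    by (simp add: m_def less_le)
  then have null: "emeasure \<eta> {z. 1 / real (Suc n) < N\<^sub>Z z} = 0" for n
    by (subst emeasure_\<eta>_tail) auto
  have "- {0} = (\<Union>n. {z. 1 / real (Suc n) < N\<^sub>Z z})"
  proof -
    have "\<exists>n. 1 / real (Suc n) < N\<^sub>Z z" if "z \<noteq> 0" for z
    proof -
      have "0 < N\<^sub>Z z"
        using that is_norm_eq_0_iff[OF N_Z, of z] is_norm_nonneg[OF N_Z, of z] by (simp add: less_le)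
      then show ?thesis
        by (rule nat_approx_posE) blast
    qed
    moreover have "\<not> 1 / real (Suc n) < N\<^sub>Z 0" for n
      by (simp add: is_norm_zero[OF N_Z] not_less)
    ultimately show ?thesis by auto
  qed
  moreover have "emeasure \<eta> (\<Union>n. {z. 1 / real (Suc n) < N\<^sub>Z z}) = 0"
    by (rule emeasure_UN_eq_0) (use null in auto)
  ultimately show False
    using assms by simp
qed

text \<open>The set \<open>{z. 1 < N\<^sub>Z z}\<close> is not bounded, but \<open>map_limit\<close> allows test functions that do not vanish near
  infinity, and homogeneity makes \<open>\<eta>\<close> continuous in the level.\<close>

lemma norm_tail_limit:
  "((\<lambda>t. measure L {p. t < N\<^sub>Z (\<psi> p)} / h t) \<longlongrightarrow> m) at_top"
proof -
  have "((\<lambda>t. measure L {z \<in> space L. 1 * t < N\<^sub>Z (\<psi> z)} / h t) \<longlongrightarrow> 1 powr (-\<gamma>) * m) at_top"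
  proof (rule tail_limit_from_ramps[OF XY.P.prob_space_axioms])
    show "isCont (\<lambda>l. l powr (-\<gamma>) * m) 1"
      by (intro continuous_intros) auto
    fix p q :: real assume pq: "0 < p" "p < q"
    obtain I where I: "0 \<le> I" "((\<lambda>t. (\<integral>z. ramp p q (N\<^sub>Z ((1 / t) *\<^sub>R \<psi> z)) \<partial>L) / h t) \<longlongrightarrow> I) at_top"
      "(\<integral>\<^sup>+z. ennreal (ramp p q (N\<^sub>Z z)) \<partial>\<eta>) = ennreal I"
      by (rule map_limit[of "\<lambda>z. ramp p q (N\<^sub>Z z)" 1 p])
         (use pq in \<open>auto intro!: continuous_on_ramp N_Z_continuous continuous_on_id simp: ramp_bounds ramp_eq_0\<close>)
    have tail: "(\<integral>\<^sup>+z. indicator {z. l < N\<^sub>Z z} z \<partial>\<eta>) = ennreal (l powr (-\<gamma>) * m)" if "0 < l" for l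
      using emeasure_\<eta>_tail[OF that] by simp
    have "(\<integral>\<^sup>+z. indicator {z. q < N\<^sub>Z z} z \<partial>\<eta>) \<le> (\<integral>\<^sup>+z. ennreal (ramp p q (N\<^sub>Z z)) \<partial>\<eta>)"
      using pq by (intro nn_integral_mono) (auto simp: indicator_def ramp_eq_1)
    then have "ennreal (q powr (-\<gamma>) * m) \<le> ennreal I"
      using pq tail[of q] unfolding I(3) by simp
    moreover have "(\<integral>\<^sup>+z. ennreal (ramp p q (N\<^sub>Z z)) \<partial>\<eta>) \<le> (\<integral>\<^sup>+z. indicator {z. p < N\<^sub>Z z} z \<partial>\<eta>)"
      using pq ramp_bounds by (intro nn_integral_mono) (auto simp: indicator_def ramp_eq_0 ennreal_le_1)
    then have "ennreal I \<le> ennreal (p powr (-\<gamma>) * m)"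
      using pq tail[of p] unfolding I(3) by simp
    moreover have "((\<lambda>t. (\<integral>z. ramp p q (N\<^sub>Z (\<psi> z) / t) \<partial>L) / h t) \<longlongrightarrow> I) at_top"
      using I(2)
    proof (rule Lim_transform_eventually)
      show "\<forall>\<^sub>F t in at_top. (\<integral>z. ramp p q (N\<^sub>Z ((1 / t) *\<^sub>R \<psi> z)) \<partial>L) / h t
          = (\<integral>z. ramp p q (N\<^sub>Z (\<psi> z) / t) \<partial>L) / h t"
        using eventually_gt_at_top[of 0] by eventually_elim (simp add: is_norm_scaleR[OF N_Z])
    qed
    moreover have "0 \<le> m"
      by (simp add: m_def)
    ultimately show "\<exists>I. ((\<lambda>t. (\<integral>z. ramp p q (N\<^sub>Z (\<psi> z) / t) \<partial>L) / h t) \<longlongrightarrow> I) at_top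
        \<and> q powr (-\<gamma>) * m \<le> I \<and> I \<le> p powr (-\<gamma>) * m"
      using I(1) by (intro exI[of _ I]) (simp add: ennreal_le_iff)
  qed simp_all
  then show ?thesis by simp
qed

end

section \<open>From random vectors to their laws\<close>

lemma nn_integral_normalized_law:
  assumes [measurable]: "X \<in> borel_measurable M" "g \<in> borel_measurable borel" and g0: "g 0 = 0"
  shows "(\<integral>\<^sup>+x. g x \<partial>normalized_law M X r t) = ennreal (1 / r t) * (\<integral>\<^sup>+\<omega>. g ((1 / t) *\<^sub>R X \<omega>) \<partial>M)"
proof -
  let ?D = "distr M borel (\<lambda>\<omega>. (1 / t) *\<^sub>R X \<omega>)"
  have gm: "g \<in> borel_measurable (restrict_space ?D (- {0}))"
    by (intro measurable_restrict_space1) simp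
  have "(\<integral>\<^sup>+x. g x \<partial>normalized_law M X r t) = ennreal (1 / r t) * (\<integral>\<^sup>+x. g x \<partial>restrict_space ?D (- {0}))"
    unfolding normalized_law_def by (rule nn_integral_scale_measure[OF gm])
  also have "(\<integral>\<^sup>+x. g x \<partial>restrict_space ?D (- {0})) = (\<integral>\<^sup>+x. g x * indicator (- {0}) x \<partial>?D)"
    by (rule nn_integral_restrict_space) simp
  also have "\<dots> = (\<integral>\<^sup>+x. g x \<partial>?D)"
    using g0 by (intro nn_integral_cong) (auto simp: indicator_def)
  also have "\<dots> = (\<integral>\<^sup>+\<omega>. g ((1 / t) *\<^sub>R X \<omega>) \<partial>M)"
    by (rule nn_integral_distr) simp_all
  finally show ?thesis .
qed

lemma radon_measure_extension:
  assumes "sets \<mu> = sets (punctured_borel :: 'a::euclidean_space measure)"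
  shows "space \<mu> = - {0}" "(\<lambda>x. x) \<in> measurable \<mu> borel"
    and "A \<in> sets borel \<Longrightarrow> emeasure (distr \<mu> borel (\<lambda>x. x)) A = emeasure \<mu> (A \<inter> - {0})"
proof -
  show sp: "space \<mu> = - {0}"
    using sets_eq_imp_space_eq[OF assms] by (simp add: space_restrict_space)
  have "(\<lambda>x. x) \<in> measurable (punctured_borel :: 'a measure) borel"
    by (intro measurable_restrict_space1) simp
  then show id: "(\<lambda>x. x) \<in> measurable \<mu> borel"
    by (simp add: measurable_cong_sets[OF assms refl])
  show "emeasure (distr \<mu> borel (\<lambda>x. x)) A = emeasure \<mu> (A \<inter> - {0})" if "A \<in> sets borel"
    using emeasure_distr[OF id that] by (simp add: sp vimage_def)
qed

lemma regular_tail_if_regularly_varying: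
  fixes X :: "'w \<Rightarrow> 'a::euclidean_space"
  assumes N: "is_norm N" and M: "prob_space M" and rv: "regularly_varying M N X \<alpha> \<mu>" and a: "0 < a"
  shows "regular_tail (distr M borel X) N \<alpha> a (distr \<mu> borel (\<lambda>x. x))"
proof -
  interpret M: prob_space M by fact
  let ?L = "distr M borel X" and ?\<nu> = "distr \<mu> borel (\<lambda>x. x)"
  have X [measurable]: "X \<in> borel_measurable M" and \<alpha>: "0 < \<alpha>" and radon: "radon_measure \<mu>"
    and nonnull: "emeasure \<mu> (space \<mu>) \<noteq> 0"
    and vague: "vague_conv (normalized_law M X (\<lambda>t. measure M {\<omega> \<in> space M. N (X \<omega>) > t})) \<mu>"
    and hom: "\<And>t A. 0 < t \<Longrightarrow> A \<in> sets \<mu> \<Longrightarrow> emeasure \<mu> ((\<lambda>x. t *\<^sub>R x) ` A) = ennreal (t powr (- \<alpha>)) * emeasure \<mu> A"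
    using rv unfolding regularly_varying_def by blast+
  have sets_\<mu>: "sets \<mu> = sets punctured_borel"
    and compact: "\<And>K. compact K \<Longrightarrow> K \<subseteq> - {0} \<Longrightarrow> emeasure \<mu> K < \<infinity>"
    using radon unfolding radon_measure_def by auto
  note ext = radon_measure_extension[OF sets_\<mu>]
  have Nm [measurable]: "N \<in> borel_measurable borel"
    by (rule is_norm_borel_measurable[OF N])
  interpret L: prob_space ?L
    by (rule M.prob_space_distr[OF X])
  have \<nu>_compact: "emeasure ?\<nu> K < \<infinity>" if "compact K" "0 \<notin> K" for K
  proof -
    have "K \<inter> - {0} = K" "K \<in> sets borel"
      using that by (auto intro: borel_compact)
    then show ?thesis using ext(3)[of K] compact[of K] that by auto
  qed
  show ?thesis
  proof
    show "sets ?L = sets borel" "sets ?\<nu> = sets borel"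
      by simp_all
    show "is_norm N" "0 < \<alpha>" "0 < a" by fact+
    show "emeasure ?\<nu> {0} = 0"
      by (simp add: ext(3))
    show "emeasure ?\<nu> UNIV \<noteq> 0"
      using nonnull by (simp add: ext)
    show "emeasure ?\<nu> K < \<infinity>" if "compact K" "0 \<notin> K" for K
      using that by (rule \<nu>_compact)
  next
    fix t :: real and A :: "'a set" assume t: "0 < t" and A: "A \<in> sets borel"
    have A0: "A \<inter> - {0} \<in> sets \<mu>"
      using A by (auto simp: sets_\<mu> sets_restrict_space)
    have "(\<lambda>x. t *\<^sub>R x) -` A \<in> sets borel"
      by (rule measurable_sets_borel[OF _ A]) measurable
    moreover have "(\<lambda>x. t *\<^sub>R x) -` A \<inter> - {0} = (\<lambda>x. (1 / t) *\<^sub>R x) ` (A \<inter> - {0})"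
    proof (intro equalityI subsetI)
      fix x assume "x \<in> (\<lambda>x. t *\<^sub>R x) -` A \<inter> - {0}"
      then show "x \<in> (\<lambda>x. (1 / t) *\<^sub>R x) ` (A \<inter> - {0})"
        using t by (intro image_eqI[of _ _ "t *\<^sub>R x"]) auto
    qed (use t in auto)
    moreover have "(1 / t) powr (- \<alpha>) = t powr \<alpha>"
      using t by (simp add: powr_divide powr_minus_divide)
    ultimately show "emeasure ?\<nu> ((\<lambda>x. t *\<^sub>R x) -` A) = ennreal (t powr \<alpha>) * emeasure ?\<nu> A"
      using hom[OF _ A0, of "1 / t"] t A by (simp add: ext(3))
  next
    fix f :: "'a \<Rightarrow> real" and K
    assume f: "continuous_on UNIV f" "\<And>x. 0 \<le> f x" and K: "compact K" "0 \<notin> K"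
      and f0: "\<And>x. x \<notin> K \<Longrightarrow> f x = 0"
    have [measurable]: "f \<in> borel_measurable borel"
      by (rule borel_measurable_continuous_onI[OF f(1)])
    have "compact (f ` K)"
      by (intro compact_continuous_image continuous_on_subset[OF f(1)] K) auto
    from compact_imp_bounded[OF this, unfolded bounded_iff]
    obtain B where B: "\<forall>z\<in>f ` K. norm z \<le> B"
      by (rule exE)
    have fB: "f x \<le> \<bar>B\<bar>" for x
      using B f0[of x] by (cases "x \<in> K") force+
    have "((\<lambda>t. \<integral>\<^sup>+x. ennreal (f x) \<partial>normalized_law M X (\<lambda>t. measure M {\<omega> \<in> space M. N (X \<omega>) > t}) t)
        \<longlongrightarrow> (\<integral>\<^sup>+x. ennreal (f x) \<partial>\<mu>)) at_top"
      using vague[unfolded vague_conv_def, rule_format, of f] f K f0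
      by (auto intro: continuous_on_subset)
    moreover have "(\<integral>\<^sup>+x. ennreal (f x) \<partial>normalized_law M X (\<lambda>t. measure M {\<omega> \<in> space M. N (X \<omega>) > t}) t)
        = ennreal ((\<integral>x. f ((1 / t) *\<^sub>R x) \<partial>?L) / measure ?L {x. t < N x})" for t
    proof -
      have int: "integrable ?L (\<lambda>x. f ((1 / t) *\<^sub>R x))"
        by (rule L.integrable_const_bound[where B = "\<bar>B\<bar>"]) (use f fB in auto)
      have "(\<integral>\<^sup>+\<omega>. ennreal (f ((1 / t) *\<^sub>R X \<omega>)) \<partial>M) = (\<integral>\<^sup>+x. ennreal (f ((1 / t) *\<^sub>R x)) \<partial>?L)"
        by (rule nn_integral_distr[symmetric]) auto
      also have "\<dots> = ennreal (\<integral>x. f ((1 / t) *\<^sub>R x) \<partial>?L)"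
        using f(2) by (intro nn_integral_eq_integral int) auto
      finally have "(\<integral>\<^sup>+\<omega>. ennreal (f ((1 / t) *\<^sub>R X \<omega>)) \<partial>M) = ennreal (\<integral>x. f ((1 / t) *\<^sub>R x) \<partial>?L)" .
      moreover have "measure ?L {x. t < N x} = measure M {\<omega> \<in> space M. N (X \<omega>) > t}"
        by (subst measure_distr) (auto intro!: arg_cong[where f = "measure M"])
      moreover have "f 0 = 0"
        using f0 K by auto
      ultimately show ?thesis
        using f(2) by (subst nn_integral_normalized_law)
          (simp_all add: ennreal_mult'[symmetric] Bochner_Integration.integral_nonneg)
    qed
    moreover have "(\<integral>\<^sup>+x. ennreal (f x) \<partial>\<mu>) = ennreal (\<integral>x. f x \<partial>?\<nu>)"
    proof -
      have "integrable ?\<nu> f"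
      proof (rule Bochner_Integration.integrable_bound)
        show "integrable ?\<nu> (\<lambda>x. \<bar>B\<bar> * indicator K x)"
          using \<nu>_compact[OF K] K(1) by (auto intro!: integrable_mult_right simp: integrable_real_indicator borel_compact)
        show "AE x in ?\<nu>. norm (f x) \<le> norm (\<bar>B\<bar> * indicator K x)"
          using f(2) fB f0 by (intro AE_I2) (auto simp: indicator_def)
      qed simp
      then have "(\<integral>\<^sup>+x. ennreal (f x) \<partial>?\<nu>) = ennreal (\<integral>x. f x \<partial>?\<nu>)"
        using f(2) by (intro nn_integral_eq_integral) auto
      then show ?thesis
        by (subst (asm) nn_integral_distr[OF ext(2)]) auto
    qed
    ultimately show "((\<lambda>t. (\<integral>x. f ((1 / t) *\<^sub>R x) \<partial>?L) / measure ?L {x. t < N x}) \<longlongrightarrow> (\<integral>x. f x \<partial>?\<nu>)) at_top"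
      using f(2) by (simp add: Bochner_Integration.integral_nonneg)
  qed
qed

lemma joint_law:
  fixes X :: "'w \<Rightarrow> 'a::euclidean_space" and Y :: "'w \<Rightarrow> 'b::euclidean_space"
  assumes M: "prob_space M" and indep: "indep_vectors M X Y"
  shows "distr M borel X \<Otimes>\<^sub>M distr M borel Y = distr M borel (\<lambda>\<omega>. (X \<omega>, Y \<omega>))"
proof -
  interpret M: prob_space M by fact
  have [measurable]: "X \<in> borel_measurable M" "Y \<in> borel_measurable M"
    and ind: "M.indep_set {X -` A \<inter> space M | A. A \<in> sets borel} {Y -` B \<inter> space M | B. B \<in> sets borel}"
    using indep unfolding indep_vectors_def by auto
  interpret LX: prob_space "distr M borel X" by (rule M.prob_space_distr) simp
  interpret LY: prob_space "distr M borel Y" by (rule M.prob_space_distr) simp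
  show ?thesis
  proof (rule pair_measure_eqI)
    show "sigma_finite_measure (distr M borel X)" "sigma_finite_measure (distr M borel Y)" ..
    show "sets (distr M borel X \<Otimes>\<^sub>M distr M borel Y) = sets (distr M borel (\<lambda>\<omega>. (X \<omega>, Y \<omega>)))"
      unfolding sets_distr borel_prod[symmetric] by (rule sets_pair_measure_cong) auto
    fix A B assume "A \<in> sets (distr M borel X)" "B \<in> sets (distr M borel Y)"
    then have AB [measurable]: "A \<in> sets borel" "B \<in> sets borel" by auto
    have AB': "A \<times> B \<in> sets borel"
      unfolding borel_prod[symmetric] using AB by simp
    have "(\<lambda>\<omega>. (X \<omega>, Y \<omega>)) -` (A \<times> B) \<inter> space M = (X -` A \<inter> space M) \<inter> (Y -` B \<inter> space M)"
      by auto
    moreover have "M.prob ((X -` A \<inter> space M) \<inter> (Y -` B \<inter> space M)) = M.prob (X -` A \<inter> space M) * M.prob (Y -` B \<inter> space M)"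
      using AB by (intro M.indep_setD[OF ind]) auto
    ultimately show "emeasure (distr M borel X) A * emeasure (distr M borel Y) B
        = emeasure (distr M borel (\<lambda>\<omega>. (X \<omega>, Y \<omega>))) (A \<times> B)"
      using AB AB' by (simp add: emeasure_distr M.emeasure_eq_measure ennreal_mult)
  qed
qed

text \<open>The conditional expectation given \<open>N Y > u\<close> is unfolded to restriction and division, the form in which it
  can be combined with integrals over the law of \<open>Y\<close>.\<close>

lemma spectral_vector_limit:
  fixes Y :: "'w \<Rightarrow> 'b::euclidean_space"
  assumes N: "is_norm N" and M: "prob_space M" and [measurable]: "Y \<in> borel_measurable M"
    and spec: "spectral_vector M N Y \<alpha> P \<Theta>"
    and pos: "\<And>u. 0 < measure M {\<omega> \<in> space M. N (Y \<omega>) > u}"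
    and k: "continuous_on UNIV k" "bounded (range k)"
  shows "((\<lambda>u. (\<integral>y. k ((1 / N y) *\<^sub>R y) * indicator {y. u < N y} y \<partial>distr M borel Y)
      / measure (distr M borel Y) {y. u < N y}) \<longlongrightarrow> (\<integral>y. k y \<partial>distr P borel \<Theta>)) at_top"
proof -
  interpret M: prob_space M by fact
  have [measurable]: "N \<in> borel_measurable borel"
    by (rule is_norm_borel_measurable[OF N])
  have km [measurable]: "k \<in> borel_measurable borel"
    by (rule borel_measurable_continuous_onI[OF k(1)])
  interpret P: prob_space P
    using spec by (simp add: spectral_vector_def)
  have [measurable]: "\<Theta> \<in> borel_measurable P"
    using spec by (simp add: spectral_vector_def)
  interpret Q: prob_space "distr P borel \<Theta>" by (rule P.prob_space_distr) simp
  obtain \<zeta> :: "real measure" where \<zeta>: "prob_space \<zeta>" "sets \<zeta> = sets borel"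
    and lim: "\<And>f :: 'b \<times> real \<Rightarrow> real. continuous_on UNIV f \<Longrightarrow> bounded (range f) \<Longrightarrow>
           ((\<lambda>x. \<integral>\<omega>. f ((1 / N (Y \<omega>)) *\<^sub>R Y \<omega>, N (Y \<omega>) / x)
                    \<partial>uniform_measure M {\<omega> \<in> space M. N (Y \<omega>) > x})
              \<longlongrightarrow> (\<integral>p. f p \<partial>(distr P borel \<Theta> \<Otimes>\<^sub>M \<zeta>))) at_top"
    using spec unfolding spectral_vector_def by blast
  interpret \<zeta>: prob_space \<zeta> by fact
  interpret Q\<zeta>: pair_prob_space "distr P borel \<Theta>" \<zeta> ..
  obtain B where B: "\<And>y. \<bar>k y\<bar> \<le> B"
    using k(2) by (auto simp: bounded_iff)
  have "((\<lambda>x. \<integral>\<omega>. k ((1 / N (Y \<omega>)) *\<^sub>R Y \<omega>) \<partial>uniform_measure M {\<omega> \<in> space M. N (Y \<omega>) > x})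
              \<longlongrightarrow> (\<integral>p. k (fst p) \<partial>(distr P borel \<Theta> \<Otimes>\<^sub>M \<zeta>))) at_top"
  proof -
    have "continuous_on UNIV (\<lambda>p :: 'b \<times> real. k (fst p))"
      by (intro continuous_on_compose2[OF k(1)] continuous_intros) auto
    moreover have "bounded (range (\<lambda>p :: 'b \<times> real. k (fst p)))"
      by (rule bounded_subset[OF k(2)]) auto
    ultimately show ?thesis
      using lim[of "\<lambda>p. k (fst p)"] by simp
  qed
  moreover have "(\<integral>p. k (fst p) \<partial>(distr P borel \<Theta> \<Otimes>\<^sub>M \<zeta>)) = (\<integral>y. k y \<partial>distr P borel \<Theta>)"
  proof -
    have "integrable (distr P borel \<Theta> \<Otimes>\<^sub>M \<zeta>) (\<lambda>p. k (fst p))"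
      by (rule Q\<zeta>.P.integrable_const_bound[where B = B]) (use B in auto)
    then have "integrable (distr P borel \<Theta> \<Otimes>\<^sub>M \<zeta>) (\<lambda>(y, z). k y)"
      by (simp add: case_prod_unfold)
    from Q\<zeta>.integral_fst[OF this] show ?thesis
      by (simp add: case_prod_unfold \<zeta>.prob_space)
  qed
  moreover have "(\<integral>\<omega>. k ((1 / N (Y \<omega>)) *\<^sub>R Y \<omega>) \<partial>uniform_measure M {\<omega> \<in> space M. N (Y \<omega>) > u})
      = (\<integral>y. k ((1 / N y) *\<^sub>R y) * indicator {y. u < N y} y \<partial>distr M borel Y) / measure (distr M borel Y) {y. u < N y}" for u
  proof -
    let ?E = "{\<omega> \<in> space M. N (Y \<omega>) > u}"
    have E: "?E \<in> sets M" by measurable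
    have eq: "uniform_measure M ?E = density M (\<lambda>\<omega>. ennreal (indicator ?E \<omega> / measure M ?E))"
      unfolding uniform_measure_def using pos[of u]
      by (intro density_cong) (auto simp: M.emeasure_eq_measure indicator_def divide_ennreal[symmetric])
    have "(\<integral>\<omega>. k ((1 / N (Y \<omega>)) *\<^sub>R Y \<omega>) \<partial>uniform_measure M ?E)
        = (\<integral>\<omega>. (indicator ?E \<omega> / measure M ?E) *\<^sub>R k ((1 / N (Y \<omega>)) *\<^sub>R Y \<omega>) \<partial>M)"
      unfolding eq by (rule integral_density) (use E in auto)
    also have "\<dots> = (\<integral>\<omega>. k ((1 / N (Y \<omega>)) *\<^sub>R Y \<omega>) * indicator {y. u < N y} (Y \<omega>) / measure M ?E \<partial>M)"
      by (intro Bochner_Integration.integral_cong) (auto simp: indicator_def)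
    also have "\<dots> = (\<integral>\<omega>. k ((1 / N (Y \<omega>)) *\<^sub>R Y \<omega>) * indicator {y. u < N y} (Y \<omega>) \<partial>M) / measure M ?E"
      by simp
    also have "(\<integral>\<omega>. k ((1 / N (Y \<omega>)) *\<^sub>R Y \<omega>) * indicator {y. u < N y} (Y \<omega>) \<partial>M)
        = (\<integral>y. k ((1 / N y) *\<^sub>R y) * indicator {y. u < N y} y \<partial>distr M borel Y)"
      by (rule integral_distr[symmetric]) measurable
    also have "measure M ?E = measure (distr M borel Y) {y. u < N y}"
      by (subst measure_distr) (auto intro!: arg_cong[where f = "measure M"])
    finally show ?thesis .
  qed
  ultimately show ?thesis by simp
qed

text \<open>A test function on the punctured space extends continuously by zero, and its support stays away from
  the origin in terms of the given norm.\<close>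

lemma vague_test_function:
  fixes f :: "'c::euclidean_space \<Rightarrow> real"
  assumes N: "is_norm N" and f: "continuous_on (- {0}) f" "\<And>x. x \<in> - {0} \<Longrightarrow> 0 \<le> f x"
    and K: "compact K" "K \<subseteq> - {0}" "\<And>x. x \<in> - {0} - K \<Longrightarrow> f x = 0"
  obtains f0 B d where "continuous_on UNIV f0" "\<And>x. 0 \<le> f0 x" "\<And>x. f0 x \<le> B" "0 < d"
    "\<And>z. N z \<le> d \<Longrightarrow> f0 z = 0" "\<And>x. x \<noteq> 0 \<Longrightarrow> f0 x = f x"
proof -
  define f0 where "f0 x = (if x = 0 then 0 else f x)" for x
  have z: "f0 x = 0" if "x \<notin> K" for x
    using that K(3) by (auto simp: f0_def)
  have "continuous_on (- {0} \<union> - K) f0"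
  proof (rule continuous_on_open_Un)
    show "open (- {0::'c})" "open (- K)"
      using K(1) by (auto intro: compact_imp_closed)
    show "continuous_on (- {0}) f0"
      using f(1) by (rule continuous_on_eq) (auto simp: f0_def)
    show "continuous_on (- K) f0"
      by (rule continuous_on_eq[OF continuous_on_const[of _ 0]]) (use z in auto)
  qed
  moreover have "- {0} \<union> - K = UNIV"
    using K(2) by auto
  ultimately have cont: "continuous_on UNIV f0"
    by simp
  have "compact (f0 ` K)"
    by (intro compact_continuous_image continuous_on_subset[OF cont] K) auto
  from compact_imp_bounded[OF this, unfolded bounded_iff]
  obtain B where B: "\<forall>z\<in>f0 ` K. norm z \<le> B"
    by (rule exE)
  have f0B: "f0 x \<le> \<bar>B\<bar>" for x
    using B z[of x] by (cases "x \<in> K") force+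
  obtain d where d: "0 < d" "\<And>x. x \<in> K \<Longrightarrow> d < N x"
  proof (cases "K = {}")
    case False
    obtain z where z: "z \<in> K" "\<And>x. x \<in> K \<Longrightarrow> N z \<le> N x"
      using continuous_attains_inf[OF K(1) False is_norm_continuous[OF N]] by auto
    have "0 < N z"
      using z(1) K(2) is_norm_eq_0_iff[OF N, of z] is_norm_nonneg[OF N, of z] by (auto simp: less_le)
    then show thesis
      using z(2) by (intro that[of "N z / 2"]) force+
  qed (auto intro: that[of 1])
  show thesis
  proof (rule that[OF cont _ f0B d(1)])
    show "0 \<le> f0 x" for x
      using f(2)[of x] by (auto simp: f0_def)
    show "f0 x = 0" if "N x \<le> d" for x
      using that d(2)[of x] by (intro z) auto
    show "f0 x = f x" if "x \<noteq> 0" for x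
      using that by (simp add: f0_def)
  qed
qed

context product_map
begin

definition \<eta>\<^sub>0 :: "'c measure" where "\<eta>\<^sub>0 = restrict_space \<eta> (- {0})"

lemma sets_\<eta>\<^sub>0: "sets \<eta>\<^sub>0 = sets punctured_borel"
  unfolding \<eta>\<^sub>0_def by (rule sets_restrict_space_cong) simp

lemma space_\<eta>\<^sub>0: "space \<eta>\<^sub>0 = - {0}"
  using sets_eq_imp_space_eq[OF sets_\<eta>] by (simp add: \<eta>\<^sub>0_def space_restrict_space)

lemma in_sets_\<eta>\<^sub>0: "A \<in> sets \<eta>\<^sub>0 \<longleftrightarrow> A \<in> sets borel \<and> A \<subseteq> - {0}"
  unfolding sets_\<eta>\<^sub>0 by (subst sets_restrict_space_iff) auto

lemma emeasure_\<eta>\<^sub>0: "A \<subseteq> - {0} \<Longrightarrow> emeasure \<eta>\<^sub>0 A = emeasure \<eta> A"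
  unfolding \<eta>\<^sub>0_def by (rule emeasure_restrict_space) auto

lemma radon_measure_scaled_\<eta>\<^sub>0: "c < \<infinity> \<Longrightarrow> radon_measure (scale_measure c \<eta>\<^sub>0)"
  unfolding radon_measure_def
proof (intro conjI allI impI)
  assume c: "c < \<infinity>"
  show "sets (scale_measure c \<eta>\<^sub>0) = sets punctured_borel"
    by (simp add: sets_\<eta>\<^sub>0)
  fix K :: "'c set" assume K: "compact K \<and> K \<subseteq> - {0}"
  have "emeasure \<eta>\<^sub>0 K < \<infinity>"
  proof (cases "K = {}")
    case False
    obtain z where z: "z \<in> K" "\<And>x. x \<in> K \<Longrightarrow> N\<^sub>Z z \<le> N\<^sub>Z x"
      using continuous_attains_inf[OF _ False is_norm_continuous[OF N_Z]] K by auto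
    have zpos: "0 < N\<^sub>Z z"
      using z(1) K is_norm_eq_0_iff[OF N_Z, of z] is_norm_nonneg[OF N_Z, of z] by (auto simp: less_le)
    then have "K \<subseteq> {x. N\<^sub>Z z / 2 < N\<^sub>Z x}"
      using z(2) by force
    then have "emeasure \<eta> K \<le> emeasure \<eta> {x. N\<^sub>Z z / 2 < N\<^sub>Z x}"
      by (intro emeasure_mono) auto
    also have "\<dots> < \<infinity>"
      using zpos by (intro \<eta>_tail_finite) simp
    finally show ?thesis
      using K by (simp add: emeasure_\<eta>\<^sub>0)
  qed simp
  then show "emeasure (scale_measure c \<eta>\<^sub>0) K < \<infinity>"
    using c by (simp add: ennreal_mult_less_top)
qed

lemma \<eta>\<^sub>0_homogeneous:
  assumes "0 < t" "A \<in> sets \<eta>\<^sub>0"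
  shows "emeasure \<eta>\<^sub>0 ((\<lambda>z. t *\<^sub>R z) ` A) = ennreal (t powr (- \<gamma>)) * emeasure \<eta>\<^sub>0 A"
proof -
  have A: "A \<in> sets borel" "A \<subseteq> - {0}"
    using assms(2) by (auto simp: in_sets_\<eta>\<^sub>0)
  have eq: "(\<lambda>z. t *\<^sub>R z) ` A = (\<lambda>z. (1 / t) *\<^sub>R z) -` A"
  proof (intro equalityI subsetI)
    fix z assume "z \<in> (\<lambda>z. (1 / t) *\<^sub>R z) -` A"
    then show "z \<in> (\<lambda>z. t *\<^sub>R z) ` A"
      using assms(1) by (intro image_eqI[of _ _ "(1 / t) *\<^sub>R z"]) auto
  qed (use assms(1) in auto)
  have "(\<lambda>z. (1 / t) *\<^sub>R z) -` A \<subseteq> - {0}"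
    using A(2) by auto
  moreover have "(1 / t) powr \<gamma> = t powr (- \<gamma>)"
    using assms(1) by (simp add: powr_divide powr_minus_divide)
  ultimately show ?thesis
    using \<eta>_homogeneous[of "1 / t" A] A assms(1) unfolding eq by (simp add: emeasure_\<eta>\<^sub>0)
qed

text \<open>Changing the normalization multiplies the limit by a constant. This covers the normalization by the
  tail of \<open>R S\<close> as well as the one by the tail of the norm of \<open>Z\<close>.\<close>

lemma vague_conv_normalized:
  fixes M :: "'w measure" and r :: "real \<Rightarrow> real"
  assumes XY [measurable]: "X \<in> borel_measurable M" "Y \<in> borel_measurable M"
    and law: "distr M borel (\<lambda>\<omega>. (X \<omega>, Y \<omega>)) = L"
    and r: "\<And>t. 0 \<le> r t" and c: "0 \<le> c" and ratio: "((\<lambda>t. h t / r t) \<longlongrightarrow> c) at_top"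
  shows "vague_conv (normalized_law M (\<lambda>\<omega>. \<psi> (X \<omega>, Y \<omega>)) r) (scale_measure (ennreal c) \<eta>\<^sub>0)"
  unfolding vague_conv_def
proof (intro allI impI)
  fix f :: "'c \<Rightarrow> real"
  assume "continuous_on (- {0}) f \<and> (\<forall>x\<in>- {0}. 0 \<le> f x) \<and>
        (\<exists>K. compact K \<and> K \<subseteq> - {0} \<and> (\<forall>x\<in>- {0} - K. f x = 0))"
  then obtain K where f: "continuous_on (- {0}) f" "\<And>x. x \<in> - {0} \<Longrightarrow> 0 \<le> f x"
    and K: "compact K" "K \<subseteq> - {0}" "\<And>x. x \<in> - {0} - K \<Longrightarrow> f x = 0"
    by blast
  obtain f0 B d where f0: "continuous_on UNIV f0" "\<And>x. 0 \<le> f0 x" "\<And>x. f0 x \<le> B" "0 < d"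
    "\<And>z. N\<^sub>Z z \<le> d \<Longrightarrow> f0 z = 0" "\<And>x. x \<noteq> 0 \<Longrightarrow> f0 x = f x"
    by (rule vague_test_function[OF N_Z f K]) blast+
  obtain l where l: "0 \<le> l" "((\<lambda>t. (\<integral>p. f0 ((1 / t) *\<^sub>R \<psi> p) \<partial>L) / h t) \<longlongrightarrow> l) at_top"
    "(\<integral>\<^sup>+z. ennreal (f0 z) \<partial>\<eta>) = ennreal l"
    by (rule map_limit[OF f0(1-5)]) blast+
  have f00: "f0 0 = 0"
    using f0(4,5) by (simp add: is_norm_zero[OF N_Z])
  have [measurable]: "f0 \<in> borel_measurable borel"
    by (rule borel_measurable_continuous_onI[OF f0(1)])
  have Zm: "(\<lambda>\<omega>. \<psi> (X \<omega>, Y \<omega>)) \<in> borel_measurable M"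
    by measurable
  have left: "(\<integral>\<^sup>+x. ennreal (f x) \<partial>normalized_law M (\<lambda>\<omega>. \<psi> (X \<omega>, Y \<omega>)) r t)
      = ennreal ((\<integral>p. f0 ((1 / t) *\<^sub>R \<psi> p) \<partial>L) / h t * (h t / r t))" for t
  proof -
    have "(\<integral>\<^sup>+x. ennreal (f x) \<partial>normalized_law M (\<lambda>\<omega>. \<psi> (X \<omega>, Y \<omega>)) r t)
        = (\<integral>\<^sup>+x. ennreal (f0 x) \<partial>normalized_law M (\<lambda>\<omega>. \<psi> (X \<omega>, Y \<omega>)) r t)"
      using f0(6) by (intro nn_integral_cong) (auto simp: normalized_law_def space_scale_measure space_restrict_space)
    also have "\<dots> = ennreal (1 / r t) * (\<integral>\<^sup>+\<omega>. ennreal (f0 ((1 / t) *\<^sub>R \<psi> (X \<omega>, Y \<omega>))) \<partial>M)"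
      using f00 by (intro nn_integral_normalized_law Zm) auto
    also have "(\<integral>\<^sup>+\<omega>. ennreal (f0 ((1 / t) *\<^sub>R \<psi> (X \<omega>, Y \<omega>))) \<partial>M)
        = (\<integral>\<^sup>+p. ennreal (f0 ((1 / t) *\<^sub>R \<psi> p)) \<partial>L)"
      unfolding law[symmetric] by (rule nn_integral_distr[symmetric]) auto
    also have "\<dots> = ennreal (\<integral>p. f0 ((1 / t) *\<^sub>R \<psi> p) \<partial>L)"
    proof (rule nn_integral_eq_integral)
      have "\<bar>f0 z\<bar> \<le> B" for z using f0(2,3)[of z] by simp
      then show "integrable L (\<lambda>p. f0 ((1 / t) *\<^sub>R \<psi> p))"
        by (intro integrable_L_bounded[where B = B]) auto
    qed (use f0(2) in auto)
    also have "ennreal (1 / r t) * \<dots> = ennreal ((\<integral>p. f0 ((1 / t) *\<^sub>R \<psi> p) \<partial>L) / r t)"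
      using r[of t] f0(2) by (simp add: ennreal_mult'[symmetric])
    finally show ?thesis
      using h_pos[of t] by simp
  qed
  have right: "(\<integral>\<^sup>+x. ennreal (f x) \<partial>scale_measure (ennreal c) \<eta>\<^sub>0) = ennreal (l * c)"
  proof -
    have "(\<integral>\<^sup>+x. ennreal (f x) \<partial>scale_measure (ennreal c) \<eta>\<^sub>0) = (\<integral>\<^sup>+x. ennreal (f0 x) \<partial>scale_measure (ennreal c) \<eta>\<^sub>0)"
      using f0(6) by (intro nn_integral_cong) (auto simp: space_scale_measure space_\<eta>\<^sub>0)
    also have "\<dots> = ennreal c * (\<integral>\<^sup>+x. ennreal (f0 x) \<partial>\<eta>\<^sub>0)"
      unfolding \<eta>\<^sub>0_def by (intro nn_integral_scale_measure measurable_restrict_space1) simp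
    also have "(\<integral>\<^sup>+x. ennreal (f0 x) \<partial>\<eta>\<^sub>0) = (\<integral>\<^sup>+x. ennreal (f0 x) * indicator (- {0}) x \<partial>\<eta>)"
      unfolding \<eta>\<^sub>0_def by (rule nn_integral_restrict_space) simp
    also have "\<dots> = (\<integral>\<^sup>+x. ennreal (f0 x) \<partial>\<eta>)"
      using f00 by (intro nn_integral_cong) (auto simp: indicator_def)
    finally show ?thesis
      using l(1,3) c by (simp add: ennreal_mult mult.commute)
  qed
  show "((\<lambda>t. \<integral>\<^sup>+x. ennreal (f x) \<partial>normalized_law M (\<lambda>\<omega>. \<psi> (X \<omega>, Y \<omega>)) r t)
      \<longlongrightarrow> (\<integral>\<^sup>+x. ennreal (f x) \<partial>scale_measure (ennreal c) \<eta>\<^sub>0)) at_top"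
    unfolding left right by (intro tendsto_ennrealI tendsto_mult l(2) ratio)
qed

lemma moment_weights:
  "ereal c\<^sub>X * enn2ereal (\<integral>\<^sup>+y. ennreal (Y.R y powr X.\<gamma>) \<partial>L\<^sub>Y) = ereal p\<^sub>X"
  "ereal c\<^sub>Y * enn2ereal (\<integral>\<^sup>+x. ennreal (X.R x powr Y.\<gamma>) \<partial>L\<^sub>X) = ereal p\<^sub>Y"
proof -
  have "enn2ereal (ennreal c\<^sub>X * (\<integral>\<^sup>+y. ennreal (Y.R y powr X.\<gamma>) \<partial>L\<^sub>Y)) = ereal p\<^sub>X"
    using p_X_nonneg unfolding p\<^sub>X_def
    by (subst weighted_nn_integral[OF c_X_nonneg integrable_moment_Y]) (auto simp: enn2ereal_ennreal)
  moreover have "enn2ereal (ennreal c\<^sub>Y * (\<integral>\<^sup>+x. ennreal (X.R x powr Y.\<gamma>) \<partial>L\<^sub>X)) = ereal p\<^sub>Y"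
    using p_Y_nonneg unfolding p\<^sub>Y_def
    by (subst weighted_nn_integral[OF c_Y_nonneg integrable_moment_X]) (auto simp: enn2ereal_ennreal)
  ultimately show
    "ereal c\<^sub>X * enn2ereal (\<integral>\<^sup>+y. ennreal (Y.R y powr X.\<gamma>) \<partial>L\<^sub>Y) = ereal p\<^sub>X"
    "ereal c\<^sub>Y * enn2ereal (\<integral>\<^sup>+x. ennreal (X.R x powr Y.\<gamma>) \<partial>L\<^sub>X) = ereal p\<^sub>Y"
    by (simp_all add: times_ennreal.rep_eq enn2ereal_ennreal c_X_nonneg c_Y_nonneg)
qed

text \<open>The coefficients of \<open>\<eta>\<close> are real numbers; the products with possibly infinite moments agree with them because
  \<open>0 \<cdot> \<infinity> = 0\<close> also holds for extended reals.\<close>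

lemma emeasure_\<eta>_ereal:
  assumes A: "A \<in> sets borel"
  shows "enn2ereal (emeasure \<eta> A) =
      (1 - ereal c\<^sub>X * enn2ereal (\<integral>\<^sup>+y. ennreal (Y.R y powr X.\<gamma>) \<partial>L\<^sub>Y)
         - ereal c\<^sub>Y * enn2ereal (\<integral>\<^sup>+x. ennreal (X.R x powr Y.\<gamma>) \<partial>L\<^sub>X))
        * enn2ereal (\<integral>\<^sup>+y. emeasure \<nu>\<^sub>X {x. \<psi> (x, y) \<in> A} \<partial>Q)
      + ereal c\<^sub>X * enn2ereal (\<integral>\<^sup>+y. emeasure \<nu>\<^sub>X {x. \<psi> (x, y) \<in> A} \<partial>L\<^sub>Y)
      + ereal c\<^sub>Y * enn2ereal (\<integral>\<^sup>+x. emeasure \<nu>\<^sub>Y {y. \<psi> (x, y) \<in> A} \<partial>L\<^sub>X)"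
proof -
  have "1 - ereal p\<^sub>X - ereal p\<^sub>Y = ereal c\<^sub>0"
    by (simp add: c\<^sub>0_def one_ereal_def)
  then show ?thesis
    unfolding moment_weights emeasure_\<eta>[OF A]
    by (simp add: plus_ennreal.rep_eq times_ennreal.rep_eq enn2ereal_ennreal c_0_nonneg c_X_nonneg c_Y_nonneg)
qed

end

theorem theorem2p1:
  fixes M :: "'w measure" and P :: "'p measure"
    and X :: "'w \<Rightarrow> 'a::euclidean_space" and Y :: "'w \<Rightarrow> 'b::euclidean_space"
    and \<Theta>Y :: "'p \<Rightarrow> 'b"
    and NX :: "'a \<Rightarrow> real" and NY :: "'b \<Rightarrow> real" and NZ :: "'c::euclidean_space \<Rightarrow> real"
    and \<mu>X :: "'a measure" and \<mu>Y :: "'b measure"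
    and \<psi> :: "'a \<times> 'b \<Rightarrow> 'c"
    and \<alpha>X \<alpha>Y aX aY cX cY :: real
  assumes "is_norm NX" and "is_norm NY" and "is_norm NZ"
    and "prob_space M"
    and "indep_vectors M X Y"
    and "regularly_varying M NX X \<alpha>X \<mu>X"
    and "regularly_varying M NY Y \<alpha>Y \<mu>Y"
    and "spectral_vector M NY Y \<alpha>Y P \<Theta>Y"
    and "0 < aX" and "0 < aY"
    and "continuous_on UNIV \<psi>"
    and "\<And>s t x y. 0 \<le> s \<Longrightarrow> 0 \<le> t \<Longrightarrow>
           \<psi> (s *\<^sub>R x, t *\<^sub>R y) = (s powr aX * t powr aY) *\<^sub>R \<psi> (x, y)"
    and "((\<lambda>t. measure M {\<omega> \<in> space M. NX (X \<omega>) powr aX > t} /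
               measure M {\<omega> \<in> space M. NX (X \<omega>) powr aX * NY (Y \<omega>) powr aY > t})
          \<longlongrightarrow> cX) at_top"
    and "((\<lambda>t. measure M {\<omega> \<in> space M. NY (Y \<omega>) powr aY > t} /
               measure M {\<omega> \<in> space M. NX (X \<omega>) powr aX * NY (Y \<omega>) powr aY > t})
          \<longlongrightarrow> cY) at_top"
  shows "\<exists>\<eta> :: 'c measure.
    radon_measure \<eta> \<and>
    (\<forall>A\<in>sets \<eta>. enn2ereal (emeasure \<eta> A) =
        (1 - ereal cX * enn2ereal (\<integral>\<^sup>+\<omega>. ennreal (NY (Y \<omega>) powr (\<alpha>X * aY / aX)) \<partial>M)
           - ereal cY * enn2ereal (\<integral>\<^sup>+\<omega>. ennreal (NX (X \<omega>) powr (\<alpha>Y * aX / aY)) \<partial>M))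
          * enn2ereal (\<integral>\<^sup>+\<omega>. emeasure \<mu>X {x \<in> space \<mu>X. \<psi> (x, \<Theta>Y \<omega>) \<in> A} \<partial>P)
        + ereal cX * enn2ereal (\<integral>\<^sup>+\<omega>. emeasure \<mu>X {x \<in> space \<mu>X. \<psi> (x, Y \<omega>) \<in> A} \<partial>M)
        + ereal cY * enn2ereal (\<integral>\<^sup>+\<omega>. emeasure \<mu>Y {y \<in> space \<mu>Y. \<psi> (X \<omega>, y) \<in> A} \<partial>M)) \<and>
    vague_conv
      (normalized_law M (\<lambda>\<omega>. \<psi> (X \<omega>, Y \<omega>))
        (\<lambda>t. measure M {\<omega> \<in> space M. NX (X \<omega>) powr aX * NY (Y \<omega>) powr aY > t})) \<eta> \<and>
    (emeasure \<eta> (space \<eta>) \<noteq> 0 \<longrightarrow>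
       regularly_varying M NZ (\<lambda>\<omega>. \<psi> (X \<omega>, Y \<omega>)) (min (\<alpha>X / aX) (\<alpha>Y / aY))
         (scale_measure (1 / emeasure \<eta> {z \<in> space \<eta>. NZ z > 1}) \<eta>))"
proof -
  note N = assms(1-3) and M = assms(4) and indep = assms(5) and rv = assms(6,7)
    and spec = assms(8) and a = assms(9,10) and \<psi>_cont = assms(11) and \<psi>_hom = assms(12)
    and cX = assms(13) and cY = assms(14)
  interpret M: prob_space M by (rule M)
  have XY [measurable]: "X \<in> borel_measurable M" "Y \<in> borel_measurable M"
    using indep by (auto simp: indep_vectors_def)
  have P: "prob_space P" and \<Theta> [measurable]: "\<Theta>Y \<in> borel_measurable P" and \<Theta>1: "AE \<omega> in P. NY (\<Theta>Y \<omega>) = 1"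
    using spec by (auto simp: spectral_vector_def)
  have [measurable]: "NX \<in> borel_measurable borel" "NY \<in> borel_measurable borel" "NZ \<in> borel_measurable borel"
    using N by (auto intro: is_norm_borel_measurable)
  let ?LX = "distr M borel X" and ?LY = "distr M borel Y"
  let ?\<nu>X = "distr \<mu>X borel (\<lambda>x. x)" and ?\<nu>Y = "distr \<mu>Y borel (\<lambda>x. x)"
  let ?Q = "distr P borel \<Theta>Y"
  interpret X: regular_tail ?LX NX \<alpha>X aX ?\<nu>X
    by (rule regular_tail_if_regularly_varying[OF N(1) M rv(1) a(1)])
  interpret Y: regular_tail ?LY NY \<alpha>Y aY ?\<nu>Y
    by (rule regular_tail_if_regularly_varying[OF N(2) M rv(2) a(2)])
  have law: "distr M borel (\<lambda>\<omega>. (X \<omega>, Y \<omega>)) = ?LX \<Otimes>\<^sub>M ?LY"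
    by (rule joint_law[OF M indep, symmetric])
  have product_sets: "{p. t < X.R (fst p) * Y.R (snd p)} \<in> sets (borel :: ('a \<times> 'b) measure)" for t
    by (intro borel_open open_Collect_less continuous_intros)
  have h_eq: "measure (?LX \<Otimes>\<^sub>M ?LY) {p. t < X.R (fst p) * Y.R (snd p)}
      = measure M {\<omega> \<in> space M. NX (X \<omega>) powr aX * NY (Y \<omega>) powr aY > t}" for t
  proof -
    have eq: "(\<lambda>\<omega>. (X \<omega>, Y \<omega>)) -` {p. t < X.R (fst p) * Y.R (snd p)} \<inter> space M
        = {\<omega> \<in> space M. NX (X \<omega>) powr aX * NY (Y \<omega>) powr aY > t}"
      by (auto simp: X.R_def Y.R_def)
    have "(\<lambda>\<omega>. (X \<omega>, Y \<omega>)) \<in> borel_measurable M"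
      by measurable
    from measure_distr[OF this product_sets[of t]] show ?thesis
      unfolding law eq .
  qed
  have GX_eq: "X.G t = measure M {\<omega> \<in> space M. NX (X \<omega>) powr aX > t}" for t
    unfolding X.G_def by (subst measure_distr) (auto simp: X.R_def intro!: arg_cong[where f = "measure M"])
  have GY_eq: "Y.G t = measure M {\<omega> \<in> space M. NY (Y \<omega>) powr aY > t}" for t
    unfolding Y.G_def by (subst measure_distr) (auto simp: Y.R_def intro!: arg_cong[where f = "measure M"])
  interpret product_map ?LX NX \<alpha>X aX ?\<nu>X ?LY NY \<alpha>Y aY ?\<nu>Y ?Q cX cY NZ \<psi>
  proof (intro product_map.intro product_tail.intro product_map_axioms.intro product_tail_axioms.intro
      X.regular_tail_axioms Y.regular_tail_axioms)
    show "prob_space ?Q"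
      by (rule prob_space.prob_space_distr[OF P \<Theta>])
    show "AE y in ?Q. NY y = 1"
      using \<Theta>1 by (subst AE_distr_iff) auto
    show "((\<lambda>t. X.G t / measure (?LX \<Otimes>\<^sub>M ?LY) {p. t < X.R (fst p) * Y.R (snd p)}) \<longlongrightarrow> cX) at_top"
      using cX by (simp only: h_eq GX_eq)
    show "((\<lambda>t. Y.G t / measure (?LX \<Otimes>\<^sub>M ?LY) {p. t < X.R (fst p) * Y.R (snd p)}) \<longlongrightarrow> cY) at_top"
      using cY by (simp only: h_eq GY_eq)
    show "\<psi> (X.dil s x, Y.dil t y) = (s * t) *\<^sub>R \<psi> (x, y)" if "0 \<le> s" "0 \<le> t" for s t x y
      using \<psi>_hom[of "s powr (1 / aX)" "t powr (1 / aY)" x y] a that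
      by (simp add: X.dil_def Y.dil_def powr_powr)
  next
    fix k :: "'b \<Rightarrow> real" assume k: "continuous_on UNIV k" "bounded (range k)"
    have pos: "0 < measure M {\<omega> \<in> space M. NY (Y \<omega>) > u}" for u
    proof -
      have "Y.T u = measure M {\<omega> \<in> space M. NY (Y \<omega>) > u}"
        unfolding Y.T_def by (subst measure_distr) (auto intro!: arg_cong[where f = "measure M"])
      then show ?thesis using Y.T_pos[of u] by simp
    qed
    note filterlim_compose[OF spectral_vector_limit[OF N(2) M XY(2) spec pos k] Y.filterlim_root]
    moreover have "\<forall>\<^sub>F u in at_top. (\<integral>y. k ((1 / NY y) *\<^sub>R y) * indicator {y. u powr (1 / aY) < NY y} y \<partial>?LY)
        / measure ?LY {y. u powr (1 / aY) < NY y}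
      = (\<integral>y. k ((1 / NY y) *\<^sub>R y) * indicator {y. u < Y.R y} y \<partial>?LY) / Y.G u"
      using eventually_ge_at_top[of 0] by eventually_elim (simp add: Y.G_def Y.less_R_iff)
    ultimately show "((\<lambda>u. (\<integral>y. k ((1 / NY y) *\<^sub>R y) * indicator {y. u < Y.R y} y \<partial>?LY) / Y.G u)
        \<longlongrightarrow> (\<integral>y. k y \<partial>?Q)) at_top"
      by (rule Lim_transform_eventually)
  qed (use N \<psi>_cont in auto)
  have h: "h t = measure M {\<omega> \<in> space M. NX (X \<omega>) powr aX * NY (Y \<omega>) powr aY > t}" for t
    unfolding h_def by (rule h_eq)
  have \<gamma>_eq: "\<gamma> = min (\<alpha>X / aX) (\<alpha>Y / aY)"
    by (simp add: \<gamma>_def X.\<gamma>_def Y.\<gamma>_def)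
  have sets_\<mu>: "sets \<mu>X = sets punctured_borel" "sets \<mu>Y = sets punctured_borel"
    using rv by (auto simp: regularly_varying_def radon_measure_def)
  note extX = radon_measure_extension[OF sets_\<mu>(1)] and extY = radon_measure_extension[OF sets_\<mu>(2)]
  have tail_Z: "measure (?LX \<Otimes>\<^sub>M ?LY) {p. t < NZ (\<psi> p)} = measure M {\<omega> \<in> space M. NZ (\<psi> (X \<omega>, Y \<omega>)) > t}" for t
    unfolding law[symmetric] by (subst measure_distr) (auto intro!: arg_cong[where f = "measure M"])
  have Zm: "(\<lambda>\<omega>. \<psi> (X \<omega>, Y \<omega>)) \<in> borel_measurable M"
    by measurable
  show ?thesis
  proof (intro exI conjI ballI impI)
    show "radon_measure \<eta>\<^sub>0"
      using radon_measure_scaled_\<eta>\<^sub>0[of 1] by simp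
    have "((\<lambda>t. h t / h t) \<longlongrightarrow> 1) at_top"
      using h_pos by (simp add: less_imp_neq[THEN not_sym])
    from vague_conv_normalized[OF XY law h_nonneg _ this]
    show "vague_conv (normalized_law M (\<lambda>\<omega>. \<psi> (X \<omega>, Y \<omega>))
        (\<lambda>t. measure M {\<omega> \<in> space M. NX (X \<omega>) powr aX * NY (Y \<omega>) powr aY > t})) \<eta>\<^sub>0"
      by (simp add: h[abs_def])
  next
    fix A assume "A \<in> sets \<eta>\<^sub>0"
    then have A: "A \<in> sets borel" "A \<subseteq> - {0}"
      by (simp_all add: in_sets_\<eta>\<^sub>0)
    have \<psi>0: "\<psi> (0, y) = 0" "\<psi> (x, 0) = 0" for x y
      using \<psi>_hom[of 0 1 0 y] \<psi>_hom[of 1 0 x 0] a by auto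
    have secX: "emeasure ?\<nu>X {x. \<psi> (x, y) \<in> A} = emeasure \<mu>X {x \<in> space \<mu>X. \<psi> (x, y) \<in> A}" for y
      using section_sets(1)[OF A(1), of y]
      by (subst extX(3)) (auto simp: extX(1) intro!: arg_cong[where f = "emeasure \<mu>X"])
    have secY: "emeasure ?\<nu>Y {y. \<psi> (x, y) \<in> A} = emeasure \<mu>Y {y \<in> space \<mu>Y. \<psi> (x, y) \<in> A}" for x
      using section_sets(2)[OF A(1), of x]
      by (subst extY(3)) (auto simp: extY(1) intro!: arg_cong[where f = "emeasure \<mu>Y"])
    have "(\<integral>\<^sup>+y. ennreal (Y.R y powr X.\<gamma>) \<partial>?LY) = (\<integral>\<^sup>+\<omega>. ennreal (NY (Y \<omega>) powr (\<alpha>X * aY / aX)) \<partial>M)"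
      by (subst nn_integral_distr) (auto simp: Y.R_def X.\<gamma>_def powr_powr mult.commute)
    moreover have "(\<integral>\<^sup>+x. ennreal (X.R x powr Y.\<gamma>) \<partial>?LX) = (\<integral>\<^sup>+\<omega>. ennreal (NX (X \<omega>) powr (\<alpha>Y * aX / aY)) \<partial>M)"
      by (subst nn_integral_distr) (auto simp: X.R_def Y.\<gamma>_def powr_powr mult.commute)
    moreover have "(\<integral>\<^sup>+y. emeasure ?\<nu>X {x. \<psi> (x, y) \<in> A} \<partial>?Q) = (\<integral>\<^sup>+\<omega>. emeasure \<mu>X {x \<in> space \<mu>X. \<psi> (x, \<Theta>Y \<omega>) \<in> A} \<partial>P)"
      using section_measurable(1)[OF A(1)] by (subst nn_integral_distr) (auto simp: secX)
    moreover have "(\<integral>\<^sup>+y. emeasure ?\<nu>X {x. \<psi> (x, y) \<in> A} \<partial>?LY) = (\<integral>\<^sup>+\<omega>. emeasure \<mu>X {x \<in> space \<mu>X. \<psi> (x, Y \<omega>) \<in> A} \<partial>M)"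
      using section_measurable(1)[OF A(1)] by (subst nn_integral_distr) (auto simp: secX)
    moreover have "(\<integral>\<^sup>+x. emeasure ?\<nu>Y {y. \<psi> (x, y) \<in> A} \<partial>?LX) = (\<integral>\<^sup>+\<omega>. emeasure \<mu>Y {y \<in> space \<mu>Y. \<psi> (X \<omega>, y) \<in> A} \<partial>M)"
      using section_measurable(2)[OF A(1)] by (subst nn_integral_distr) (auto simp: secY)
    ultimately show "enn2ereal (emeasure \<eta>\<^sub>0 A) =
        (1 - ereal cX * enn2ereal (\<integral>\<^sup>+\<omega>. ennreal (NY (Y \<omega>) powr (\<alpha>X * aY / aX)) \<partial>M)
           - ereal cY * enn2ereal (\<integral>\<^sup>+\<omega>. ennreal (NX (X \<omega>) powr (\<alpha>Y * aX / aY)) \<partial>M))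
          * enn2ereal (\<integral>\<^sup>+\<omega>. emeasure \<mu>X {x \<in> space \<mu>X. \<psi> (x, \<Theta>Y \<omega>) \<in> A} \<partial>P)
        + ereal cX * enn2ereal (\<integral>\<^sup>+\<omega>. emeasure \<mu>X {x \<in> space \<mu>X. \<psi> (x, Y \<omega>) \<in> A} \<partial>M)
        + ereal cY * enn2ereal (\<integral>\<^sup>+\<omega>. emeasure \<mu>Y {y \<in> space \<mu>Y. \<psi> (X \<omega>, y) \<in> A} \<partial>M)"
      using emeasure_\<eta>_ereal[OF A(1)] by (simp only: emeasure_\<eta>\<^sub>0[OF A(2)])
  next
    assume nonnull: "emeasure \<eta>\<^sub>0 (space \<eta>\<^sub>0) \<noteq> 0"
    then have m: "0 < m"
      by (intro m_pos) (simp add: space_\<eta>\<^sub>0 emeasure_\<eta>\<^sub>0)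
    have "{z \<in> space \<eta>\<^sub>0. NZ z > 1} = {z. 1 < NZ z}"
      by (auto simp: space_\<eta>\<^sub>0 is_norm_zero[OF N_Z])
    moreover have "{z. 1 < NZ z} \<subseteq> - {0}"
      by (auto simp: is_norm_zero[OF N_Z])
    ultimately have scale: "1 / emeasure \<eta>\<^sub>0 {z \<in> space \<eta>\<^sub>0. NZ z > 1} = ennreal (1 / m)"
      using m by (simp add: emeasure_\<eta>\<^sub>0 emeasure_\<eta>_1 divide_ennreal[symmetric])
    let ?S = "scale_measure (ennreal (1 / m)) \<eta>\<^sub>0"
    have "((\<lambda>t. inverse (measure (?LX \<Otimes>\<^sub>M ?LY) {p. t < NZ (\<psi> p)} / h t)) \<longlongrightarrow> inverse m) at_top"
      using m by (intro tendsto_inverse norm_tail_limit) simp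
    then have "((\<lambda>t. h t / measure M {\<omega> \<in> space M. NZ (\<psi> (X \<omega>, Y \<omega>)) > t}) \<longlongrightarrow> 1 / m) at_top"
      by (simp add: tail_Z inverse_eq_divide)
    then have vague: "vague_conv (normalized_law M (\<lambda>\<omega>. \<psi> (X \<omega>, Y \<omega>))
        (\<lambda>t. measure M {\<omega> \<in> space M. NZ (\<psi> (X \<omega>, Y \<omega>)) > t})) ?S"
      using m by (intro vague_conv_normalized[OF XY law]) auto
    show "regularly_varying M NZ (\<lambda>\<omega>. \<psi> (X \<omega>, Y \<omega>)) (min (\<alpha>X / aX) (\<alpha>Y / aY))
        (scale_measure (1 / emeasure \<eta>\<^sub>0 {z \<in> space \<eta>\<^sub>0. NZ z > 1}) \<eta>\<^sub>0)"
      unfolding scale regularly_varying_def \<gamma>_eq[symmetric]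
    proof (intro conjI allI impI ballI)
      show "0 < \<gamma>"
        using X.\<gamma>_pos Y.\<gamma>_pos by (simp add: \<gamma>_def)
      show "radon_measure ?S"
        by (rule radon_measure_scaled_\<eta>\<^sub>0) simp
      show "emeasure ?S (space ?S) \<noteq> 0"
        using nonnull m by (simp add: space_scale_measure ennreal_eq_0_iff)
      fix t :: real and A assume "0 < t" "A \<in> sets ?S"
      then show "emeasure ?S ((\<lambda>x. t *\<^sub>R x) ` A) = ennreal (t powr - \<gamma>) * emeasure ?S A"
        by (simp add: \<eta>\<^sub>0_homogeneous mult_ac)
    qed (fact Zm vague)+
  qed
qed

end
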